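(* Let $T$ be a map from $[0,1]$ to $[0,1]$ preserving a probability measure $\mu$ on $[0,1]$. Assume that $T$ is $\mathcal{BV}$-contracting, that $f\in\mathcal{BV}$, and that $$\sigma^2:=\mu\big((f-\mu(f))^2\big)+2\sum_{n\ge1}\mu\big(f\circ T^n\cdot(f-\mu(f))\big)>0.$$ For each $n$, on the probability space $([0,1],\mu)$ (so $\mathbb{P}=\mu$), let $X_k=f\circ T^{n-k+1}-\mu(f)$, $1\le k\le n$, and let $W_n^\circ$ be the block self-normalized sum of $X_1,\dots,X_n$ with block length $m$ defined in the context. [i] Let $m=\lfloor n^{2/7}\rfloor$. Then $$\frac{\mathbb{P}(W_n^\circ\ge x)}{1-\Phi(x)}=1+o(1)$$ uniformly for $0\le x=o(n^{1/14}/\sqrt{\ln n})$ as $n\to\infty$. [ii] Assume $m=m(n)\to\infty$ and $n^{1/2}/m\to\infty$ as $n\to\infty$. Let $(a_n)$ be any sequence of real numbers such that $a_n\to0$ and $a_nn^{1/2}/m\to\infty$ as $n\to\infty$. Then, for each Borel set $B\subset\mathbb{R}$, $$-\inf_{x\in B^o}\frac{x^2}{2}\le\liminf_{n\to\infty}a_n^2\ln\mathbb{P}\big(a_nW_n^\circ\in B\big)\le\limsup_{n\to\infty}a_n^2\ln\mathbb{P}\big(a_nW_n^\circ\in B\big)\le-\inf_{x\in\overline{B}}\frac{x^2}{2},$$ where $B^o$ and $\overline{B}$ denote the interior and the closure of $B$, respectively.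
   Context: $\mathcal{BV}$ is the class of functions of bounded variation from $[0,1]$ to $\mathbb{R}$. For $f\in\mathcal{BV}$, $\|df\|$ is the total variation norm of the measure $df$: $\|df\|=\sup\{\int g\,df:\ \|g\|_\infty\le1\}$. A Markov kernel $K$ is said to be $\mathcal{BV}$-contracting if there exist two constants $\kappa>0$ and $\rho\in[0,1)$ such that $\|dK^n(f)\|\le\kappa\rho^n\|df\|$ for all $n\ge1$ and $f\in\mathcal{BV}$. The Perron-Frobenius operator $K$ of $T$, from $L^2([0,1],\mu)$ to $L^2([0,1],\mu)$, is defined by $$\int_0^1(Kh)(x)f(x)\,\mu(dx)=\int_0^1h(x)(f\circ T)(x)\,\mu(dx).$$ It is viewed as a Markov kernel with invariant measure $\mu$. The map $T$ is said to be $\mathcal{BV}$-contracting if its Perron-Frobenius operator is $\mathcal{BV}$-contracting. $\mu(f)=\int f\,d\mu$, and $\Phi$ is the standard normal distribution function. For an integer $m=m(n)\in[1,n]$: $k=\lfloor n/m\rfloor$, $H_j=\{i:m(j-1)+1\le i\le mj\}$, $S_j^\circ=\sum_{i\in H_j}X_i$ for $1\le j\le k$, $(V_k^\circ)^2=\sum_{j=1}^k(S_j^\circ)^2$, and $W_n^\circ=\big(\sum_{j=1}^kS_j^\circ\big)/V_k^\circ$ (with the convention $W_n^\circ=0$ when $V_k^\circ=0$). "Uniformly for $0\le x=o(b_n)$" means: for every sequence $x_n\ge0$ with $x_n=o(b_n)$, the convergence is uniform over $0\le x\le x_n$. Conventions: $\inf\emptyset=+\infty$, $\ln0=-\infty$.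 *)

theory Defs
  imports "HOL-Probability.Probability" "HOL-Library.Landau_Symbols"
begin

section \<open>Functions of bounded variation on the unit interval\<close>

text \<open>
  Real functions on \<open>[0,1]\<close> are represented by functions of type \<^typ>\<open>real \<Rightarrow> real\<close>
  of which only the values on \<open>{0..1}\<close> matter.
\<close>

definition unit_partition :: "nat \<Rightarrow> (nat \<Rightarrow> real) \<Rightarrow> bool" where
  "unit_partition N t \<longleftrightarrow> t 0 = 0 \<and> t N = 1 \<and> (\<forall>i<N. t i < t (Suc i))"

definition BV :: "(real \<Rightarrow> real) set" where
  "BV = {f. \<exists>C. \<forall>N t. unit_partition N t \<longrightarrow> (\<Sum>i<N. \<bar>f (t (Suc i)) - f (t i)\<bar>) \<le> C}"

definition step_fun :: "nat \<Rightarrow> (nat \<Rightarrow> real) \<Rightarrow> (nat \<Rightarrow> real) \<Rightarrow> real \<Rightarrow> real" where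
  "step_fun N t c x = (\<Sum>i<N. c i * indicator {t i<..t (Suc i)} x)"

text \<open>The integral \<open>\<integral> g df\<close> of \<open>g = step_fun N t c\<close>, where \<open>df ((s,t]) = f t - f s\<close>.\<close>

definition step_integral :: "nat \<Rightarrow> (nat \<Rightarrow> real) \<Rightarrow> (nat \<Rightarrow> real) \<Rightarrow> (real \<Rightarrow> real) \<Rightarrow> real" where
  "step_integral N t c f = (\<Sum>i<N. c i * (f (t (Suc i)) - f (t i)))"

text \<open>
  The total variation norm \<open>\<parallel>df\<parallel> = sup {\<integral> g df | \<parallel>g\<parallel>\<^sub>\<infinity> \<le> 1}\<close>.
  As a function \<open>f\<close> of bounded variation need not be right-continuous, \<open>df\<close> is the additive
  set function \<open>(s,t] \<mapsto> f t - f s\<close>, and \<open>g\<close> ranges over the step functions on which its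
  integral is defined.  If \<open>f\<close> is right-continuous, \<open>df\<close> extends to the Lebesgue-Stieltjes signed
  measure and step functions suffice to attain its total variation norm.  Passing to that measure
  for an arbitrary \<open>f\<close> (that is, replacing \<open>f t\<close> by \<open>f (t+)\<close>) would instead make
  \<open>\<parallel>df\<parallel>\<close> blind to isolated values of \<open>f\<close>, which matter when \<open>\<mu>\<close> has atoms.
\<close>

definition dnorm :: "(real \<Rightarrow> real) \<Rightarrow> real" where
  "dnorm f = Sup {step_integral N t c f | N t c.
     unit_partition N t \<and> (\<forall>x\<in>{0..1}. \<bar>step_fun N t c x\<bar> \<le> 1)}"

section \<open>Markov kernels and the Perron-Frobenius operator\<close>

definition unit_prob :: "real measure \<Rightarrow> bool" where
  "unit_prob \<mu> \<longleftrightarrow> prob_space \<mu> \<and> sets \<mu> = sets (restrict_space borel {0..1})"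

definition measure_preserving :: "real measure \<Rightarrow> (real \<Rightarrow> real) \<Rightarrow> bool" where
  "measure_preserving \<mu> T \<longleftrightarrow> T \<in> measurable \<mu> \<mu> \<and> distr \<mu> \<mu> T = \<mu>"

definition square_integrable :: "real measure \<Rightarrow> (real \<Rightarrow> real) \<Rightarrow> bool" where
  "square_integrable \<mu> h \<longleftrightarrow> h \<in> borel_measurable \<mu> \<and> integrable \<mu> (\<lambda>x. (h x)\<^sup>2)"

definition markov_kernel :: "real measure \<Rightarrow> (real \<Rightarrow> real measure) \<Rightarrow> bool" where
  "markov_kernel \<mu> K \<longleftrightarrow> K \<in> measurable \<mu> (prob_algebra \<mu>)"

definition kernel_op :: "(real \<Rightarrow> real measure) \<Rightarrow> (real \<Rightarrow> real) \<Rightarrow> real \<Rightarrow> real" where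
  "kernel_op K h x = (\<integral>y. h y \<partial>K x)"

definition perron_frobenius_kernel ::
    "real measure \<Rightarrow> (real \<Rightarrow> real) \<Rightarrow> (real \<Rightarrow> real measure) \<Rightarrow> bool" where
  "perron_frobenius_kernel \<mu> T K \<longleftrightarrow> markov_kernel \<mu> K \<and>
     (\<forall>h. square_integrable \<mu> h \<longrightarrow> square_integrable \<mu> (kernel_op K h) \<and>
        (\<forall>f. square_integrable \<mu> f \<longrightarrow>
           (\<integral>x. kernel_op K h x * f x \<partial>\<mu>) = (\<integral>x. h x * f (T x) \<partial>\<mu>)))"

text \<open>
  The Perron-Frobenius operator acts on \<open>L\<^sup>2(\<mu>)\<close>, so \<open>K\<^sup>n f\<close> is only determined up to
  \<open>\<mu>\<close>-null sets, while \<^const>\<open>dnorm\<close> depends on the pointwise values: the bound on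
  \<open>\<parallel>dK\<^sup>n f\<parallel>\<close> is a bound for some version \<open>g\<close> of \<open>K\<^sup>n f\<close>.
\<close>

definition BV_contracting_kernel :: "real measure \<Rightarrow> (real \<Rightarrow> real measure) \<Rightarrow> bool" where
  "BV_contracting_kernel \<mu> K \<longleftrightarrow>
     (\<exists>\<kappa> \<rho>. \<kappa> > 0 \<and> 0 \<le> \<rho> \<and> \<rho> < 1 \<and>
        (\<forall>n\<ge>1. \<forall>f\<in>BV. \<exists>g\<in>BV. (AE x in \<mu>. (kernel_op K ^^ n) f x = g x) \<and>
           dnorm g \<le> \<kappa> * \<rho> ^ n * dnorm f))"

text \<open>Any two Perron-Frobenius kernels of \<open>T\<close> agree \<open>\<mu>\<close>-almost everywhere, so the choice of
  \<open>K\<close> below is immaterial.\<close>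

definition BV_contracting :: "real measure \<Rightarrow> (real \<Rightarrow> real) \<Rightarrow> bool" where
  "BV_contracting \<mu> T \<longleftrightarrow>
     (\<exists>K. perron_frobenius_kernel \<mu> T K \<and> BV_contracting_kernel \<mu> K)"

definition asymp_var :: "real measure \<Rightarrow> (real \<Rightarrow> real) \<Rightarrow> (real \<Rightarrow> real) \<Rightarrow> real" where
  "asymp_var \<mu> T f =
     (let m = (\<integral>x. f x \<partial>\<mu>) in
        (\<integral>x. (f x - m)\<^sup>2 \<partial>\<mu>) + 2 * (\<Sum>n. \<integral>x. f ((T ^^ Suc n) x) * (f x - m) \<partial>\<mu>))"

section \<open>Block self-normalized sums\<close>

definition obs ::
    "real measure \<Rightarrow> (real \<Rightarrow> real) \<Rightarrow> (real \<Rightarrow> real) \<Rightarrow> nat \<Rightarrow> nat \<Rightarrow> real \<Rightarrow> real" where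
  "obs \<mu> T f n k x = f ((T ^^ (n - k + 1)) x) - (\<integral>y. f y \<partial>\<mu>)"

definition block_sum :: "(nat \<Rightarrow> 'a \<Rightarrow> real) \<Rightarrow> nat \<Rightarrow> nat \<Rightarrow> 'a \<Rightarrow> real" where
  "block_sum X m j x = (\<Sum>i\<in>{m * (j - 1) + 1..m * j}. X i x)"

definition block_norm :: "(nat \<Rightarrow> 'a \<Rightarrow> real) \<Rightarrow> nat \<Rightarrow> nat \<Rightarrow> 'a \<Rightarrow> real" where
  "block_norm X m n x = sqrt (\<Sum>j\<in>{1..n div m}. (block_sum X m j x)\<^sup>2)"

text \<open>Division by zero in HOL yields the convention \<open>W = 0\<close> when the normalization vanishes.\<close>

definition block_self_normalized :: "(nat \<Rightarrow> 'a \<Rightarrow> real) \<Rightarrow> nat \<Rightarrow> nat \<Rightarrow> 'a \<Rightarrow> real" where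
  "block_self_normalized X m n x = (\<Sum>j\<in>{1..n div m}. block_sum X m j x) / block_norm X m n x"

definition W_circ ::
    "real measure \<Rightarrow> (real \<Rightarrow> real) \<Rightarrow> (real \<Rightarrow> real) \<Rightarrow> nat \<Rightarrow> nat \<Rightarrow> real \<Rightarrow> real" where
  "W_circ \<mu> T f m n = block_self_normalized (obs \<mu> T f n) m n"

definition std_normal_cdf :: "real \<Rightarrow> real" where
  "std_normal_cdf = cdf std_normal_distribution"

definition ln_ext :: "real \<Rightarrow> ereal" where
  "ln_ext p = (if p = 0 then -\<infinity> else ereal (ln p))"

end

theory Submission
  imports Defs "HOL-Real_Asymp.Real_Asymp"
begin

text \<open>
  With \<open>g = f - \<mu>(f)\<close> and \<open>h = \<Sum>\<^sub>i K\<^sup>i g\<close>, \<open>p = h - g\<close> (both of bounded variation by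
  contraction), \<open>g = q + p \<circ> T - p\<close> where \<open>q = h - p \<circ> T\<close> is a martingale difference
  for the decreasing \<open>\<sigma>\<close>-fields \<open>T\<^sup>-\<^sup>i\<close>; contraction applied to \<open>h\<^sup>2\<close> and \<open>p\<^sup>2\<close> makes the
  conditional expectations of \<open>q\<^sup>2\<close> converge to \<open>\<sigma>\<^sup>2\<close> exponentially fast. Up to a
  coboundary the block sums, rescaled to unit total variance, thus form a bounded martingale array
  \<open>\<eta>\<close> with nearly constant conditional variance.

  For the Cramer asymptotics, the event \<open>M \<ge> x * sqrt Q\<close>, where \<open>M = \<Sum> \<eta>\<close> and
  \<open>Q = \<Sum> \<eta>\<^sup>2\<close>, is compared with \<open>\<Sum> (\<eta> - x / 2 * (\<eta>\<^sup>2 - 1 / k)) \<ge> x\<close>. The tail of this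
  linear sum is obtained by Lindeberg replacement in the smoothed normal tail; bounding the Taylor
  remainders by multiples of \<open>exp (- x * z)\<close> makes the error small relative to the normal tail at
  \<open>x\<close>. The large deviation principle needs only logarithmic precision: the Chernoff bound and
  exponential tilting for \<open>M\<close>, together with exponential concentration of \<open>Q\<close> at \<open>1\<close>.
\<close>

section \<open>Functions of bounded variation\<close>

text \<open>Two effects fix the exponents of the Cramer range. A block is a bounded summand of
  relative size \<open>m / sqrt n\<close>, so the replacement argument needs
  \<open>x^3 * m / sqrt n\<close> small; the coboundary perturbs the normalization by
  \<open>1 / sqrt m\<close>, so the threshold shift needs \<open>x^2 / sqrt m\<close> small. Both
  limits are \<open>n powr (1/14)\<close> exactly when \<open>m\<close> is of order
  \<open>n powr (2/7)\<close>. The factor \<open>sqrt (ln n)\<close> pays for cutting off the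
  Gaussian smoothing where its tail beats the polynomial factor in \<open>x\<close>. Normal tails in
  this range are far below any power of \<open>n\<close>, so an additive error bound would say
  nothing. The observations run backwards along the orbit. Hence a sum of \<open>k + 1\<close> terms
  along the orbit is its first term plus a function of \<open>T\<close>, and that function has the
  law of the sum of \<open>k\<close> terms by invariance. Testing the first term against functions
  of \<open>T\<close> is therefore all the conditioning that is needed: each estimate is a one-step
  inequality that is iterated, and it applies to blocks with \<open>T ^^ m\<close> in place of
  \<open>T\<close>.\<close>

definition variation :: "nat \<Rightarrow> (nat \<Rightarrow> real) \<Rightarrow> (real \<Rightarrow> real) \<Rightarrow> real" where
  "variation N t f = (\<Sum>i<N. \<bar>f (t (Suc i)) - f (t i)\<bar>)"

lemma variation_nonneg: "0 \<le> variation N t f"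
  by (simp add: variation_def sum_nonneg)

lemma variation_cong:
  assumes "\<And>i. i \<le> N \<Longrightarrow> f (t i) = g (u i)"
  shows "variation N t f = variation N u g"
  unfolding variation_def by (intro sum.cong refl) (simp add: assms)

lemma strict_chain:
  assumes "\<forall>i<N. t i \<le> t (Suc i)"
  shows "\<exists>N' t'. t' 0 = t 0 \<and> t' N' = t N \<and> (\<forall>i<N'. t' i < t' (Suc i)) \<and>
           variation N' t' f = variation N t f"
  using assms
proof (induction N)
  case 0
  show ?case by (intro exI[of _ 0] exI[of _ t]) (simp add: variation_def)
next
  case (Suc N)
  then obtain N' t' where *: "t' 0 = t 0" "t' N' = t N" "\<forall>i<N'. t' i < t' (Suc i)"
     "variation N' t' f = variation N t f"
    by auto
  show ?case
  proof (cases "t (Suc N) = t N")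
    case True
    with * show ?thesis
      by (intro exI[of _ N'] exI[of _ t']) (simp add: variation_def)
  next
    case False
    define u where "u = t'(Suc N' := t (Suc N))"
    have "t N < t (Suc N)" using Suc.prems False by (simp add: order_less_le)
    then have "\<forall>i<Suc N'. u i < u (Suc i)" using * by (auto simp: u_def less_Suc_eq)
    moreover have "variation (Suc N') u f = variation (Suc N) t f"
      using * variation_cong[of N' f u f t'] by (simp add: variation_def u_def)
    moreover have "u 0 = t 0" "u (Suc N') = t (Suc N)" using * by (auto simp: u_def)
    ultimately show ?thesis by blast
  qed
qed

text \<open>The half-open cells are disjoint, so a right endpoint sees a single coefficient. This
  turns the sup bound on a step function into bounds on its coefficients.\<close>

lemma step_fun_at_right_endpoint:
  assumes "unit_partition N t" "i < N"
  shows "step_fun N t c (t (Suc i)) = c i"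
proof -
  have m: "t a < t b" if "a < b" "b \<le> N" for a b
    using that
  proof (induction b)
    case (Suc b)
    then show ?case using assms unfolding unit_partition_def
      by (metis Suc_leD Suc_le_lessD less_antisym less_trans)
  qed simp
  have "c j * indicator {t j<..t (Suc j)} (t (Suc i)) = (if j = i then c i else 0)" if "j < N" for j
  proof -
    consider "j < i" | "j = i" | "i < j" by linarith
    then show ?thesis
    proof cases
      case 1
      then have "t (Suc j) < t (Suc i)" using m[of "Suc j" "Suc i"] assms by simp
      with 1 show ?thesis by (auto simp: indicator_def)
    next
      case 2
      then show ?thesis using m[of i "Suc i"] assms by (auto simp: indicator_def)
    next
      case 3
      then have "t (Suc i) \<le> t j" using m[of "Suc i" j] that by (cases "Suc i = j") auto
      with 3 show ?thesis by (auto simp: indicator_def)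
    qed
  qed
  then have "step_fun N t c (t (Suc i)) = (\<Sum>j<N. if j = i then c i else 0)"
    unfolding step_fun_def by (intro sum.cong) auto
  then show ?thesis using assms by simp
qed

lemma unit_partition_bounds:
  assumes "unit_partition N t" "i \<le> N"
  shows "t i \<in> {0..1}"
proof -
  have "t i \<le> t N"
  proof (rule inc_induct[OF assms(2)])
    fix n assume "n < N" "t (Suc n) \<le> t N"
    moreover have "t n < t (Suc n)"
      using assms(1) calculation by (simp add: unit_partition_def)
    ultimately show "t n \<le> t N" by linarith
  qed simp
  moreover have "0 \<le> t i"
    using assms
  proof (induction i)
    case (Suc i)
    then have "t i < t (Suc i)" "0 \<le> t i" by (auto simp: unit_partition_def)
    then show ?case by simp
  qed (simp add: unit_partition_def)
  ultimately show ?thesis using assms by (simp add: unit_partition_def)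
qed

lemma step_integral_le_variation:
  assumes "unit_partition N t" "\<forall>x\<in>{0..1}. \<bar>step_fun N t c x\<bar> \<le> 1"
  shows "step_integral N t c f \<le> variation N t f"
  unfolding step_integral_def variation_def
proof (rule sum_mono)
  fix i assume i: "i \<in> {..<N}"
  then have "\<bar>c i\<bar> \<le> 1"
    using assms(2) unit_partition_bounds[OF assms(1), of "Suc i"]
      step_fun_at_right_endpoint[OF assms(1), of i c] by fastforce
  then have "\<bar>c i * (f (t (Suc i)) - f (t i))\<bar> \<le> 1 * \<bar>f (t (Suc i)) - f (t i)\<bar>"
    unfolding abs_mult by (intro mult_right_mono) auto
  then have "\<bar>c i * (f (t (Suc i)) - f (t i))\<bar> \<le> \<bar>f (t (Suc i)) - f (t i)\<bar>" by simp
  then show "c i * (f (t (Suc i)) - f (t i)) \<le> \<bar>f (t (Suc i)) - f (t i)\<bar>" by (rule order_trans[OF abs_ge_self])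
qed

lemma BV_I:
  assumes "\<And>N t. unit_partition N t \<Longrightarrow> variation N t f \<le> C"
  shows "f \<in> BV"
  using assms unfolding BV_def variation_def by blast

text \<open>Taking for \<open>c i\<close> the sign of the increment makes the step integral equal to
  the variation. Membership in BV supplies the upper bound that \<open>Sup\<close> needs to be
  meaningful.\<close>

lemma strict_variation_le_dnorm:
  assumes f: "f \<in> BV" and p: "unit_partition N t"
  shows "variation N t f \<le> dnorm f"
proof -
  obtain C where C: "\<And>N t. unit_partition N t \<Longrightarrow> variation N t f \<le> C"
    using f unfolding BV_def variation_def by auto
  define c where "c i = sgn (f (t (Suc i)) - f (t i))" for i
  have "\<bar>step_fun N t c x\<bar> \<le> 1" if x: "x \<in> {0..1}" for x
  proof (cases "\<exists>i<N. x \<in> {t i<..t (Suc i)}")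
    case True
    then obtain i where i: "i < N" "x \<in> {t i<..t (Suc i)}" by auto
    have mono: "t a \<le> t b" if "a \<le> b" "b \<le> N" for a b
    proof (rule inc_induct[OF that(1)])
      fix n assume "a \<le> n" "n < b" "t (Suc n) \<le> t b"
      moreover have "t n < t (Suc n)"
        using p that calculation by (simp add: unit_partition_def)
      ultimately show "t n \<le> t b" by linarith
    qed simp
    have "indicator {t j<..t (Suc j)} x = (if j = i then 1 else (0::real))" if "j < N" for j
    proof -
      consider "j < i" | "j = i" | "i < j" by linarith
      then show ?thesis
        using mono[of "Suc j" i] mono[of "Suc i" j] i that by cases (auto simp: indicator_def)
    qed
    then have "step_fun N t c x = (\<Sum>j<N. if j = i then c j else 0)"
      unfolding step_fun_def by (intro sum.cong) auto
    then show ?thesis using i by (simp add: c_def abs_sgn_eq)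
  next
    case False
    then have "step_fun N t c x = 0"
      unfolding step_fun_def by (intro sum.neutral) (auto simp: indicator_def)
    then show ?thesis by simp
  qed
  moreover have "step_integral N t c f = variation N t f"
    unfolding step_integral_def variation_def c_def
    by (intro sum.cong) (auto simp: sgn_if)
  ultimately have "variation N t f \<in> {step_integral N t c f | N t c.
     unit_partition N t \<and> (\<forall>x\<in>{0..1}. \<bar>step_fun N t c x\<bar> \<le> 1)}" (is "_ \<in> ?S")
    using p by (intro CollectI exI[of _ N] exI[of _ t] exI[of _ c]) auto
  moreover have "bdd_above ?S"
    by (rule bdd_aboveI[of _ C]) (use step_integral_le_variation C in \<open>blast intro: order_trans\<close>)
  ultimately show ?thesis unfolding dnorm_def by (rule cSup_upper)
qed

lemma unit_partition_trivial: "unit_partition 1 real"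
  by (simp add: unit_partition_def)

lemma dnorm_nonneg: "f \<in> BV \<Longrightarrow> 0 \<le> dnorm f"
  using strict_variation_le_dnorm[OF _ unit_partition_trivial] variation_nonneg
  by (meson order_trans)

text \<open>Completing the chain by the point 1 can only add variation; \<open>strict_chain\<close>
  then removes repetitions. Weak chains ending anywhere are what the later arguments
  produce.\<close>

lemma variation_le_dnorm:
  assumes f: "f \<in> BV" and t: "t 0 = 0" "\<forall>i<N. t i \<le> t (Suc i)" "t N \<le> 1"
  shows "variation N t f \<le> dnorm f"
proof -
  define u where "u = t(Suc N := 1)"
  obtain N' t' where *: "t' 0 = u 0" "t' N' = u (Suc N)" "\<forall>i<N'. t' i < t' (Suc i)"
     "variation N' t' f = variation (Suc N) u f"
    using strict_chain[of "Suc N" u f] t by (auto simp: u_def less_Suc_eq)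
  have "variation N t f = variation N u f" by (rule variation_cong) (auto simp: u_def)
  also have "\<dots> \<le> variation (Suc N) u f" by (simp add: variation_def)
  also have "\<dots> \<le> dnorm f"
    using strict_variation_le_dnorm[OF f, of N' t'] * t by (simp add: unit_partition_def u_def)
  finally show ?thesis .
qed

lemma BV_diff_le_dnorm:
  assumes f: "f \<in> BV" and "x \<in> {0..1}" "y \<in> {0..1}"
  shows "\<bar>f x - f y\<bar> \<le> dnorm f"
proof -
  have *: "\<bar>f y - f x\<bar> \<le> dnorm f" if "0 \<le> x" "x \<le> y" "y \<le> 1" for x y
  proof -
    \<comment> \<open>The chain 0, x, y; its first two points coincide when x = 0.\<close>
    define t where "t = (\<lambda>i::nat. if i = 0 then 0 else if i = 1 then x else y)"
    have "variation 2 t f \<le> dnorm f"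
      using that by (intro variation_le_dnorm[OF f]) (auto simp: t_def)
    then show ?thesis by (simp add: variation_def t_def numeral_2_eq_2)
  qed
  then show ?thesis
    using *[of x y] *[of y x] assms by (cases "x \<le> y") (auto simp: abs_minus_commute)
qed

lemma BV_bounded:
  assumes "f \<in> BV"
  shows "\<exists>C. \<forall>x\<in>{0..1}. \<bar>f x\<bar> \<le> C"
proof (intro exI[of _ "\<bar>f 0\<bar> + dnorm f"] ballI)
  fix x :: real assume "x \<in> {0..1}"
  then show "\<bar>f x\<bar> \<le> \<bar>f 0\<bar> + dnorm f"
    using BV_diff_le_dnorm[OF assms, of x 0] by auto
qed

text \<open>Jordan decomposition: the variation \<open>V\<close> on \<open>[0,x]\<close> and \<open>V - f\<close> are both monotone.\<close>

lemma BV_measurable: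
  assumes f: "f \<in> BV"
  shows "f \<in> borel_measurable (restrict_space borel {0..1})"
proof -
  define S where "S x = {variation N t f | N t. t 0 = 0 \<and> (\<forall>i<N. t i \<le> t (Suc i)) \<and> t N = x}" for x
  define V where "V x = Sup (S x)" for x
  have bdd: "bdd_above (S x)" if "x \<le> 1" for x
    unfolding bdd_above_def S_def using variation_le_dnorm[OF f] that
    by (intro exI[of _ "dnorm f"]) auto
  have ne: "S x \<noteq> {}" if "0 \<le> x" for x
  proof -
    have "variation 1 (\<lambda>i. if i = 0 then 0 else x) f \<in> S x"
      using that unfolding S_def by (intro CollectI exI conjI) (rule refl, auto)
    then show ?thesis by auto
  qed
  \<comment> \<open>Appending \<open>y\<close> to a chain that ends at \<open>x\<close> adds exactly
    the jump between them. Both monotonicity claims are read off from this inequality.\<close>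
  have incr: "V x + \<bar>f y - f x\<bar> \<le> V y" if "0 \<le> x" "x \<le> y" "y \<le> 1" for x y
  proof -
    have "V x \<le> V y - \<bar>f y - f x\<bar>"
      unfolding V_def
    proof (rule cSup_least[OF ne])
      fix v assume "v \<in> S x"
      then obtain N t where t: "v = variation N t f" "t 0 = 0" "\<forall>i<N. t i \<le> t (Suc i)" "t N = x"
        unfolding S_def by auto
      define u where "u = t(Suc N := y)"
      have "variation (Suc N) u f = v + \<bar>f y - f x\<bar>"
        using t variation_cong[of N f u f t] by (simp add: variation_def u_def)
      moreover have "variation (Suc N) u f \<in> S y"
        using t that unfolding S_def
        by (intro CollectI exI[of _ "Suc N"] exI[of _ u]) (auto simp: u_def less_Suc_eq)
      ultimately have "v + \<bar>f y - f x\<bar> \<le> Sup (S y)"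
        using cSup_upper[OF _ bdd[OF that(3)]] by simp
      then show "v \<le> Sup (S y) - \<bar>f y - f x\<bar>" by simp
    qed (use that in auto)
    then show ?thesis by simp
  qed
  have "mono_on {0..1} V" "mono_on {0..1} (\<lambda>x. V x - f x)"
  proof -
    have "V x \<le> V y" "V x - f x \<le> V y - f y" if "x \<in> {0..1}" "y \<in> {0..1}" "x \<le> y" for x y
      using incr[of x y] that by (auto simp: abs_le_iff abs_if split: if_splits)
    then show "mono_on {0..1} V" "mono_on {0..1} (\<lambda>x. V x - f x)"
      by (blast intro: mono_onI)+
  qed
  then have "V \<in> borel_measurable (restrict_space borel {0..1})"
    "(\<lambda>x. V x - f x) \<in> borel_measurable (restrict_space borel {0..1})"
    by (auto intro!: borel_measurable_mono_on_fnc)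
  then have "(\<lambda>x. V x - (V x - f x)) \<in> borel_measurable (restrict_space borel {0..1})"
    by measurable
  then show ?thesis by simp
qed

lemma BV_sq:
  assumes f: "f \<in> BV"
  shows "(\<lambda>x. (f x)\<^sup>2) \<in> BV"
proof -
  obtain C where C: "\<forall>x\<in>{0..1}. \<bar>f x\<bar> \<le> C" using BV_bounded[OF f] by auto
  show ?thesis
  proof (rule BV_I)
    fix N t assume p: "unit_partition N t"
    have "variation N t (\<lambda>x. (f x)\<^sup>2) \<le> 2 * C * variation N t f"
      unfolding variation_def sum_distrib_left
    proof (rule sum_mono)
      fix i assume "i \<in> {..<N}"
      then have "t i \<in> {0..1}" "t (Suc i) \<in> {0..1}"
        using unit_partition_bounds[OF p] by auto
      then have "\<bar>f (t (Suc i))\<bar> \<le> C" "\<bar>f (t i)\<bar> \<le> C" using C by blast+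
      then have "\<bar>f (t (Suc i)) + f (t i)\<bar> \<le> 2 * C" by linarith
      then show "\<bar>(f (t (Suc i)))\<^sup>2 - (f (t i))\<^sup>2\<bar> \<le> 2 * C * \<bar>f (t (Suc i)) - f (t i)\<bar>"
        using mult_right_mono[of "\<bar>f (t (Suc i)) + f (t i)\<bar>" "2 * C" "\<bar>f (t (Suc i)) - f (t i)\<bar>"]
        by (simp only: power2_eq_square square_diff_square_factored abs_mult abs_ge_zero)
    qed
    also have "\<dots> \<le> 2 * C * dnorm f"
      using strict_variation_le_dnorm[OF f p] C[rule_format, of 0] by (intro mult_left_mono) auto
    finally show "variation N t (\<lambda>x. (f x)\<^sup>2) \<le> 2 * C * dnorm f" .
  qed
qed

lemma BV_diff_const: "f \<in> BV \<Longrightarrow> (\<lambda>x. f x - c) \<in> BV"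
  unfolding BV_def by simp

text \<open>The finite sum over a partition is exchanged with the series, and the sum of the
  \<open>dnorm\<close> bounds every partition. Pointwise summability is a separate hypothesis
  because \<open>dnorm\<close> does not see constants.\<close>

lemma BV_suminf:
  assumes G: "\<And>i. G i \<in> BV" and s: "summable (\<lambda>i. dnorm (G i))"
    and p: "\<And>x. x \<in> {0..1} \<Longrightarrow> summable (\<lambda>i. G i x)"
  shows "(\<lambda>x. \<Sum>i. G i x) \<in> BV"
proof (rule BV_I)
  fix N t assume t: "unit_partition N t"
  have a: "summable (\<lambda>i. \<bar>G i (t (Suc j)) - G i (t j)\<bar>)" if "j < N" for j
    by (rule summable_comparison_test'[OF s, of 0])
      (use that unit_partition_bounds[OF t] BV_diff_le_dnorm[OF G] in auto)
  have "variation N t (\<lambda>x. \<Sum>i. G i x) \<le> (\<Sum>j<N. \<Sum>i. \<bar>G i (t (Suc j)) - G i (t j)\<bar>)"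
    unfolding variation_def
  proof (rule sum_mono)
    fix j assume j: "j \<in> {..<N}"
    then have "(\<Sum>i. G i (t (Suc j))) - (\<Sum>i. G i (t j)) = (\<Sum>i. G i (t (Suc j)) - G i (t j))"
      using p unit_partition_bounds[OF t] by (intro suminf_diff) auto
    also have "\<bar>\<dots>\<bar> \<le> (\<Sum>i. \<bar>G i (t (Suc j)) - G i (t j)\<bar>)"
      using a j by (intro summable_rabs) auto
    finally show "\<bar>(\<Sum>i. G i (t (Suc j))) - (\<Sum>i. G i (t j))\<bar> \<le> (\<Sum>i. \<bar>G i (t (Suc j)) - G i (t j)\<bar>)" .
  qed
  also have "\<dots> = (\<Sum>i. variation N t (G i))"
    unfolding variation_def using a by (intro suminf_sum[symmetric]) auto
  also have "\<dots> \<le> (\<Sum>i. dnorm (G i))"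
  proof (intro suminf_le s)
    show "summable (\<lambda>i. variation N t (G i))"
      unfolding variation_def using a by (intro summable_sum) auto
  qed (use strict_variation_le_dnorm[OF G t] in auto)
  finally show "variation N t (\<lambda>x. \<Sum>i. G i x) \<le> (\<Sum>i. dnorm (G i))" .
qed

section \<open>Bounded functions and weak conditional bounds\<close>

text \<open>Bounded at every point rather than almost everywhere: the class is closed under
  products, exponentials and composition with \<open>T\<close> without any null sets, and every
  integral over it exists.\<close>

definition bmeas :: "'a measure \<Rightarrow> ('a \<Rightarrow> real) \<Rightarrow> bool" where
  "bmeas M \<phi> \<longleftrightarrow> \<phi> \<in> borel_measurable M \<and> (\<exists>C. \<forall>x\<in>space M. \<bar>\<phi> x\<bar> \<le> C)"

lemma bmeas_measurable [measurable_dest]: "bmeas M \<phi> \<Longrightarrow> \<phi> \<in> borel_measurable M"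
  by (simp add: bmeas_def)

lemma bmeasI: "\<phi> \<in> borel_measurable M \<Longrightarrow> (\<And>x. x \<in> space M \<Longrightarrow> \<bar>\<phi> x\<bar> \<le> C) \<Longrightarrow> bmeas M \<phi>"
  by (auto simp: bmeas_def)

lemma bmeas_bound:
  assumes "bmeas M \<phi>"
  obtains C where "C > 0" "\<And>x. x \<in> space M \<Longrightarrow> \<bar>\<phi> x\<bar> \<le> C"
proof -
  from assms obtain C where C: "\<forall>x\<in>space M. \<bar>\<phi> x\<bar> \<le> C" by (auto simp: bmeas_def)
  show ?thesis by (rule that[of "max 1 C"]) (use C in \<open>auto simp: le_max_iff_disj\<close>)
qed

lemma bmeas_const [simp, intro!]: "bmeas M (\<lambda>_. c)"
  by (auto simp: bmeas_def)

lemma bmeas_compose: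
  assumes \<phi>: "bmeas M \<phi>" and F: "continuous_on UNIV (F :: real \<Rightarrow> real)"
  shows "bmeas M (\<lambda>x. F (\<phi> x))"
proof -
  obtain C where C: "\<And>x. x \<in> space M \<Longrightarrow> \<bar>\<phi> x\<bar> \<le> C" using bmeas_bound[OF \<phi>] by blast
  have "compact (F ` {-C..C})"
    by (intro compact_continuous_image continuous_on_subset[OF F]) auto
  then obtain D where "\<forall>y\<in>F ` {-C..C}. norm y \<le> D"
    using compact_imp_bounded by (force simp: bounded_iff)
  then have D: "\<bar>F y\<bar> \<le> D" if "y \<in> {-C..C}" for y
    using that by simp
  show ?thesis
  proof (rule bmeasI[of _ _ D])
    show "(\<lambda>x. F (\<phi> x)) \<in> borel_measurable M"
      using borel_measurable_continuous_on[OF F bmeas_measurable[OF \<phi>]] .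
    show "\<bar>F (\<phi> x)\<bar> \<le> D" if "x \<in> space M" for x
      using C[OF that] by (intro D) (auto simp: abs_le_iff)
  qed
qed

lemma bmeas_add [intro!]:
  assumes "bmeas M \<phi>" "bmeas M \<psi>" shows "bmeas M (\<lambda>x. \<phi> x + \<psi> x)"
proof -
  obtain C where C: "\<And>x. x \<in> space M \<Longrightarrow> \<bar>\<phi> x\<bar> \<le> C" using bmeas_bound[OF assms(1)] by blast
  obtain D where D: "\<And>x. x \<in> space M \<Longrightarrow> \<bar>\<psi> x\<bar> \<le> D" using bmeas_bound[OF assms(2)] by blast
  have "\<bar>\<phi> x + \<psi> x\<bar> \<le> C + D" if "x \<in> space M" for x
    using C[OF that] D[OF that] by linarith
  moreover have "(\<lambda>x. \<phi> x + \<psi> x) \<in> borel_measurable M" using assms by measurable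
  ultimately show ?thesis by (intro bmeasI)
qed

lemma bmeas_mult [intro!]:
  assumes "bmeas M \<phi>" "bmeas M \<psi>" shows "bmeas M (\<lambda>x. \<phi> x * \<psi> x)"
proof -
  obtain C where C: "\<And>x. x \<in> space M \<Longrightarrow> \<bar>\<phi> x\<bar> \<le> C" using bmeas_bound[OF assms(1)] by blast
  obtain D where D: "\<And>x. x \<in> space M \<Longrightarrow> \<bar>\<psi> x\<bar> \<le> D" using bmeas_bound[OF assms(2)] by blast
  have "\<bar>\<phi> x * \<psi> x\<bar> \<le> C * D" if "x \<in> space M" for x
    using C[OF that] D[OF that] unfolding abs_mult by (intro mult_mono) linarith+
  moreover have "(\<lambda>x. \<phi> x * \<psi> x) \<in> borel_measurable M" using assms by measurable
  ultimately show ?thesis by (intro bmeasI)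
qed

lemma bmeas_uminus [intro!]: "bmeas M \<phi> \<Longrightarrow> bmeas M (\<lambda>x. - \<phi> x)"
  using bmeas_mult[of M "\<lambda>_. -1" \<phi>] by simp

lemma bmeas_diff [intro!]: "bmeas M \<phi> \<Longrightarrow> bmeas M \<psi> \<Longrightarrow> bmeas M (\<lambda>x. \<phi> x - \<psi> x)"
  using bmeas_add[of M \<phi> "\<lambda>x. - \<psi> x"] bmeas_uminus[of M \<psi>] by simp

lemma bmeas_divide_const [intro!]: "bmeas M \<phi> \<Longrightarrow> bmeas M (\<lambda>x. \<phi> x / c)"
  using bmeas_mult[of M \<phi> "\<lambda>_. inverse c"] by (simp add: field_simps)

lemma bmeas_power [intro!]: "bmeas M \<phi> \<Longrightarrow> bmeas M (\<lambda>x. \<phi> x ^ n)"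
  by (induction n) auto

lemma bmeas_sum [intro!]: "(\<And>i. i \<in> I \<Longrightarrow> bmeas M (\<phi> i)) \<Longrightarrow> bmeas M (\<lambda>x. \<Sum>i\<in>I. \<phi> i x)"
  by (induction I rule: infinite_finite_induct) auto

lemma bmeas_prod [intro!]: "(\<And>i. i \<in> I \<Longrightarrow> bmeas M (\<phi> i)) \<Longrightarrow> bmeas M (\<lambda>x. \<Prod>i\<in>I. \<phi> i x)"
  by (induction I rule: infinite_finite_induct) auto

lemma bmeas_exp [intro!]: "bmeas M \<phi> \<Longrightarrow> bmeas M (\<lambda>x. exp (\<phi> x))"
  by (rule bmeas_compose[where F = exp]) (auto intro: continuous_intros)

lemma bmeas_abs [intro!]: "bmeas M \<phi> \<Longrightarrow> bmeas M (\<lambda>x. \<bar>\<phi> x\<bar>)"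
  by (rule bmeas_compose[where F = abs]) (auto intro: continuous_intros)

lemma bmeas_indicator [intro!]: "{x \<in> space M. P x} \<in> sets M \<Longrightarrow> bmeas M (indicator {x \<in> space M. P x})"
  by (rule bmeasI[of _ _ 1]) (auto simp: indicator_def)

lemma bmeas_comp_measurable: "bmeas M \<phi> \<Longrightarrow> T \<in> measurable N M \<Longrightarrow> bmeas N (\<lambda>x. \<phi> (T x))"
  unfolding bmeas_def by (auto intro: measurable_compose) (metis measurable_space)

context prob_space
begin

lemma bmeas_integrable [intro!]:
  assumes "bmeas M \<phi>" shows "integrable M \<phi>"
proof -
  obtain C where "\<And>x. x \<in> space M \<Longrightarrow> \<bar>\<phi> x\<bar> \<le> C" using bmeas_bound[OF assms] by blast
  then show ?thesis
    using assms by (intro integrable_const_bound[of _ C] AE_I2) (auto simp: bmeas_def)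
qed

lemma integral_mono_bmeas:
  "bmeas M \<phi> \<Longrightarrow> bmeas M \<psi> \<Longrightarrow> (\<And>x. x \<in> space M \<Longrightarrow> \<phi> x \<le> \<psi> x) \<Longrightarrow> (\<integral>x. \<phi> x \<partial>M) \<le> (\<integral>x. \<psi> x \<partial>M)"
  by (intro integral_mono bmeas_integrable)

end

text \<open>The weak form of \<open>l \<le> E[\<xi> | T\<^sup>-\<^sup>1] \<le> u\<close>: conditioning on the \<open>\<sigma>\<close>-field generated
  by \<open>T\<close> means testing against the functions \<open>\<phi> \<circ> T\<close>.\<close>

definition cond_in :: "'a measure \<Rightarrow> ('a \<Rightarrow> 'a) \<Rightarrow> real \<Rightarrow> real \<Rightarrow> ('a \<Rightarrow> real) \<Rightarrow> bool" where
  "cond_in M T l u \<xi> \<longleftrightarrow> bmeas M \<xi> \<and>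
     (\<forall>\<phi>. bmeas M \<phi> \<longrightarrow> (\<forall>x\<in>space M. 0 \<le> \<phi> x) \<longrightarrow>
        l * (\<integral>x. \<phi> x \<partial>M) \<le> (\<integral>x. \<xi> x * \<phi> (T x) \<partial>M) \<and>
        (\<integral>x. \<xi> x * \<phi> (T x) \<partial>M) \<le> u * (\<integral>x. \<phi> x \<partial>M))"

locale preserving = prob_space M for M :: "'a measure" +
  fixes T :: "'a \<Rightarrow> 'a"
  assumes T_meas [measurable]: "T \<in> measurable M M" and T_inv: "distr M M T = M"
begin

lemma iter_meas [measurable]: "T ^^ n \<in> measurable M M"
  by (induction n) (auto intro: measurable_comp)

lemma iter_inv: "distr M M (T ^^ n) = M"
proof (induction n)
  case 0
  show ?case by (simp add: id_def distr_id)
next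
  case (Suc n)
  have "distr M M (T ^^ Suc n) = distr (distr M M (T ^^ n)) M T"
    by (subst distr_distr) simp_all
  then show ?case by (simp only: Suc T_inv)
qed

text \<open>Lets every result of the locale be used at block level, with \<open>T ^^ m\<close> as
  the map.\<close>

lemma iter_preserving: "preserving M (T ^^ n)"
  by unfold_locales (auto simp: iter_inv)

lemma iter_space [simp]: "x \<in> space M \<Longrightarrow> (T ^^ n) x \<in> space M"
  by (rule measurable_space[OF iter_meas])

lemma T_space [simp]: "x \<in> space M \<Longrightarrow> T x \<in> space M"
  by (rule measurable_space[OF T_meas])

lemma bmeas_T [intro!]: "bmeas M \<phi> \<Longrightarrow> bmeas M (\<lambda>x. \<phi> (T x))"
  by (rule bmeas_comp_measurable[OF _ T_meas])

lemma bmeas_iter [intro!]: "bmeas M \<phi> \<Longrightarrow> bmeas M (\<lambda>x. \<phi> ((T ^^ n) x))"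
  by (rule bmeas_comp_measurable[OF _ iter_meas])

lemma integral_T: "bmeas M \<phi> \<Longrightarrow> (\<integral>x. \<phi> (T x) \<partial>M) = (\<integral>x. \<phi> x \<partial>M)"
  using integral_distr[of T M M \<phi>] by (simp add: T_inv bmeas_def)

lemma prob_T:
  assumes "{x \<in> space M. P x} \<in> sets M"
  shows "measure M {x \<in> space M. P (T x)} = measure M {x \<in> space M. P x}"
proof -
  have "measure (distr M M T) {x \<in> space M. P x} = measure M (T -` {x \<in> space M. P x} \<inter> space M)"
    using assms by (intro measure_distr) simp_all
  also have "T -` {x \<in> space M. P x} \<inter> space M = {x \<in> space M. P (T x)}" by auto
  finally show ?thesis by (simp add: T_inv)
qed

lemma cond_inD:
  assumes "cond_in M T l u \<xi>" "bmeas M \<phi>" "\<forall>x\<in>space M. 0 \<le> \<phi> x"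
  shows "l * (\<integral>x. \<phi> x \<partial>M) \<le> (\<integral>x. \<xi> x * \<phi> (T x) \<partial>M)"
    "(\<integral>x. \<xi> x * \<phi> (T x) \<partial>M) \<le> u * (\<integral>x. \<phi> x \<partial>M)" "bmeas M \<xi>"
  using assms unfolding cond_in_def by auto

lemma cond_in_bmeas: "cond_in M T l u \<xi> \<Longrightarrow> bmeas M \<xi>"
  by (simp add: cond_in_def)

lemma cond_in_weaken:
  assumes "cond_in M T l u \<xi>" "l' \<le> l" "u \<le> u'"
  shows "cond_in M T l' u' \<xi>"
  unfolding cond_in_def
proof (intro conjI allI impI)
  fix \<phi> assume \<phi>: "bmeas M \<phi>" "\<forall>x\<in>space M. 0 \<le> \<phi> x"
  have I: "0 \<le> (\<integral>x. \<phi> x \<partial>M)" using \<phi> by (intro integral_nonneg_AE AE_I2) auto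
  note b = cond_inD(1,2)[OF assms(1) \<phi>(1) \<phi>(2)]
  from b(1) mult_right_mono[OF assms(2) I]
  show "l' * (\<integral>x. \<phi> x \<partial>M) \<le> (\<integral>x. \<xi> x * \<phi> (T x) \<partial>M)" by linarith
  from b(2) mult_right_mono[OF assms(3) I]
  show "(\<integral>x. \<xi> x * \<phi> (T x) \<partial>M) \<le> u' * (\<integral>x. \<phi> x \<partial>M)" by linarith
qed (use assms cond_in_bmeas in auto)

lemma cond_in_const: "cond_in M T c c (\<lambda>_. c)"
  by (simp add: cond_in_def integral_T)

lemma cond_in_add:
  assumes "cond_in M T l u \<xi>" "cond_in M T l' u' \<zeta>"
  shows "cond_in M T (l + l') (u + u') (\<lambda>x. \<xi> x + \<zeta> x)"
proof -
  have b [intro]: "bmeas M \<xi>" "bmeas M \<zeta>" using assms cond_in_bmeas by auto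
  have *: "(\<integral>x. (\<xi> x + \<zeta> x) * \<phi> (T x) \<partial>M) = (\<integral>x. \<xi> x * \<phi> (T x) \<partial>M) + (\<integral>x. \<zeta> x * \<phi> (T x) \<partial>M)"
    if "bmeas M \<phi>" for \<phi>
    unfolding distrib_right using that by (intro Bochner_Integration.integral_add) auto
  show ?thesis
    unfolding cond_in_def
  proof (intro conjI allI impI)
    fix \<phi> assume \<phi>: "bmeas M \<phi>" "\<forall>x\<in>space M. 0 \<le> \<phi> x"
    note b = cond_inD(1,2)[OF assms(1) \<phi>(1) \<phi>(2)] cond_inD(1,2)[OF assms(2) \<phi>(1) \<phi>(2)]
    show "(l + l') * (\<integral>x. \<phi> x \<partial>M) \<le> (\<integral>x. (\<xi> x + \<zeta> x) * \<phi> (T x) \<partial>M)"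
      unfolding *[OF \<phi>(1)] distrib_right[of l l'] using b by linarith
    show "(\<integral>x. (\<xi> x + \<zeta> x) * \<phi> (T x) \<partial>M) \<le> (u + u') * (\<integral>x. \<phi> x \<partial>M)"
      unfolding *[OF \<phi>(1)] distrib_right[of u u'] using b by linarith
  qed (use b in auto)
qed

lemma cond_in_cmult:
  assumes "cond_in M T l u \<xi>" "0 \<le> c"
  shows "cond_in M T (c * l) (c * u) (\<lambda>x. c * \<xi> x)"
  using assms unfolding cond_in_def by (auto simp: mult.assoc intro!: mult_left_mono)

lemma cond_in_uminus:
  assumes "cond_in M T l u \<xi>"
  shows "cond_in M T (- u) (- l) (\<lambda>x. - \<xi> x)"
  using assms unfolding cond_in_def by auto

text \<open>The way to treat nonlinear functions such as exponentials: they are enclosed between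
  polynomials in \<open>\<eta>\<close> whose conditional bounds are known.\<close>

lemma cond_in_mono:
  assumes "cond_in M T l u \<xi>" "cond_in M T l' u' \<zeta>" "bmeas M \<eta>"
    and "\<And>x. x \<in> space M \<Longrightarrow> \<xi> x \<le> \<eta> x" "\<And>x. x \<in> space M \<Longrightarrow> \<eta> x \<le> \<zeta> x"
  shows "cond_in M T l u' \<eta>"
  unfolding cond_in_def
proof (intro conjI allI impI)
  fix \<phi> assume \<phi>: "bmeas M \<phi>" "\<forall>x\<in>space M. 0 \<le> \<phi> x"
  note b = cond_in_bmeas[OF assms(1)] cond_in_bmeas[OF assms(2)]
  have "(\<integral>x. \<xi> x * \<phi> (T x) \<partial>M) \<le> (\<integral>x. \<eta> x * \<phi> (T x) \<partial>M)"
    using \<phi> b assms by (intro integral_mono_bmeas bmeas_mult bmeas_T mult_right_mono) auto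
  then show "l * (\<integral>x. \<phi> x \<partial>M) \<le> (\<integral>x. \<eta> x * \<phi> (T x) \<partial>M)"
    using cond_inD(1)[OF assms(1) \<phi>(1)] \<phi>(2) by force
  have "(\<integral>x. \<eta> x * \<phi> (T x) \<partial>M) \<le> (\<integral>x. \<zeta> x * \<phi> (T x) \<partial>M)"
    using \<phi> b assms by (intro integral_mono_bmeas bmeas_mult bmeas_T mult_right_mono) auto
  then show "(\<integral>x. \<eta> x * \<phi> (T x) \<partial>M) \<le> u' * (\<integral>x. \<phi> x \<partial>M)"
    using cond_inD(2)[OF assms(2) \<phi>(1)] \<phi>(2) by force
qed (use assms in auto)

text \<open>Only nonnegative test functions occur in \<open>cond_in\<close>; a signed one is split
  into its positive and negative parts, and the two bounds add up to the L1 norm.\<close>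

lemma cond_in_signed:
  assumes \<xi>: "cond_in M T (- c) c \<xi>" and \<phi>: "bmeas M \<phi>"
  shows "\<bar>\<integral>x. \<xi> x * \<phi> (T x) \<partial>M\<bar> \<le> c * (\<integral>x. \<bar>\<phi> x\<bar> \<partial>M)"
proof -
  define p n where "p x = (\<bar>\<phi> x\<bar> + \<phi> x) / 2" and "n x = (\<bar>\<phi> x\<bar> - \<phi> x) / 2" for x
  have [intro]: "bmeas M p" "bmeas M n" "bmeas M \<xi>"
    unfolding p_def n_def using \<phi> cond_in_bmeas[OF \<xi>] by auto
  have "\<And>x. 0 \<le> p x" "\<And>x. 0 \<le> n x" by (auto simp: p_def n_def)
  then have "\<bar>\<integral>x. \<xi> x * p (T x) \<partial>M\<bar> \<le> c * (\<integral>x. p x \<partial>M)" "\<bar>\<integral>x. \<xi> x * n (T x) \<partial>M\<bar> \<le> c * (\<integral>x. n x \<partial>M)"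
    using cond_inD(1,2)[OF \<xi>, of p] cond_inD(1,2)[OF \<xi>, of n] \<open>bmeas M p\<close> \<open>bmeas M n\<close>
    by (auto simp: abs_le_iff)
  moreover have "(\<integral>x. \<xi> x * \<phi> (T x) \<partial>M) = (\<integral>x. \<xi> x * p (T x) \<partial>M) - (\<integral>x. \<xi> x * n (T x) \<partial>M)"
  proof -
    have "(\<integral>x. \<xi> x * \<phi> (T x) \<partial>M) = (\<integral>x. \<xi> x * p (T x) - \<xi> x * n (T x) \<partial>M)"
      by (intro Bochner_Integration.integral_cong refl) (simp add: p_def n_def field_simps)
    also have "\<dots> = (\<integral>x. \<xi> x * p (T x) \<partial>M) - (\<integral>x. \<xi> x * n (T x) \<partial>M)"
      by (intro Bochner_Integration.integral_diff) auto
    finally show ?thesis .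
  qed
  moreover have "(\<integral>x. \<bar>\<phi> x\<bar> \<partial>M) = (\<integral>x. p x \<partial>M) + (\<integral>x. n x \<partial>M)"
  proof -
    have "(\<integral>x. \<bar>\<phi> x\<bar> \<partial>M) = (\<integral>x. p x + n x \<partial>M)"
      by (intro Bochner_Integration.integral_cong refl) (simp add: p_def n_def field_simps)
    also have "\<dots> = (\<integral>x. p x \<partial>M) + (\<integral>x. n x \<partial>M)"
      by (intro Bochner_Integration.integral_add) auto
    finally show ?thesis .
  qed
  ultimately show ?thesis by (simp add: distrib_left)
qed

text \<open>Iterating the conditional bound along the orbit replaces conditioning on a filtration.\<close>

lemma integral_prod_iter:
  assumes \<xi>: "cond_in M T l u \<xi>" and nn: "\<And>x. x \<in> space M \<Longrightarrow> 0 \<le> \<xi> x" and lu: "0 \<le> l" "0 \<le> u"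
  shows "l ^ k \<le> (\<integral>x. (\<Prod>i<k. \<xi> ((T ^^ i) x)) \<partial>M) \<and> (\<integral>x. (\<Prod>i<k. \<xi> ((T ^^ i) x)) \<partial>M) \<le> u ^ k"
proof (induction k)
  case 0
  show ?case by (simp add: prob_space)
next
  case (Suc k)
  define \<phi> where "\<phi> x = (\<Prod>i<k. \<xi> ((T ^^ i) x))" for x
  have \<phi>: "bmeas M \<phi>" "\<forall>x\<in>space M. 0 \<le> \<phi> x"
    unfolding \<phi>_def using cond_in_bmeas[OF \<xi>] nn by (auto intro!: prod_nonneg)
  \<comment> \<open>Splitting off the factor with index 0 leaves a product that depends on
    \<open>x\<close> only through \<open>T x\<close>.\<close>
  have "(\<integral>x. (\<Prod>i<Suc k. \<xi> ((T ^^ i) x)) \<partial>M) = (\<integral>x. \<xi> x * \<phi> (T x) \<partial>M)"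
    by (intro Bochner_Integration.integral_cong refl)
      (simp add: \<phi>_def prod.lessThan_Suc_shift funpow_swap1 del: prod.lessThan_Suc)
  moreover have "l * l ^ k \<le> l * (\<integral>x. \<phi> x \<partial>M)" "u * (\<integral>x. \<phi> x \<partial>M) \<le> u * u ^ k"
    using Suc lu by (auto simp: \<phi>_def intro: mult_left_mono)
  ultimately show ?case using cond_inD(1,2)[OF \<xi> \<phi>] by simp
qed

end

section \<open>Martingale-coboundary decomposition\<close>

text \<open>Gordin's decomposition in weak form. The conditional variance given the distant iterates
  is controlled uniformly, not merely in mean, because such bounds can be multiplied along the orbit
  in Laplace transforms.\<close>

definition mg_decomposition ::
    "'a measure \<Rightarrow> ('a \<Rightarrow> 'a) \<Rightarrow> ('a \<Rightarrow> real) \<Rightarrow> real \<Rightarrow> bool" where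
  "mg_decomposition M T g s2 \<longleftrightarrow>
     (\<exists>q p C \<rho>. bmeas M q \<and> bmeas M p \<and> 0 \<le> C \<and> 0 \<le> \<rho> \<and> \<rho> < 1 \<and>
        (\<forall>x\<in>space M. g x = q x + (p (T x) - p x)) \<and>
        cond_in M T 0 0 q \<and>
        (\<forall>i. cond_in M (T ^^ Suc i) (s2 - C * \<rho> ^ i) (s2 + C * \<rho> ^ i) (\<lambda>x. (q x)\<^sup>2)))"

locale unit_system = preserving M T for M :: "real measure" and T +
  assumes sets_M: "sets M = sets (restrict_space borel {0..1})"
begin

lemma space_M: "space M = {0..1}"
  using sets_eq_imp_space_eq[OF sets_M] by (simp add: space_restrict_space)

lemma BV_bmeas:
  assumes "f \<in> BV" shows "bmeas M f"
proof -
  obtain C where "\<forall>x\<in>{0..1}. \<bar>f x\<bar> \<le> C" using BV_bounded[OF assms] by auto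
  moreover have "f \<in> borel_measurable M"
    using BV_measurable[OF assms] measurable_cong_sets[OF sets_M refl] by blast
  ultimately show ?thesis by (intro bmeasI) (auto simp: space_M)
qed

lemma bmeas_square_integrable: "bmeas M \<phi> \<Longrightarrow> square_integrable M \<phi>"
  unfolding square_integrable_def
  by (intro conjI bmeas_measurable bmeas_integrable bmeas_power)

text \<open>Square integrability of the iterates is carried through the induction because the
  defining duality of the kernel is only available for square integrable functions.\<close>

lemma kernel_iterate:
  assumes K: "perron_frobenius_kernel M T K" and w: "bmeas M w"
  shows "square_integrable M ((kernel_op K ^^ n) w) \<and>
    (\<forall>\<phi>. bmeas M \<phi> \<longrightarrow> (\<integral>x. (kernel_op K ^^ n) w x * \<phi> x \<partial>M) = (\<integral>x. w x * \<phi> ((T ^^ n) x) \<partial>M))"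
proof (induction n)
  case 0
  show ?case using bmeas_square_integrable[OF w] by simp
next
  case (Suc n)
  let ?w = "(kernel_op K ^^ n) w"
  have sq: "square_integrable M ?w" using Suc by simp
  have "(\<integral>x. (kernel_op K ^^ Suc n) w x * \<phi> x \<partial>M) = (\<integral>x. w x * \<phi> ((T ^^ Suc n) x) \<partial>M)"
    if \<phi>: "bmeas M \<phi>" for \<phi>
  proof -
    have "(\<integral>x. (kernel_op K ^^ Suc n) w x * \<phi> x \<partial>M) = (\<integral>x. ?w x * \<phi> (T x) \<partial>M)"
      using K sq bmeas_square_integrable[OF \<phi>] by (simp add: perron_frobenius_kernel_def)
    also have "\<dots> = (\<integral>x. w x * \<phi> (T ((T ^^ n) x)) \<partial>M)"
      using Suc bmeas_T[OF \<phi>] by blast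
    finally show ?thesis by simp
  qed
  then show ?case
    using K sq by (simp add: perron_frobenius_kernel_def)
qed

text \<open>The interface to the kernel: a BV version of each iterate that satisfies the n-fold
  duality. Passing to a version is harmless, since the duality only sees classes modulo null
  sets.\<close>

lemma BV_transfer:
  assumes "BV_contracting M T"
  obtains \<kappa> \<rho> where "0 < \<kappa>" "0 \<le> \<rho>" "\<rho> < 1"
    "\<And>w n. w \<in> BV \<Longrightarrow> \<exists>g\<in>BV. dnorm g \<le> \<kappa> * \<rho> ^ n * dnorm w \<and> (n = 0 \<longrightarrow> g = w) \<and>
       (\<forall>\<phi>. bmeas M \<phi> \<longrightarrow> (\<integral>x. g x * \<phi> x \<partial>M) = (\<integral>x. w x * \<phi> ((T ^^ n) x) \<partial>M))"
proof -
  obtain K \<kappa> \<rho> where K: "perron_frobenius_kernel M T K" and \<kappa>: "\<kappa> > 0" "0 \<le> \<rho>" "\<rho> < 1"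
    and ctr: "\<And>n f. n \<ge> 1 \<Longrightarrow> f \<in> BV \<Longrightarrow> \<exists>g\<in>BV. (AE x in M. (kernel_op K ^^ n) f x = g x) \<and>
           dnorm g \<le> \<kappa> * \<rho> ^ n * dnorm f"
    using assms unfolding BV_contracting_def BV_contracting_kernel_def by blast
  show ?thesis
  \<comment> \<open>The maximum with 1 extends the bound to \<open>n = 0\<close>, where the
    contraction property is silent and \<open>g = w\<close> is taken.\<close>
  proof (rule that[of "max 1 \<kappa>" \<rho>])
    fix w :: "real \<Rightarrow> real" and n :: nat assume w: "w \<in> BV"
    show "\<exists>g\<in>BV. dnorm g \<le> max 1 \<kappa> * \<rho> ^ n * dnorm w \<and> (n = 0 \<longrightarrow> g = w) \<and>
       (\<forall>\<phi>. bmeas M \<phi> \<longrightarrow> (\<integral>x. g x * \<phi> x \<partial>M) = (\<integral>x. w x * \<phi> ((T ^^ n) x) \<partial>M))"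
    proof (cases "n = 0")
      case True
      have "dnorm w \<le> max 1 \<kappa> * dnorm w"
        using dnorm_nonneg[OF w] mult_right_mono[of 1 "max 1 \<kappa>" "dnorm w"] by simp
      then show ?thesis using w True by (intro bexI[of _ w]) auto
    next
      case False
      then obtain g where g: "g \<in> BV" "AE x in M. (kernel_op K ^^ n) w x = g x"
           "dnorm g \<le> \<kappa> * \<rho> ^ n * dnorm w"
        using ctr[of n w] w by auto
      have "\<kappa> * \<rho> ^ n * dnorm w \<le> max 1 \<kappa> * \<rho> ^ n * dnorm w"
        using \<kappa> dnorm_nonneg[OF w] by (intro mult_right_mono) auto
      moreover have "(\<integral>x. g x * \<phi> x \<partial>M) = (\<integral>x. w x * \<phi> ((T ^^ n) x) \<partial>M)" if \<phi>: "bmeas M \<phi>" for \<phi>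
      proof -
        have sq: "square_integrable M ((kernel_op K ^^ n) w)"
          and eq: "(\<integral>x. (kernel_op K ^^ n) w x * \<phi> x \<partial>M) = (\<integral>x. w x * \<phi> ((T ^^ n) x) \<partial>M)"
          using kernel_iterate[OF K BV_bmeas[OF w], of n] \<phi> by auto
        have "(\<integral>x. g x * \<phi> x \<partial>M) = (\<integral>x. (kernel_op K ^^ n) w x * \<phi> x \<partial>M)"
          using g(2) sq BV_bmeas[OF g(1)] \<phi>
          by (intro integral_cong_AE) (auto simp: square_integrable_def bmeas_def)
        then show ?thesis using eq by simp
      qed
      ultimately show ?thesis using g False by (intro bexI[of _ g]) auto
    qed
  qed (use \<kappa> in auto)
qed

text \<open>All values of \<open>g\<close> lie within \<open>dnorm g\<close> of \<open>g x\<close>,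
  hence so does their average. For functions of mean zero this turns contraction of
  \<open>dnorm\<close> into a uniform bound.\<close>

lemma BV_minus_mean:
  assumes "g \<in> BV" "x \<in> {0..1}"
  shows "\<bar>g x - (\<integral>y. g y \<partial>M)\<bar> \<le> dnorm g"
proof -
  have b: "bmeas M g" by (rule BV_bmeas[OF assms(1)])
  have bd: "g x - dnorm g \<le> g y" "g y \<le> g x + dnorm g" if "y \<in> space M" for y
    using BV_diff_le_dnorm[OF assms, of y] that unfolding space_M abs_le_iff by linarith+
  have "(\<integral>y. g x - dnorm g \<partial>M) \<le> (\<integral>y. g y \<partial>M)" "(\<integral>y. g y \<partial>M) \<le> (\<integral>y. g x + dnorm g \<partial>M)"
    using b bd by (intro integral_mono_bmeas; simp)+
  then show ?thesis by (simp add: prob_space abs_le_iff)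
qed

lemma contracting_decomposition:
  assumes contr: "BV_contracting M T" and f: "f \<in> BV"
  shows "mg_decomposition M T (\<lambda>x. f x - (\<integral>y. f y \<partial>M)) (asymp_var M T f)"
proof -
  obtain \<kappa> \<rho> where \<kappa>: "0 < \<kappa>" "0 \<le> \<rho>" "\<rho> < 1" and
    transfer: "\<And>w n. w \<in> BV \<Longrightarrow> \<exists>g\<in>BV. dnorm g \<le> \<kappa> * \<rho> ^ n * dnorm w \<and> (n = 0 \<longrightarrow> g = w) \<and>
       (\<forall>\<phi>. bmeas M \<phi> \<longrightarrow> (\<integral>x. g x * \<phi> x \<partial>M) = (\<integral>x. w x * \<phi> ((T ^^ n) x) \<partial>M))"
    using BV_transfer[OF contr] by blast
  define g0 where "g0 x = f x - (\<integral>y. f y \<partial>M)" for x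
  have g0: "g0 \<in> BV" unfolding g0_def by (rule BV_diff_const[OF f])
  have bg0 [intro!]: "bmeas M g0" by (rule BV_bmeas[OF g0])
  have mean_g0: "(\<integral>x. g0 x \<partial>M) = 0"
    unfolding g0_def using bmeas_integrable[OF BV_bmeas[OF f]] by (simp add: prob_space)
  define D where "D = dnorm g0"
  have D: "0 \<le> D" unfolding D_def by (rule dnorm_nonneg[OF g0])
  \<comment> \<open>Pointwise representatives of the iterates are fixed once, with
    \<open>G 0 = g0\<close>, so that the decomposition below holds at every point of the
    space.\<close>
  obtain G where G: "\<And>n. G n \<in> BV" "\<And>n. dnorm (G n) \<le> \<kappa> * \<rho> ^ n * D" "G 0 = g0"
    and Gint: "\<And>n \<phi>. bmeas M \<phi> \<Longrightarrow> (\<integral>x. G n x * \<phi> x \<partial>M) = (\<integral>x. g0 x * \<phi> ((T ^^ n) x) \<partial>M)"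
    using transfer[OF g0] unfolding D_def by metis
  have bG [intro!]: "bmeas M (G n)" for n by (rule BV_bmeas[OF G(1)])
  have mean_G: "(\<integral>x. G n x \<partial>M) = 0" for n
    using Gint[of "\<lambda>_. 1" n] mean_g0 by simp
  have G_bound: "\<bar>G n x\<bar> \<le> \<kappa> * \<rho> ^ n * D" if "x \<in> {0..1}" for n x
    using BV_minus_mean[OF G(1) that, of n] G(2)[of n] by (simp add: mean_G)
  have geo: "summable (\<lambda>n. \<kappa> * \<rho> ^ n * D)"
    using \<kappa> by (intro summable_mult summable_mult2 summable_geometric) auto
  have sumG: "summable (\<lambda>n. G n x)" if "x \<in> {0..1}" for x
    by (rule summable_comparison_test'[OF geo, of 0]) (use G_bound[OF that] in simp)
  have sumd: "summable (\<lambda>n. dnorm (G n))"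
    by (rule summable_comparison_test'[OF geo, of 0]) (use G dnorm_nonneg[OF G(1)] in simp)
  define h where "h x = (\<Sum>n. G n x)" for x
  define p where "p x = (\<Sum>n. G (Suc n) x)" for x
  have h: "h \<in> BV" unfolding h_def by (intro BV_suminf G sumd sumG)
  have p: "p \<in> BV"
    unfolding p_def
    by (intro BV_suminf G) (simp_all add: sumd sumG summable_Suc_iff[of "\<lambda>n. dnorm (G n)"]
        summable_Suc_iff[of "\<lambda>n. G n _"])
  have bh [intro!]: "bmeas M h" and bp [intro!]: "bmeas M p" using BV_bmeas h p by auto
  have h_p: "h x = g0 x + p x" if "x \<in> space M" for x
    using suminf_split_head[OF sumG[of x]] that by (simp add: space_M h_def p_def G(3))
  have int_series: "(\<lambda>n. \<integral>x. G n x * \<phi> x \<partial>M) sums (\<integral>x. h x * \<phi> x \<partial>M)" if \<phi>: "bmeas M \<phi>" for \<phi>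
  proof -
    obtain C where C: "C > 0" "\<And>x. x \<in> space M \<Longrightarrow> \<bar>\<phi> x\<bar> \<le> C" using bmeas_bound[OF \<phi>] by blast
    have b: "\<bar>G n x * \<phi> x\<bar> \<le> \<kappa> * \<rho> ^ n * D * C" if "x \<in> space M" for n x
      unfolding abs_mult using C G_bound[of x n] that D \<kappa>
      by (intro mult_mono) (auto simp: space_M)
    have geo': "summable (\<lambda>n. \<kappa> * \<rho> ^ n * D * C)" by (rule summable_mult2[OF geo])
    have sm: "summable (\<lambda>n. \<bar>G n x * \<phi> x\<bar>)" if "x \<in> space M" for x
      by (rule summable_comparison_test'[OF geo', of 0]) (use b[OF that] in simp)
    have "(\<lambda>n. \<integral>x. G n x * \<phi> x \<partial>M) sums (\<integral>x. (\<Sum>n. G n x * \<phi> x) \<partial>M)"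
    proof (rule sums_integral)
      show "integrable M (\<lambda>x. G n x * \<phi> x)" for n using \<phi> by auto
      show "AE x in M. summable (\<lambda>n. norm (G n x * \<phi> x))" using sm by (intro AE_I2) simp
      have "(\<integral>x. \<bar>G n x * \<phi> x\<bar> \<partial>M) \<le> \<kappa> * \<rho> ^ n * D * C" for n
      proof -
        have "(\<integral>x. \<bar>G n x * \<phi> x\<bar> \<partial>M) \<le> (\<integral>x. \<kappa> * \<rho> ^ n * D * C \<partial>M)"
          using b \<phi> by (intro integral_mono_bmeas) auto
        then show ?thesis by (simp add: prob_space)
      qed
      then show "summable (\<lambda>n. \<integral>x. norm (G n x * \<phi> x) \<partial>M)"
        by (intro summable_comparison_test'[OF geo', of 0]) simp
    qed
    also have "(\<integral>x. (\<Sum>n. G n x * \<phi> x) \<partial>M) = (\<integral>x. h x * \<phi> x \<partial>M)"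
      by (intro Bochner_Integration.integral_cong refl)
        (simp add: h_def suminf_mult2[OF sumG] space_M)
    finally show ?thesis .
  qed
  \<comment> \<open>The weak form of \<open>K h = p\<close>: duality moves \<open>G n\<close> to
    \<open>G (Suc n)\<close> term by term. Together with \<open>p = h - g0\<close> this is the
    Poisson equation for \<open>g0\<close>, and it makes \<open>q\<close> orthogonal to functions of
    \<open>T\<close>.\<close>
  have h_T: "(\<integral>x. h x * \<phi> (T x) \<partial>M) = (\<integral>x. p x * \<phi> x \<partial>M)" if \<phi>: "bmeas M \<phi>" for \<phi>
  proof -
    have "(\<integral>x. G n x * \<phi> (T x) \<partial>M) = (\<integral>x. G (Suc n) x * \<phi> x \<partial>M)" for n
      using Gint[OF bmeas_T[OF \<phi>], of n] Gint[OF \<phi>, of "Suc n"] by simp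
    then have "(\<lambda>n. \<integral>x. G (Suc n) x * \<phi> x \<partial>M) sums (\<integral>x. h x * \<phi> (T x) \<partial>M)"
      using int_series[OF bmeas_T[OF \<phi>]] by simp
    moreover have "(\<lambda>n. \<integral>x. G (Suc n) x * \<phi> x \<partial>M) sums ((\<integral>x. h x * \<phi> x \<partial>M) - (\<integral>x. g0 x * \<phi> x \<partial>M))"
      using int_series[OF \<phi>] G(3) by (subst sums_Suc_iff) simp
    moreover have "(\<integral>x. h x * \<phi> x \<partial>M) - (\<integral>x. g0 x * \<phi> x \<partial>M) = (\<integral>x. h x * \<phi> x - g0 x * \<phi> x \<partial>M)"
      using \<phi> by (intro Bochner_Integration.integral_diff[symmetric]) auto
    moreover have "\<dots> = (\<integral>x. p x * \<phi> x \<partial>M)"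
      by (intro Bochner_Integration.integral_cong refl) (simp add: h_p algebra_simps)
    ultimately show ?thesis by (auto dest: sums_unique2)
  qed
  define q where "q x = h x - p (T x)" for x
  have bq [intro!]: "bmeas M q" unfolding q_def by auto
  have q_orth: "(\<integral>x. q x * \<phi> (T x) \<partial>M) = 0" if \<phi>: "bmeas M \<phi>" for \<phi>
  proof -
    have "(\<integral>x. q x * \<phi> (T x) \<partial>M) = (\<integral>x. h x * \<phi> (T x) - p (T x) * \<phi> (T x) \<partial>M)"
      by (simp add: q_def left_diff_distrib)
    also have "\<dots> = (\<integral>x. h x * \<phi> (T x) \<partial>M) - (\<integral>x. p (T x) * \<phi> (T x) \<partial>M)"
      using \<phi> by (intro Bochner_Integration.integral_diff) auto
    also have "(\<integral>x. p (T x) * \<phi> (T x) \<partial>M) = (\<integral>x. p x * \<phi> x \<partial>M)"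
      using \<phi> by (intro integral_T) auto
    finally show ?thesis using h_T[OF \<phi>] by simp
  qed
  \<comment> \<open>Pythagoras for \<open>h = q + p o T\<close>: the cross term vanishes because
    \<open>q\<close> is orthogonal to every function of \<open>T\<close>.\<close>
  have q_sq: "(\<integral>x. (q x)\<^sup>2 * \<phi> (T x) \<partial>M) = (\<integral>x. (h x)\<^sup>2 * \<phi> (T x) \<partial>M) - (\<integral>x. (p x)\<^sup>2 * \<phi> x \<partial>M)"
    if \<phi>: "bmeas M \<phi>" for \<phi>
  proof -
    have "(\<integral>x. (q x)\<^sup>2 * \<phi> (T x) \<partial>M) =
        (\<integral>x. ((h x)\<^sup>2 * \<phi> (T x) - (p (T x))\<^sup>2 * \<phi> (T x)) - 2 * (q x * (p (T x) * \<phi> (T x))) \<partial>M)"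
      by (intro Bochner_Integration.integral_cong refl) (simp add: q_def power2_eq_square algebra_simps)
    also have "\<dots> = (\<integral>x. (h x)\<^sup>2 * \<phi> (T x) - (p (T x))\<^sup>2 * \<phi> (T x) \<partial>M) - (\<integral>x. 2 * (q x * (p (T x) * \<phi> (T x))) \<partial>M)"
      using \<phi> by (intro Bochner_Integration.integral_diff) auto
    also have "(\<integral>x. 2 * (q x * (p (T x) * \<phi> (T x))) \<partial>M) = 0"
      using q_orth[OF bmeas_mult[OF bp \<phi>]] by simp
    also have "(\<integral>x. (h x)\<^sup>2 * \<phi> (T x) - (p (T x))\<^sup>2 * \<phi> (T x) \<partial>M)
        = (\<integral>x. (h x)\<^sup>2 * \<phi> (T x) \<partial>M) - (\<integral>x. (p (T x))\<^sup>2 * \<phi> (T x) \<partial>M)"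
      using \<phi> by (intro Bochner_Integration.integral_diff) auto
    also have "(\<integral>x. (p (T x))\<^sup>2 * \<phi> (T x) \<partial>M) = (\<integral>x. (p x)\<^sup>2 * \<phi> x \<partial>M)"
      using \<phi> by (intro integral_T) auto
    finally show ?thesis by simp
  qed
  \<comment> \<open>Decay of correlations with the L1 norm of the test function on the right, which
    is the form required by \<open>cond_in\<close>.\<close>
  have mixing: "\<bar>(\<integral>x. w x * \<phi> ((T ^^ n) x) \<partial>M) - (\<integral>x. w x \<partial>M) * (\<integral>x. \<phi> x \<partial>M)\<bar> \<le> \<kappa> * \<rho> ^ n * dnorm w * (\<integral>x. \<phi> x \<partial>M)"
    if w: "w \<in> BV" and \<phi>: "bmeas M \<phi>" "\<forall>x\<in>space M. 0 \<le> \<phi> x" for w \<phi> n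
  proof -
    obtain g where g: "g \<in> BV" "dnorm g \<le> \<kappa> * \<rho> ^ n * dnorm w"
      and gi: "\<And>\<phi>. bmeas M \<phi> \<Longrightarrow> (\<integral>x. g x * \<phi> x \<partial>M) = (\<integral>x. w x * \<phi> ((T ^^ n) x) \<partial>M)"
      using transfer[OF w, of n] by blast
    have bg [intro!]: "bmeas M g" by (rule BV_bmeas[OF g(1)])
    have mg: "(\<integral>x. g x \<partial>M) = (\<integral>x. w x \<partial>M)" using gi[of "\<lambda>_. 1"] by simp
    have "(\<integral>x. w x * \<phi> ((T ^^ n) x) \<partial>M) - (\<integral>x. w x \<partial>M) * (\<integral>x. \<phi> x \<partial>M)
        = (\<integral>x. g x * \<phi> x \<partial>M) - (\<integral>x. (\<integral>y. w y \<partial>M) * \<phi> x \<partial>M)"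
      using gi[OF \<phi>(1)] by simp
    also have "\<dots> = (\<integral>x. g x * \<phi> x - (\<integral>y. w y \<partial>M) * \<phi> x \<partial>M)"
      using \<phi> by (intro Bochner_Integration.integral_diff[symmetric]) auto
    also have "\<bar>\<dots>\<bar> \<le> (\<integral>x. \<bar>g x * \<phi> x - (\<integral>y. w y \<partial>M) * \<phi> x\<bar> \<partial>M)"
      by (rule integral_abs_bound)
    also have "\<dots> \<le> (\<integral>x. \<kappa> * \<rho> ^ n * dnorm w * \<phi> x \<partial>M)"
    proof (intro integral_mono_bmeas)
      fix x assume x: "x \<in> space M"
      have "\<bar>g x * \<phi> x - (\<integral>y. w y \<partial>M) * \<phi> x\<bar> = \<bar>g x - (\<integral>y. g y \<partial>M)\<bar> * \<phi> x"
        using \<phi>(2) x by (simp add: mg left_diff_distrib[symmetric] abs_mult)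
      also have "\<dots> \<le> \<kappa> * \<rho> ^ n * dnorm w * \<phi> x"
        using BV_minus_mean[OF g(1), of x] g(2) x \<phi>(2) by (intro mult_right_mono) (auto simp: space_M)
      finally show "\<bar>g x * \<phi> x - (\<integral>y. w y \<partial>M) * \<phi> x\<bar> \<le> \<kappa> * \<rho> ^ n * dnorm w * \<phi> x" .
    qed (use \<phi> in auto)
    finally show ?thesis by simp
  qed
  define h2 p2 where "h2 = (\<lambda>x. (h x)\<^sup>2)" and "p2 = (\<lambda>x. (p x)\<^sup>2)"
  have h2: "h2 \<in> BV" "p2 \<in> BV" unfolding h2_def p2_def by (intro BV_sq h p)+
  define s2 where "s2 = (\<integral>x. h2 x \<partial>M) - (\<integral>x. p2 x \<partial>M)"
  define C where "C = \<kappa> * dnorm h2 + \<kappa> * dnorm p2"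
  have C: "0 \<le> C" unfolding C_def using \<kappa> dnorm_nonneg h2 by auto
  have var: "cond_in M (T ^^ Suc i) (s2 - C * \<rho> ^ i) (s2 + C * \<rho> ^ i) (\<lambda>x. (q x)\<^sup>2)" for i
    unfolding cond_in_def
  proof (intro conjI allI impI)
    show "bmeas M (\<lambda>x. (q x)\<^sup>2)" by (rule bmeas_power[OF bq])
  next
    fix \<phi> assume \<phi>: "bmeas M \<phi>" "\<forall>x\<in>space M. 0 \<le> \<phi> x"
    define I where "I = (\<integral>x. \<phi> x \<partial>M)"
    have I: "0 \<le> I" unfolding I_def using \<phi> by (intro integral_nonneg_AE AE_I2) auto
    have "(\<integral>x. (q x)\<^sup>2 * \<phi> ((T ^^ Suc i) x) \<partial>M) = (\<integral>x. (q x)\<^sup>2 * \<phi> ((T ^^ i) (T x)) \<partial>M)"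
      by (simp add: funpow_swap1)
    also have "\<dots> = (\<integral>x. h2 x * \<phi> ((T ^^ Suc i) x) \<partial>M) - (\<integral>x. p2 x * \<phi> ((T ^^ i) x) \<partial>M)"
      using q_sq[OF bmeas_iter[OF \<phi>(1), of i]] by (simp add: h2_def p2_def funpow_swap1)
    finally have e: "(\<integral>x. (q x)\<^sup>2 * \<phi> ((T ^^ Suc i) x) \<partial>M) =
      (\<integral>x. h2 x * \<phi> ((T ^^ Suc i) x) \<partial>M) - (\<integral>x. p2 x * \<phi> ((T ^^ i) x) \<partial>M)" .
    \<comment> \<open>The term with \<open>h2\<close> is transported one step further than the one
      with \<open>p2\<close>; its spare factor \<open>\<rho>\<close> is given up so that both share
      the rate \<open>\<rho> ^ i\<close>.\<close>
    have m: "\<kappa> * \<rho> ^ Suc i * dnorm h2 * I \<le> \<kappa> * \<rho> ^ i * dnorm h2 * I"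
      using \<kappa> I dnorm_nonneg[OF h2(1)]
      by (intro mult_right_mono mult_left_mono power_decreasing) auto
    have "\<bar>(\<integral>x. (q x)\<^sup>2 * \<phi> ((T ^^ Suc i) x) \<partial>M) - s2 * I\<bar> \<le> C * \<rho> ^ i * I"
      using mixing[OF h2(1) \<phi>, of "Suc i"] mixing[OF h2(2) \<phi>, of i] m
      unfolding e s2_def C_def I_def[symmetric] left_diff_distrib distrib_right
      by (simp only: mult_ac)
    then show "(s2 - C * \<rho> ^ i) * (\<integral>x. \<phi> x \<partial>M) \<le> (\<integral>x. (q x)\<^sup>2 * \<phi> ((T ^^ Suc i) x) \<partial>M)"
      "(\<integral>x. (q x)\<^sup>2 * \<phi> ((T ^^ Suc i) x) \<partial>M) \<le> (s2 + C * \<rho> ^ i) * (\<integral>x. \<phi> x \<partial>M)"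
      unfolding I_def[symmetric] left_diff_distrib distrib_right by linarith+
  qed
  \<comment> \<open>As \<open>p = h - g0\<close>, the difference of squares is
    \<open>2 * h * g0\<close> minus the square of \<open>g0\<close>. Integrating the series for
    \<open>h\<close> against \<open>g0\<close> gives the autocovariances, with the term at lag 0
    counted twice minus once.\<close>
  have "s2 = asymp_var M T f"
  proof -
    define c where "c n = (\<integral>x. g0 x * g0 ((T ^^ n) x) \<partial>M)" for n
    have "(\<lambda>n. \<integral>x. G n x * g0 x \<partial>M) sums (\<integral>x. h x * g0 x \<partial>M)" by (rule int_series[OF bg0])
    then have c: "c sums (\<integral>x. h x * g0 x \<partial>M)"
      unfolding c_def using Gint[OF bg0] by simp
    have "s2 = (\<integral>x. h2 x - p2 x \<partial>M)"
      unfolding s2_def using BV_bmeas h2 by (intro Bochner_Integration.integral_diff[symmetric]) auto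
    also have "\<dots> = (\<integral>x. 2 * (h x * g0 x) - (g0 x)\<^sup>2 \<partial>M)"
      by (intro Bochner_Integration.integral_cong refl)
        (simp add: h2_def p2_def h_p power2_eq_square algebra_simps)
    also have "\<dots> = (\<integral>x. 2 * (h x * g0 x) \<partial>M) - (\<integral>x. (g0 x)\<^sup>2 \<partial>M)"
      by (intro Bochner_Integration.integral_diff) auto
    also have "\<dots> = 2 * suminf c - c 0"
      using sums_unique[OF c] by (simp add: c_def power2_eq_square)
    also have "suminf c = c 0 + (\<Sum>n. c (Suc n))"
      using suminf_split_head[OF sums_summable[OF c]] by simp
    finally have s2: "s2 = c 0 + 2 * (\<Sum>n. c (Suc n))" by simp
    have "(\<integral>x. f ((T ^^ Suc n) x) * (f x - (\<integral>y. f y \<partial>M)) \<partial>M) = c (Suc n)" for n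
    proof -
      have "(\<integral>x. f ((T ^^ Suc n) x) * (f x - (\<integral>y. f y \<partial>M)) \<partial>M)
          = (\<integral>x. g0 x * g0 ((T ^^ Suc n) x) + (\<integral>y. f y \<partial>M) * g0 x \<partial>M)"
        by (intro Bochner_Integration.integral_cong refl) (simp add: g0_def algebra_simps)
      also have "\<dots> = (\<integral>x. g0 x * g0 ((T ^^ Suc n) x) \<partial>M) + (\<integral>x. (\<integral>y. f y \<partial>M) * g0 x \<partial>M)"
        by (intro Bochner_Integration.integral_add bmeas_integrable bmeas_mult bmeas_iter[OF bg0] bg0 bmeas_const)
      finally show ?thesis by (simp add: mean_g0 c_def)
    qed
    then show ?thesis
      unfolding asymp_var_def Let_def s2 by (simp add: c_def g0_def power2_eq_square)
  qed
  moreover have "cond_in M T 0 0 q"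
    unfolding cond_in_def using q_orth by auto
  moreover have "\<forall>x\<in>space M. g0 x = q x + (p (T x) - p x)"
    using h_p by (simp add: q_def)
  ultimately show ?thesis
    unfolding mg_decomposition_def g0_def using bq bp C \<kappa> var by blast
qed

end

section \<open>Laplace transforms of orbit sums\<close>

lemma exp_cubic_bound:
  assumes "\<bar>u\<bar> \<le> (1::real)"
  shows "\<bar>exp u - (1 + u + u\<^sup>2 / 2)\<bar> \<le> \<bar>u\<bar> ^ 3 / 2"
proof -
  obtain t where t: "\<bar>t\<bar> \<le> \<bar>u\<bar>" "exp u = (\<Sum>m<3. u ^ m / fact m) + exp t / fact 3 * u ^ 3"
    using Maclaurin_exp_le[of u 3] by blast
  have "exp t \<le> exp 1" using t assms by simp
  then have "exp t \<le> 3" using exp_le by linarith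
  have e: "exp u - (1 + u + u\<^sup>2 / 2) = exp t / 6 * u ^ 3"
    using t(2) by (simp add: eval_nat_numeral)
  have "\<bar>exp u - (1 + u + u\<^sup>2 / 2)\<bar> = exp t / 6 * \<bar>u\<bar> ^ 3"
    unfolding e by (simp add: abs_mult power_abs)
  also have "\<dots> \<le> 3 / 6 * \<bar>u\<bar> ^ 3"
    using \<open>exp t \<le> 3\<close> by (intro mult_right_mono) auto
  finally show ?thesis by simp
qed

lemma exp_uminus_le:
  assumes "0 \<le> u" "u \<le> (1::real)"
  shows "exp (- u) \<le> 1 - u + u\<^sup>2"
proof -
  have "\<bar>- u\<bar> ^ 3 \<le> u\<^sup>2"
    using assms mult_right_mono[of u 1 "u\<^sup>2"] by (simp add: power3_eq_cube power2_eq_square)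
  moreover have "exp (- u) - (1 + - u + (- u)\<^sup>2 / 2) \<le> \<bar>- u\<bar> ^ 3 / 2"
    using exp_cubic_bound[of "- u"] assms unfolding abs_le_iff by simp
  ultimately show ?thesis unfolding power2_minus by linarith
qed

definition orbit_sum :: "('a \<Rightarrow> 'a) \<Rightarrow> ('a \<Rightarrow> real) \<Rightarrow> nat \<Rightarrow> 'a \<Rightarrow> real" where
  "orbit_sum T \<eta> k x = (\<Sum>i<k. \<eta> ((T ^^ i) x))"

lemma orbit_sum_0 [simp]: "orbit_sum T \<eta> 0 x = 0"
  by (simp add: orbit_sum_def)

text \<open>Removing the first term, not the last, leaves a function of \<open>T x\<close>, against
  which \<open>\<eta>\<close> may be tested.\<close>

lemma orbit_sum_Suc: "orbit_sum T \<eta> (Suc k) x = \<eta> x + orbit_sum T \<eta> k (T x)"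
  by (simp add: orbit_sum_def sum.lessThan_Suc_shift funpow_swap1 del: sum.lessThan_Suc)

lemma exp_orbit_sum: "exp (x * orbit_sum T \<eta> k \<omega>) = (\<Prod>i<k. exp (x * \<eta> ((T ^^ i) \<omega>)))"
  by (simp add: orbit_sum_def sum_distrib_left exp_sum)

context preserving
begin

lemma bmeas_orbit_sum [intro!]: "bmeas M \<eta> \<Longrightarrow> bmeas M (orbit_sum T \<eta> k)"
  unfolding orbit_sum_def by auto

lemma chernoff:
  assumes Z: "bmeas M Z" and x: "0 \<le> x"
  shows "measure M {\<omega> \<in> space M. a \<le> Z \<omega>} \<le> exp (- x * a) * (\<integral>\<omega>. exp (x * Z \<omega>) \<partial>M)"
proof -
  have [measurable]: "Z \<in> borel_measurable M" using Z by (rule bmeas_measurable)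
  have "measure M {\<omega> \<in> space M. a \<le> Z \<omega>} = (\<integral>\<omega>. indicator {\<omega> \<in> space M. a \<le> Z \<omega>} \<omega> \<partial>M)"
    by simp
  also have "\<dots> \<le> (\<integral>\<omega>. exp (- x * a) * exp (x * Z \<omega>) \<partial>M)"
  proof (intro integral_mono_bmeas bmeas_indicator bmeas_mult bmeas_const bmeas_exp Z)
    fix \<omega> assume "\<omega> \<in> space M"
    have "a \<le> Z \<omega> \<Longrightarrow> 1 \<le> exp (- x * a) * exp (x * Z \<omega>)"
      using mult_left_mono[OF _ x, of a "Z \<omega>"] by (simp add: exp_add[symmetric])
    then show "indicator {\<omega> \<in> space M. a \<le> Z \<omega>} \<omega> \<le> exp (- x * a) * exp (x * Z \<omega>)"
      by (auto simp: indicator_def)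
  qed measurable
  finally show ?thesis by simp
qed

lemma laplace_upper:
  assumes \<xi>: "cond_in M T l u (\<lambda>\<omega>. exp (c * \<eta> \<omega>))" and u: "u \<le> 1 + v" "0 \<le> l" and v: "0 \<le> 1 + v"
  shows "(\<integral>\<omega>. exp (c * orbit_sum T \<eta> k \<omega>) \<partial>M) \<le> exp (real k * v)"
proof -
  have "cond_in M T l (1 + v) (\<lambda>\<omega>. exp (c * \<eta> \<omega>))"
    by (rule cond_in_weaken[OF \<xi> order_refl u(1)])
  from integral_prod_iter[OF this] v u
  have "(\<integral>\<omega>. exp (c * orbit_sum T \<eta> k \<omega>) \<partial>M) \<le> (1 + v) ^ k"
    by (simp add: exp_orbit_sum)
  also have "\<dots> \<le> exp v ^ k" using v exp_ge_add_one_self by (intro power_mono) auto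
  finally show ?thesis by (simp add: exp_of_nat_mult)
qed

text \<open>The parameter \<open>\<alpha>\<close> bounds the conditional mean, \<open>\<beta>\<close> the relative error of the
  conditional variance.\<close>

lemma exp_cond_in:
  assumes mean: "cond_in M T (- \<alpha> / k) (\<alpha> / k) \<eta>"
    and var: "cond_in M T ((1 - \<beta>) / k) ((1 + \<beta>) / k) (\<lambda>\<omega>. (\<eta> \<omega>)\<^sup>2)"
    and bd: "\<And>\<omega>. \<omega> \<in> space M \<Longrightarrow> \<bar>\<eta> \<omega>\<bar> \<le> \<epsilon>"
    and x: "0 \<le> x" "x * \<epsilon> \<le> 1" and k: "k > 0"
  shows "cond_in M T (1 + (- x * \<alpha> + x\<^sup>2 / 2 * ((1 - x * \<epsilon>) * (1 - \<beta>))) / k)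
     (1 + (x * \<alpha> + x\<^sup>2 / 2 * ((1 + x * \<epsilon>) * (1 + \<beta>))) / k) (\<lambda>\<omega>. exp (x * \<eta> \<omega>))"
proof -
  obtain \<omega>0 where "\<omega>0 \<in> space M" using not_empty by blast
  then have \<epsilon>: "0 \<le> \<epsilon>" using bd[of \<omega>0] by linarith
  have lo: "cond_in M T (1 + (x * (- \<alpha> / k) + x\<^sup>2 / 2 * (1 - x * \<epsilon>) * ((1 - \<beta>) / k)))
     (1 + (x * (\<alpha> / k) + x\<^sup>2 / 2 * (1 - x * \<epsilon>) * ((1 + \<beta>) / k)))
     (\<lambda>\<omega>. 1 + (x * \<eta> \<omega> + x\<^sup>2 / 2 * (1 - x * \<epsilon>) * (\<eta> \<omega>)\<^sup>2))"
    using x by (intro cond_in_add cond_in_const cond_in_cmult mean var) auto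
  have hi: "cond_in M T (1 + (x * (- \<alpha> / k) + x\<^sup>2 / 2 * (1 + x * \<epsilon>) * ((1 - \<beta>) / k)))
     (1 + (x * (\<alpha> / k) + x\<^sup>2 / 2 * (1 + x * \<epsilon>) * ((1 + \<beta>) / k)))
     (\<lambda>\<omega>. 1 + (x * \<eta> \<omega> + x\<^sup>2 / 2 * (1 + x * \<epsilon>) * (\<eta> \<omega>)\<^sup>2))"
    using x \<epsilon> by (intro cond_in_add cond_in_const cond_in_cmult mean var) auto
  have bounds: "1 + (x * \<eta> \<omega> + x\<^sup>2 / 2 * (1 - x * \<epsilon>) * (\<eta> \<omega>)\<^sup>2) \<le> exp (x * \<eta> \<omega>)"
    "exp (x * \<eta> \<omega>) \<le> 1 + (x * \<eta> \<omega> + x\<^sup>2 / 2 * (1 + x * \<epsilon>) * (\<eta> \<omega>)\<^sup>2)" if "\<omega> \<in> space M" for \<omega>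
  proof -
    have a: "\<bar>x * \<eta> \<omega>\<bar> \<le> x * \<epsilon>"
      using bd[OF that] x by (simp add: abs_mult mult_left_mono)
    \<comment> \<open>The cubic Taylor remainder is absorbed into the quadratic term at the relative
      cost \<open>x * \<epsilon>\<close>, so bounds on the conditional variance suffice.\<close>
    have "\<bar>x * \<eta> \<omega>\<bar> ^ 3 / 2 = \<bar>x * \<eta> \<omega>\<bar> * (x * \<eta> \<omega>)\<^sup>2 / 2"
      by (simp add: power3_eq_cube power2_eq_square abs_mult[symmetric])
    also have "\<dots> \<le> (x * \<epsilon>) * (x * \<eta> \<omega>)\<^sup>2 / 2"
      using a by (intro divide_right_mono mult_right_mono) auto
    finally have "\<bar>exp (x * \<eta> \<omega>) - (1 + x * \<eta> \<omega> + (x * \<eta> \<omega>)\<^sup>2 / 2)\<bar> \<le> (x * \<epsilon>) * (x * \<eta> \<omega>)\<^sup>2 / 2"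
      using exp_cubic_bound[of "x * \<eta> \<omega>"] a x by linarith
    moreover have "x\<^sup>2 / 2 * (1 + x * \<epsilon>) * (\<eta> \<omega>)\<^sup>2 = (x * \<eta> \<omega>)\<^sup>2 / 2 + (x * \<epsilon>) * (x * \<eta> \<omega>)\<^sup>2 / 2"
      "x\<^sup>2 / 2 * (1 - x * \<epsilon>) * (\<eta> \<omega>)\<^sup>2 = (x * \<eta> \<omega>)\<^sup>2 / 2 - (x * \<epsilon>) * (x * \<eta> \<omega>)\<^sup>2 / 2"
      by (simp_all add: field_simps power_mult_distrib)
    ultimately show "1 + (x * \<eta> \<omega> + x\<^sup>2 / 2 * (1 - x * \<epsilon>) * (\<eta> \<omega>)\<^sup>2) \<le> exp (x * \<eta> \<omega>)"
      "exp (x * \<eta> \<omega>) \<le> 1 + (x * \<eta> \<omega> + x\<^sup>2 / 2 * (1 + x * \<epsilon>) * (\<eta> \<omega>)\<^sup>2)"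
      by linarith+
  qed
  have "cond_in M T (1 + (x * (- \<alpha> / k) + x\<^sup>2 / 2 * (1 - x * \<epsilon>) * ((1 - \<beta>) / k)))
     (1 + (x * (\<alpha> / k) + x\<^sup>2 / 2 * (1 + x * \<epsilon>) * ((1 + \<beta>) / k))) (\<lambda>\<omega>. exp (x * \<eta> \<omega>))"
    by (rule cond_in_mono[OF lo hi _ bounds])
      (intro bmeas_exp bmeas_mult bmeas_const cond_in_bmeas[OF mean])
  moreover have "x * (- \<alpha> / k) + x\<^sup>2 / 2 * (1 - x * \<epsilon>) * ((1 - \<beta>) / k)
      = (- x * \<alpha> + x\<^sup>2 / 2 * ((1 - x * \<epsilon>) * (1 - \<beta>))) / k"
    "x * (\<alpha> / k) + x\<^sup>2 / 2 * (1 + x * \<epsilon>) * ((1 + \<beta>) / k)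
      = (x * \<alpha> + x\<^sup>2 / 2 * ((1 + x * \<epsilon>) * (1 + \<beta>))) / k"
    using k by (simp_all add: field_simps)
  ultimately show ?thesis by simp
qed

text \<open>The lower bound delivered by \<open>exp_cond_in\<close> may be negative, whereas
  \<open>laplace_upper\<close> asks for a nonnegative one; positivity of the exponential provides
  0.\<close>

lemma exp_cond_in_nonneg:
  assumes "cond_in M T l u (\<lambda>\<omega>. exp (\<eta> \<omega>))"
  shows "cond_in M T 0 u (\<lambda>\<omega>. exp (\<eta> \<omega>))"
proof -
  have "cond_in M T 0 0 (\<lambda>_. 0)" by (rule cond_in_const)
  from cond_in_mono[OF this assms cond_in_bmeas[OF assms]] show ?thesis by simp
qed

text \<open>The number \<open>j\<close> of summands is kept apart from the variance scale
  \<open>k\<close>, because the replacement argument needs the bound for every partial sum.\<close>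

lemma laplace_upper_sum:
  assumes mean: "cond_in M T (- \<alpha> / k) (\<alpha> / k) \<eta>"
    and var: "cond_in M T ((1 - \<beta>) / k) ((1 + \<beta>) / k) (\<lambda>\<omega>. (\<eta> \<omega>)\<^sup>2)"
    and bd: "\<And>\<omega>. \<omega> \<in> space M \<Longrightarrow> \<bar>\<eta> \<omega>\<bar> \<le> \<epsilon>"
    and x: "0 \<le> x" "x * \<epsilon> \<le> 1" and k: "k > 0" and nn: "0 \<le> \<alpha>" "0 \<le> \<beta>" "0 \<le> \<epsilon>"
  shows "(\<integral>\<omega>. exp (x * orbit_sum T \<eta> j \<omega>) \<partial>M)
    \<le> exp (real j / k * (x * \<alpha> + x\<^sup>2 / 2 * ((1 + x * \<epsilon>) * (1 + \<beta>))))"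
proof -
  let ?v = "(x * \<alpha> + x\<^sup>2 / 2 * ((1 + x * \<epsilon>) * (1 + \<beta>))) / k"
  have "0 \<le> ?v" using x k nn by (intro divide_nonneg_pos add_nonneg_nonneg mult_nonneg_nonneg) auto
  then have "(\<integral>\<omega>. exp (x * orbit_sum T \<eta> j \<omega>) \<partial>M) \<le> exp (real j * ?v)"
    by (intro laplace_upper[OF exp_cond_in_nonneg[OF exp_cond_in[OF mean var bd x k]]]) auto
  then show ?thesis by simp
qed

text \<open>Iteration gives the k-th power of \<open>1 + y\<close>, where \<open>y\<close> lies in
  the unit interval and \<open>1 + y\<close> is at least the exponential of \<open>y\<close> minus
  its square. Since \<open>k * y\<close> is at most the square of \<open>x\<close>, the loss is at
  most the subtracted fraction.\<close>

lemma laplace_lower_sum: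
  assumes mean: "cond_in M T 0 0 \<eta>"
    and var: "cond_in M T ((1 - \<beta>) / k) ((1 + \<beta>) / k) (\<lambda>\<omega>. (\<eta> \<omega>)\<^sup>2)"
    and bd: "\<And>\<omega>. \<omega> \<in> space M \<Longrightarrow> \<bar>\<eta> \<omega>\<bar> \<le> \<epsilon>"
    and x: "0 \<le> x" "x * \<epsilon> \<le> 1" "x\<^sup>2 \<le> real k" and k: "k > 0" and nn: "0 \<le> \<epsilon>" "0 \<le> \<beta>" "\<beta> \<le> 1"
  shows "exp (x\<^sup>2 / 2 * ((1 - x * \<epsilon>) * (1 - \<beta>)) - (x\<^sup>2)\<^sup>2 / real k)
     \<le> (\<integral>\<omega>. exp (x * orbit_sum T \<eta> k \<omega>) \<partial>M)"
proof -
  define y where "y = x\<^sup>2 / 2 * ((1 - x * \<epsilon>) * (1 - \<beta>)) / k"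
  have "(1 - x * \<epsilon>) * (1 - \<beta>) \<le> 1 * 1" using x nn by (intro mult_mono) auto
  then have "x\<^sup>2 / 2 * ((1 - x * \<epsilon>) * (1 - \<beta>)) \<le> x\<^sup>2 / 2 * 1" by (intro mult_left_mono) auto
  then have "x\<^sup>2 / 2 * ((1 - x * \<epsilon>) * (1 - \<beta>)) \<le> x\<^sup>2" using zero_le_power2[of x] by linarith
  then have y_le: "y \<le> x\<^sup>2 / k" unfolding y_def using k by (intro divide_right_mono) auto
  have y: "0 \<le> y" "y \<le> 1"
  proof -
    show "0 \<le> y" unfolding y_def using x nn k by (intro divide_nonneg_pos mult_nonneg_nonneg) auto
    have "x\<^sup>2 / k \<le> 1" using x k by simp
    then show "y \<le> 1" using y_le by linarith
  qed
  have "cond_in M T (1 + y) (1 + x\<^sup>2 / 2 * ((1 + x * \<epsilon>) * (1 + \<beta>)) / k) (\<lambda>\<omega>. exp (x * \<eta> \<omega>))"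
    using exp_cond_in[of 0 "real k" \<eta> \<beta> \<epsilon> x] mean var bd x k by (simp add: y_def)
  from integral_prod_iter[OF this, of k] y x nn k
  have "(1 + y) ^ k \<le> (\<integral>\<omega>. exp (x * orbit_sum T \<eta> k \<omega>) \<partial>M)"
    by (auto simp: exp_orbit_sum)
  moreover have "exp (y - y\<^sup>2) \<le> 1 + y"
    using ln_one_plus_pos_lower_bound[OF y] y by (simp add: ln_ge_iff)
  then have "exp (real k * (y - y\<^sup>2)) \<le> (1 + y) ^ k"
    unfolding exp_of_nat_mult by (intro power_mono) auto
  moreover have "x\<^sup>2 / 2 * ((1 - x * \<epsilon>) * (1 - \<beta>)) - (x\<^sup>2)\<^sup>2 / real k \<le> real k * (y - y\<^sup>2)"
  proof -
    have "y\<^sup>2 \<le> (x\<^sup>2 / k)\<^sup>2" using y y_le by (intro power_mono) auto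
    then have "real k * y\<^sup>2 \<le> real k * (x\<^sup>2 / k)\<^sup>2" by (intro mult_left_mono) auto
    also have "\<dots> = (x\<^sup>2)\<^sup>2 / real k" using k by (simp add: power2_eq_square)
    moreover have "real k * y = x\<^sup>2 / 2 * ((1 - x * \<epsilon>) * (1 - \<beta>))" using k by (simp add: y_def)
    ultimately show ?thesis unfolding right_diff_distrib[of "real k" y] by linarith
  qed
  ultimately show ?thesis using exp_le_cancel_iff order_trans by blast
qed

text \<open>Chernoff bounds on both sides for the sum of squares, with \<open>c\<close> left free.
  The second-order part of \<open>exp (c * \<eta>^2)\<close> is at most
  \<open>c^2 * \<epsilon>^2 * \<eta>^2\<close>, and these terms have total conditional mean at most
  twice \<open>c^2 * \<epsilon>^2\<close>.\<close>

lemma quadratic_concentration: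
  assumes var: "cond_in M T ((1 - \<beta>) / k) ((1 + \<beta>) / k) (\<lambda>\<omega>. (\<eta> \<omega>)\<^sup>2)" and \<eta>: "bmeas M \<eta>"
    and bd: "\<And>\<omega>. \<omega> \<in> space M \<Longrightarrow> \<bar>\<eta> \<omega>\<bar> \<le> \<epsilon>"
    and c: "0 \<le> c" "c * \<epsilon>\<^sup>2 \<le> 1" and k: "k > 0" and nn: "0 \<le> \<beta>" "\<beta> \<le> 1"
  shows "measure M {\<omega> \<in> space M. \<gamma> \<le> \<bar>orbit_sum T (\<lambda>\<omega>. (\<eta> \<omega>)\<^sup>2) k \<omega> - 1\<bar>}
    \<le> 2 * exp (- c * \<gamma> + c * \<beta> + 2 * c\<^sup>2 * \<epsilon>\<^sup>2)"
proof -
  let ?\<eta>2 = "\<lambda>\<omega>. (\<eta> \<omega>)\<^sup>2" and ?Q = "orbit_sum T (\<lambda>\<omega>. (\<eta> \<omega>)\<^sup>2) k"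
  let ?w = "c\<^sup>2 * \<epsilon>\<^sup>2"
  have w: "0 \<le> ?w" "?w \<le> c"
    using c mult_left_mono[OF c(2) c(1)] by (auto simp: power2_eq_square mult.assoc)
  have [measurable]: "?Q \<in> borel_measurable M" using \<eta> by (auto intro!: bmeas_measurable)
  have sq: "(c * ?\<eta>2 \<omega>)\<^sup>2 \<le> ?w * ?\<eta>2 \<omega>" "c * ?\<eta>2 \<omega> \<le> 1" if "\<omega> \<in> space M" for \<omega>
  proof -
    have "?\<eta>2 \<omega> \<le> \<epsilon>\<^sup>2" using bd[OF that] by (simp add: abs_le_square_iff[symmetric])
    then show "(c * ?\<eta>2 \<omega>)\<^sup>2 \<le> ?w * ?\<eta>2 \<omega>" "c * ?\<eta>2 \<omega> \<le> 1"
      using c mult_right_mono[of "?\<eta>2 \<omega>" "\<epsilon>\<^sup>2" "c\<^sup>2 * ?\<eta>2 \<omega>"] mult_left_mono[of "?\<eta>2 \<omega>" "\<epsilon>\<^sup>2" c]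
      by (auto simp: power_mult_distrib power2_eq_square mult_ac)
  qed
  have up: "cond_in M T 0 (1 + (c + ?w) * ((1 + \<beta>) / k)) (\<lambda>\<omega>. exp (c * ?\<eta>2 \<omega>))"
  proof -
    have "0 \<le> c + ?w" using c w by linarith
    then have hi: "cond_in M T (1 + (c + ?w) * ((1 - \<beta>) / k)) (1 + (c + ?w) * ((1 + \<beta>) / k))
        (\<lambda>\<omega>. 1 + (c + ?w) * ?\<eta>2 \<omega>)"
      by (intro cond_in_add cond_in_const cond_in_cmult var)
    have ub: "exp (c * ?\<eta>2 \<omega>) \<le> 1 + (c + ?w) * ?\<eta>2 \<omega>" if "\<omega> \<in> space M" for \<omega>
      using sq[OF that] exp_bound[of "c * ?\<eta>2 \<omega>"] c by (simp add: distrib_right)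
    show ?thesis
      by (rule cond_in_mono[OF cond_in_const hi _ _ ub])
        (auto intro!: bmeas_exp bmeas_mult bmeas_power \<eta>)
  qed
  have down: "cond_in M T 0 (1 + (- (c * ((1 - \<beta>) / k)) + ?w * ((1 + \<beta>) / k))) (\<lambda>\<omega>. exp ((- c) * ?\<eta>2 \<omega>))"
  proof -
    have hi: "cond_in M T (1 + (- (c * ((1 + \<beta>) / k)) + ?w * ((1 - \<beta>) / k)))
        (1 + (- (c * ((1 - \<beta>) / k)) + ?w * ((1 + \<beta>) / k)))
        (\<lambda>\<omega>. 1 + (- (c * ?\<eta>2 \<omega>) + ?w * ?\<eta>2 \<omega>))"
      by (intro cond_in_add cond_in_const cond_in_uminus cond_in_cmult var c(1) w(1))
    have ub: "exp ((- c) * ?\<eta>2 \<omega>) \<le> 1 + (- (c * ?\<eta>2 \<omega>) + ?w * ?\<eta>2 \<omega>)" if "\<omega> \<in> space M" for \<omega>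
      using exp_uminus_le[of "c * ?\<eta>2 \<omega>"] sq[OF that] c by simp
    show ?thesis
      by (rule cond_in_mono[OF cond_in_const hi _ _ ub])
        (auto intro!: bmeas_exp bmeas_mult bmeas_power \<eta> simp del: mult_minus_left)
  qed
  have p1: "c\<^sup>2 * \<epsilon>\<^sup>2 * \<beta> \<le> c\<^sup>2 * \<epsilon>\<^sup>2" using w nn mult_left_mono[of \<beta> 1 ?w] by simp
  have "measure M {\<omega> \<in> space M. 1 + \<gamma> \<le> ?Q \<omega>} \<le> exp (- c * (1 + \<gamma>)) * (\<integral>\<omega>. exp (c * ?Q \<omega>) \<partial>M)"
    using \<eta> c by (intro chernoff) auto
  also have "\<dots> \<le> exp (- c * (1 + \<gamma>)) * exp (real k * ((c + ?w) * ((1 + \<beta>) / k)))"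
  proof (intro mult_left_mono laplace_upper[OF up])
    have "0 \<le> (c + ?w) * ((1 + \<beta>) / k)"
      using nn by (intro mult_nonneg_nonneg add_nonneg_nonneg divide_nonneg_nonneg c(1) w(1)) auto
    then show "0 \<le> 1 + (c + ?w) * ((1 + \<beta>) / k)" by linarith
  qed auto
  also have "\<dots> = exp (- c * (1 + \<gamma>) + (c + ?w) * (1 + \<beta>))"
    using k by (simp add: exp_add[symmetric])
  also have "\<dots> \<le> exp (- c * \<gamma> + c * \<beta> + 2 * c\<^sup>2 * \<epsilon>\<^sup>2)"
    using p1 by (simp add: algebra_simps)
  finally have 1: "measure M {\<omega> \<in> space M. 1 + \<gamma> \<le> ?Q \<omega>} \<le> exp (- c * \<gamma> + c * \<beta> + 2 * c\<^sup>2 * \<epsilon>\<^sup>2)" .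
  \<comment> \<open>Testing the conditional bound against the constant 1 shows that an upper bound
    for a positive function is nonnegative.\<close>
  have v: "0 \<le> 1 + (- (c * ((1 - \<beta>) / k)) + ?w * ((1 + \<beta>) / k))"
  proof -
    have "0 \<le> (1 + (- (c * ((1 - \<beta>) / k)) + ?w * ((1 + \<beta>) / k))) * (\<integral>\<omega>. 1 \<partial>M)"
      by (rule order_trans[OF _ cond_inD(2)[OF down, of "\<lambda>_. 1"]]) (auto intro!: integral_nonneg_AE)
    then show ?thesis by (simp add: prob_space)
  qed
  have "measure M {\<omega> \<in> space M. - (1 - \<gamma>) \<le> - ?Q \<omega>} \<le> exp (- c * (- (1 - \<gamma>))) * (\<integral>\<omega>. exp (c * (- ?Q \<omega>)) \<partial>M)"
    using \<eta> c by (intro chernoff) auto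
  also have "(\<integral>\<omega>. exp (c * (- ?Q \<omega>)) \<partial>M) = (\<integral>\<omega>. exp ((- c) * ?Q \<omega>) \<partial>M)" by simp
  also have "exp (- c * (- (1 - \<gamma>))) * \<dots>
      \<le> exp (- c * (- (1 - \<gamma>))) * exp (real k * (- (c * ((1 - \<beta>) / k)) + ?w * ((1 + \<beta>) / k)))"
    using v by (intro mult_left_mono laplace_upper[OF down]) auto
  also have "\<dots> = exp (c * (1 - \<gamma>) - c * (1 - \<beta>) + ?w * (1 + \<beta>))"
    using k by (simp add: exp_add[symmetric] field_simps)
  also have "\<dots> \<le> exp (- c * \<gamma> + c * \<beta> + 2 * c\<^sup>2 * \<epsilon>\<^sup>2)"
    using p1 by (simp add: algebra_simps)
  finally have 2: "measure M {\<omega> \<in> space M. - (1 - \<gamma>) \<le> - ?Q \<omega>} \<le> exp (- c * \<gamma> + c * \<beta> + 2 * c\<^sup>2 * \<epsilon>\<^sup>2)" .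
  have "measure M {\<omega> \<in> space M. \<gamma> \<le> \<bar>?Q \<omega> - 1\<bar>}
     \<le> measure M ({\<omega> \<in> space M. 1 + \<gamma> \<le> ?Q \<omega>} \<union> {\<omega> \<in> space M. - (1 - \<gamma>) \<le> - ?Q \<omega>})"
    by (intro finite_measure_mono) auto
  also have "\<dots> \<le> measure M {\<omega> \<in> space M. 1 + \<gamma> \<le> ?Q \<omega>} + measure M {\<omega> \<in> space M. - (1 - \<gamma>) \<le> - ?Q \<omega>}"
    by (intro measure_Un_le) auto
  finally show ?thesis using 1 2 by linarith
qed

end

section \<open>The normal tail\<close>

definition ntail :: "real \<Rightarrow> real" where
  "ntail z = 1 - std_normal_cdf z"

lemma std_normal_density_measure:
  "measure std_normal_distribution {a<..b} = integral {a..b} std_normal_density"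
proof -
  have c: "continuous_on {a..b} std_normal_density"
    unfolding std_normal_density_def by (intro continuous_intros) auto
  have "measure std_normal_distribution {a<..b} = (\<integral>x\<in>{a<..b}. std_normal_density x \<partial>lborel)"
    unfolding measure_def set_lebesgue_integral_def
    by (subst emeasure_density, simp, simp, subst integral_eq_nn_integral)
      (auto intro!: arg_cong[where f = enn2real] nn_integral_cong split: split_indicator)
  also have "\<dots> = (\<integral>x\<in>{a..b}. std_normal_density x \<partial>lborel)"
  proof (rule set_integral_cong_set)
    have "AE x in lborel. x \<noteq> a" by (rule AE_lborel_singleton)
    then show "AE x in lborel. (x \<in> {a..b}) = (x \<in> {a<..b})" by eventually_elim auto
  qed (auto simp: set_borel_measurable_def)
  also have "\<dots> = integral {a..b} std_normal_density"
    using borel_integrable_atLeastAtMost'[OF c] by (intro set_borel_integral_eq_integral)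
  finally show ?thesis .
qed

lemma std_normal_cdf_diff:
  assumes "a \<le> b"
  shows "std_normal_cdf b = std_normal_cdf a + integral {a..b} std_normal_density"
proof -
  interpret real_distribution std_normal_distribution by (rule real_dist_normal_dist)
  have "cdf std_normal_distribution b - cdf std_normal_distribution a
      = measure std_normal_distribution {a<..b}"
    using assms by (cases "a = b") (auto simp: cdf_diff_eq)
  then show ?thesis by (simp add: std_normal_cdf_def std_normal_density_measure)
qed

lemma ntail_deriv: "(ntail has_real_derivative - std_normal_density z) (at z)"
proof -
  have c: "continuous_on {z - 1..z + 1} std_normal_density"
    unfolding std_normal_density_def by (intro continuous_intros) auto
  have "((\<lambda>u. integral {z - 1..u} std_normal_density) has_real_derivative std_normal_density z)
      (at z within {z - 1..z + 1})"
    by (rule integral_has_real_derivative[OF c]) auto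
  then have "((\<lambda>u. integral {z - 1..u} std_normal_density) has_real_derivative std_normal_density z) (at z)"
    by (simp add: at_within_Icc_at)
  then have "((\<lambda>u. 1 - (std_normal_cdf (z - 1) + integral {z - 1..u} std_normal_density))
      has_real_derivative - std_normal_density z) (at z)"
    by (auto intro!: derivative_eq_intros)
  moreover have ev: "eventually (\<lambda>u. 1 - (std_normal_cdf (z - 1) + integral {z - 1..u} std_normal_density) = ntail u) (nhds z)"
  proof -
    have "eventually (\<lambda>u. u \<in> {z - 1<..}) (nhds z)" by (intro eventually_nhds_in_open) auto
    then show ?thesis
    proof eventually_elim
      case (elim u)
      then show ?case using std_normal_cdf_diff[of "z - 1" u] by (simp add: ntail_def)
    qed
  qed
  ultimately show ?thesis using DERIV_cong_ev[OF refl ev refl] by blast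
qed

lemma ntail_at_top: "(ntail \<longlongrightarrow> 0) at_top"
proof -
  interpret real_distribution std_normal_distribution by (rule real_dist_normal_dist)
  have "((\<lambda>z. 1 - cdf std_normal_distribution z) \<longlongrightarrow> 1 - 1) at_top"
    by (intro tendsto_intros cdf_lim_at_top_prob)
  then show ?thesis by (simp add: ntail_def[abs_def] std_normal_cdf_def)
qed

lemma ntail_antimono: "a \<le> b \<Longrightarrow> ntail b \<le> ntail a"
  by (rule DERIV_nonpos_imp_nonincreasing[of a b ntail]) (auto intro!: exI ntail_deriv)

lemma ntail_nonneg: "0 \<le> ntail z"
proof (rule tendsto_upperbound[OF ntail_at_top])
  show "eventually (\<lambda>u. ntail u \<le> ntail z) at_top"
    using eventually_ge_at_top[of z] by eventually_elim (rule ntail_antimono)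
qed simp

lemma ntail_le_1: "ntail z \<le> 1"
proof -
  interpret real_distribution std_normal_distribution by (rule real_dist_normal_dist)
  show ?thesis using cdf_nonneg[of z] by (simp add: ntail_def std_normal_cdf_def)
qed

text \<open>A function that decreases to the limit 0 is nonnegative. This reduces both Mills ratio
  estimates to the sign of a derivative.\<close>

lemma ntail_nonneg_by_deriv:
  fixes F :: "real \<Rightarrow> real"
  assumes "\<And>z. c \<le> z \<Longrightarrow> (F has_real_derivative F' z) (at z)" "\<And>z. c \<le> z \<Longrightarrow> F' z \<le> 0"
    and "(F \<longlongrightarrow> 0) at_top" "c \<le> x"
  shows "0 \<le> F x"
proof (rule tendsto_upperbound[OF assms(3)])
  show "eventually (\<lambda>u. F u \<le> F x) at_top"
    using eventually_ge_at_top[of x]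
  proof eventually_elim
    fix u assume "x \<le> u"
    then show "F u \<le> F x"
    proof (rule DERIV_nonpos_imp_nonincreasing)
      fix y assume "x \<le> y" "y \<le> u"
      then show "\<exists>d. (F has_real_derivative d) (at y) \<and> d \<le> 0"
        using assms(1,2)[of y] assms(4) by (intro exI[of _ "F' y"]) auto
    qed
  qed
qed simp

lemma std_normal_density_deriv:
  "(std_normal_density has_real_derivative - z * std_normal_density z) (at z)"
proof -
  have "((\<lambda>x. 1 / sqrt (2 * pi) * exp (- x\<^sup>2 / 2)) has_real_derivative
      1 / sqrt (2 * pi) * (- z * exp (- z\<^sup>2 / 2))) (at z)"
    by (rule DERIV_cmult) (auto intro!: derivative_eq_intros)
  then show ?thesis by (simp add: std_normal_density_def[abs_def])
qed

lemma std_normal_density_at_top: "(std_normal_density \<longlongrightarrow> 0) at_top"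
  unfolding std_normal_density_def by real_asymp

text \<open>The denominator \<open>1 + x\<close>, in place of the asymptotically sharp
  \<open>x\<close>, keeps the bound finite down to \<open>x = 0\<close>.\<close>

lemma ntail_lower:
  assumes "0 \<le> x"
  shows "std_normal_density x / (1 + x) \<le> ntail x"
proof -
  have "0 \<le> ntail x - std_normal_density x / (1 + x)"
  proof (rule ntail_nonneg_by_deriv[OF _ _ _ assms])
    fix z :: real assume z: "0 \<le> z"
    have nz: "1 + z \<noteq> 0" using z by simp
    show "((\<lambda>x. ntail x - std_normal_density x / (1 + x)) has_real_derivative
        - std_normal_density z - ((- z * std_normal_density z) * (1 + z) - std_normal_density z * 1)
           / ((1 + z) * (1 + z))) (at z)"
      by (intro DERIV_diff DERIV_divide ntail_deriv std_normal_density_deriv nz)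
        (auto intro!: derivative_eq_intros)
    have "0 \<le> z * std_normal_density z" using z by simp
    then have "- ((- z * std_normal_density z) * (1 + z) - std_normal_density z * 1)
        \<le> std_normal_density z * ((1 + z) * (1 + z))"
      by (simp add: algebra_simps)
    then have "- (((- z * std_normal_density z) * (1 + z) - std_normal_density z * 1)
           / ((1 + z) * (1 + z))) \<le> std_normal_density z"
      unfolding minus_divide_left using z by (subst pos_divide_le_eq) auto
    then show "- std_normal_density z - ((- z * std_normal_density z) * (1 + z) - std_normal_density z * 1)
           / ((1 + z) * (1 + z)) \<le> 0" by linarith
  next
    have "((\<lambda>x. std_normal_density x / (1 + x)) \<longlongrightarrow> 0) at_top"
      unfolding std_normal_density_def by real_asymp
    from tendsto_diff[OF ntail_at_top this]
    show "((\<lambda>x. ntail x - std_normal_density x / (1 + x)) \<longlongrightarrow> 0) at_top" by simp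
  qed
  then show ?thesis by simp
qed

lemma ntail_pos: "0 < ntail x"
proof -
  have "0 < std_normal_density (max 0 x) / (1 + max 0 x)"
    by (intro divide_pos_pos normal_density_pos) auto
  also have "\<dots> \<le> ntail (max 0 x)" by (rule ntail_lower) simp
  also have "\<dots> \<le> ntail x" by (rule ntail_antimono) simp
  finally show ?thesis .
qed

lemma std_normal_density_le: "std_normal_density x \<le> exp (- x\<^sup>2 / 2)"
proof -
  have "1 \<le> sqrt (2 * pi)" using pi_gt3 by simp
  then have "1 / sqrt (2 * pi) \<le> 1" by simp
  then have "1 / sqrt (2 * pi) * exp (- x\<^sup>2 / 2) \<le> 1 * exp (- x\<^sup>2 / 2)"
    by (intro mult_right_mono) auto
  then show ?thesis by (simp only: std_normal_density_def mult_1)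
qed

lemma ntail_upper:
  assumes "1 \<le> x"
  shows "ntail x \<le> exp (- x\<^sup>2 / 2)"
proof -
  have "0 \<le> std_normal_density x - ntail x"
  proof (rule ntail_nonneg_by_deriv[OF _ _ _ assms])
    fix z :: real assume z: "1 \<le> z"
    show "((\<lambda>x. std_normal_density x - ntail x) has_real_derivative
        std_normal_density z - z * std_normal_density z) (at z)"
      by (auto intro!: derivative_eq_intros ntail_deriv std_normal_density_deriv)
    show "std_normal_density z - z * std_normal_density z \<le> 0"
      using z mult_right_mono[of 1 z "std_normal_density z"] by (simp add: normal_density_nonneg)
  next
    show "((\<lambda>x. std_normal_density x - ntail x) \<longlongrightarrow> 0) at_top"
      using tendsto_diff[OF std_normal_density_at_top ntail_at_top] by simp
  qed
  then show ?thesis using std_normal_density_le[of x] by linarith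
qed

text \<open>Converts exponential weights into multiples of the normal tail. The price is one factor
  \<open>1 + x\<close>; the 3 bounds \<open>sqrt (2 * pi)\<close>.\<close>

lemma exp_le_ntail:
  assumes "0 \<le> x"
  shows "exp (- x\<^sup>2 / 2) \<le> 3 * (1 + x) * ntail x"
proof -
  have "sqrt (2 * pi) \<le> 3"
    using pi_less_4 by (intro real_le_lsqrt) auto
  have "exp (- x\<^sup>2 / 2) = sqrt (2 * pi) * std_normal_density x"
    by (simp add: std_normal_density_def)
  also have "\<dots> \<le> 3 * std_normal_density x"
    using \<open>sqrt (2 * pi) \<le> 3\<close> by (intro mult_right_mono) auto
  also have "std_normal_density x \<le> (1 + x) * ntail x"
    using ntail_lower[OF assms] assms by (simp add: divide_simps mult.commute)
  finally show ?thesis by (simp only: mult.assoc)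
qed

text \<open>Mean value theorem: \<open>x * d \<le> 1\<close> keeps the Gaussian exponential on the
  interval within a factor e of its value at \<open>x\<close>. The constant 9 is 3 for
  \<open>exp 1\<close> times the 3 of \<open>exp_le_ntail\<close>.\<close>

lemma ntail_shift:
  assumes "0 \<le> x" "0 \<le> d" "x * d \<le> 1"
  shows "ntail (x - d) \<le> (1 + 9 * (1 + x) * d) * ntail x" "(1 - 9 * (1 + x) * d) * ntail x \<le> ntail (x + d)"
proof -
  have K: "exp (1 + - x\<^sup>2 / 2) \<le> 9 * (1 + x) * ntail x"
  proof -
    have "exp (1 + - x\<^sup>2 / 2) = exp 1 * exp (- x\<^sup>2 / 2)" by (rule exp_add)
    also have "\<dots> \<le> 3 * (3 * (1 + x) * ntail x)"
      using exp_le exp_le_ntail[OF assms(1)] by (intro mult_mono) auto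
    also have "\<dots> = 9 * (1 + x) * ntail x" by simp
    finally show ?thesis .
  qed
  show "ntail (x - d) \<le> (1 + 9 * (1 + x) * d) * ntail x"
  proof (cases "d = 0")
    case False
    then obtain z where z: "x - d < z" "z < x" "ntail x - ntail (x - d) = (x - (x - d)) * - std_normal_density z"
      using MVT2[of "x - d" x ntail "\<lambda>z. - std_normal_density z"] ntail_deriv assms(2) by auto
    have "0 \<le> (z - x)\<^sup>2" by simp
    then have "- z\<^sup>2 / 2 \<le> - x\<^sup>2 / 2 + x * (x - z)" by (simp add: power2_eq_square algebra_simps)
    also have "x * (x - z) \<le> x * d" using z assms by (intro mult_left_mono) auto
    finally have "- z\<^sup>2 / 2 \<le> 1 + - x\<^sup>2 / 2" using assms by simp
    then have "exp (- z\<^sup>2 / 2) \<le> exp (1 + - x\<^sup>2 / 2)" by simp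
    then have "std_normal_density z \<le> 9 * (1 + x) * ntail x"
      using std_normal_density_le[of z] K by linarith
    then have "d * std_normal_density z \<le> d * (9 * (1 + x) * ntail x)"
      using assms by (intro mult_left_mono)
    then show ?thesis using z(3) by (simp add: algebra_simps)
  qed simp
  show "(1 - 9 * (1 + x) * d) * ntail x \<le> ntail (x + d)"
  proof (cases "d = 0")
    case False
    then obtain z where z: "x < z" "z < x + d" "ntail (x + d) - ntail x = ((x + d) - x) * - std_normal_density z"
      using MVT2[of x "x + d" ntail "\<lambda>z. - std_normal_density z"] ntail_deriv assms(2) by auto
    have "x\<^sup>2 \<le> z\<^sup>2" using z assms by (intro power_mono) auto
    then have "exp (- z\<^sup>2 / 2) \<le> exp (1 + - x\<^sup>2 / 2)" by simp
    then have "std_normal_density z \<le> 9 * (1 + x) * ntail x"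
      using std_normal_density_le[of z] K by linarith
    then have "d * std_normal_density z \<le> d * (9 * (1 + x) * ntail x)"
      using assms by (intro mult_left_mono)
    then show ?thesis using z(3) by (simp add: algebra_simps)
  qed simp
qed

section \<open>Lindeberg replacement with exponential weights\<close>

text \<open>The smoothed indicator \<open>htail s\<close> solves the backward heat equation, with \<open>s\<close> the
  remaining variance.\<close>

definition heat :: "real \<Rightarrow> real \<Rightarrow> real" where
  "heat s z = std_normal_density (z / sqrt s) / sqrt s"

definition htail :: "real \<Rightarrow> real \<Rightarrow> real" where
  "htail s z = ntail (z / sqrt s)"

lemma heat_nonneg: "0 < s \<Longrightarrow> 0 \<le> heat s z"
  by (simp add: heat_def)

lemma htail_deriv_z:
  assumes "0 < s"
  shows "((\<lambda>z. htail s z) has_real_derivative - heat s z) (at z)"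
proof -
  have "((\<lambda>z. ntail (z / sqrt s)) has_real_derivative - std_normal_density (z / sqrt s) * (1 / sqrt s)) (at z)"
    by (rule DERIV_chain2[OF ntail_deriv]) (use assms in \<open>auto intro!: derivative_eq_intros simp: divide_simps\<close>)
  then show ?thesis by (simp add: htail_def heat_def)
qed

lemma heat_deriv_z:
  assumes "0 < s"
  shows "((\<lambda>z. heat s z) has_real_derivative - (z / s) * heat s z) (at z)"
proof -
  have "((\<lambda>z. std_normal_density (z / sqrt s)) has_real_derivative
      (- (z / sqrt s) * std_normal_density (z / sqrt s)) * (1 / sqrt s)) (at z)"
    by (rule DERIV_chain2[OF std_normal_density_deriv]) (use assms in \<open>auto intro!: derivative_eq_intros simp: divide_simps\<close>)
  from DERIV_cdivide[OF this, of "sqrt s"] show ?thesis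
    using assms by (simp add: heat_def)
qed

lemma scaled_deriv_s:
  assumes "0 < s"
  shows "((\<lambda>s. z / sqrt s) has_real_derivative - z / (2 * s * sqrt s)) (at s)"
proof -
  have "((\<lambda>s. z / sqrt s) has_real_derivative (0 * sqrt s - z * (inverse (sqrt s) / 2)) / (sqrt s * sqrt s)) (at s)"
    using assms by (intro DERIV_divide DERIV_const DERIV_real_sqrt) auto
  then show ?thesis using assms by (simp add: divide_simps mult_ac)
qed

lemma htail_deriv_s:
  assumes "0 < s"
  shows "((\<lambda>s. htail s z) has_real_derivative z / s * heat s z / 2) (at s)"
proof -
  have "((\<lambda>s. ntail (z / sqrt s)) has_real_derivative - std_normal_density (z / sqrt s) * (- z / (2 * s * sqrt s))) (at s)"
    by (rule DERIV_chain2[OF ntail_deriv scaled_deriv_s[OF assms]])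
  then show ?thesis by (simp add: htail_def heat_def mult_ac)
qed

lemma heat_deriv_s:
  assumes "0 < s"
  shows "((\<lambda>s. heat s z) has_real_derivative heat s z * ((z / s)\<^sup>2 / 2 - 1 / (2 * s))) (at s)"
proof -
  have "((\<lambda>s. std_normal_density (z / sqrt s)) has_real_derivative
      (- (z / sqrt s) * std_normal_density (z / sqrt s)) * (- z / (2 * s * sqrt s))) (at s)"
    by (rule DERIV_chain2[OF std_normal_density_deriv scaled_deriv_s[OF assms]])
  then have "((\<lambda>s. std_normal_density (z / sqrt s) / sqrt s) has_real_derivative
      ((- (z / sqrt s) * std_normal_density (z / sqrt s)) * (- z / (2 * s * sqrt s)) * sqrt s
        - std_normal_density (z / sqrt s) * (inverse (sqrt s) / 2)) / (sqrt s * sqrt s)) (at s)"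
    using assms by (intro DERIV_divide DERIV_real_sqrt) auto
  moreover have "((- (z / sqrt s) * std_normal_density (z / sqrt s)) * (- z / (2 * s * sqrt s)) * sqrt s
        - std_normal_density (z / sqrt s) * (inverse (sqrt s) / 2)) / (sqrt s * sqrt s)
      = heat s z * ((z / s)\<^sup>2 / 2 - 1 / (2 * s))"
    using assms by (simp add: heat_def divide_simps power2_eq_square) (simp add: algebra_simps)
  ultimately show ?thesis by (simp add: heat_def)
qed

text \<open>The second derivative of \<open>htail\<close> in space and twice its derivative in time;
  the equality of the two is the heat equation that drives the replacement.\<close>

definition heat1 :: "real \<Rightarrow> real \<Rightarrow> real" where
  "heat1 s z = z / s * heat s z"

lemma heat1_deriv_z:
  assumes "0 < s"
  shows "((\<lambda>z. heat1 s z) has_real_derivative (1 / s - (z / s)\<^sup>2) * heat s z) (at z)"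
proof -
  have "((\<lambda>z. z / s * heat s z) has_real_derivative (1 / s) * heat s z + (- (z / s) * heat s z) * (z / s)) (at z)"
    using assms by (intro DERIV_mult heat_deriv_z) (auto intro!: derivative_eq_intros)
  then show ?thesis by (simp add: heat1_def[abs_def] power2_eq_square algebra_simps)
qed

lemma heat1_deriv_s:
  assumes "0 < s"
  shows "((\<lambda>s. heat1 s z) has_real_derivative ((z / s) ^ 3 / 2 - 3 / 2 * (z / s) * (1 / s)) * heat s z) (at s)"
proof -
  have "((\<lambda>s. z / s * heat s z) has_real_derivative
      (- z / s\<^sup>2) * heat s z + heat s z * ((z / s)\<^sup>2 / 2 - 1 / (2 * s)) * (z / s)) (at s)"
    using assms by (intro DERIV_mult heat_deriv_s) (auto intro!: derivative_eq_intros simp: power2_eq_square)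
  moreover have "(- z / s\<^sup>2) * heat s z + heat s z * ((z / s)\<^sup>2 / 2 - 1 / (2 * s)) * (z / s)
      = ((z / s) ^ 3 / 2 - 3 / 2 * (z / s) * (1 / s)) * heat s z"
    using assms by (simp add: power2_eq_square power3_eq_cube field_simps)
  ultimately show ?thesis by (simp add: heat1_def[abs_def])
qed

text \<open>Completing the square: relative to the exponential weight, every factor \<open>z / s\<close> costs at
  most \<open>x + 1 / \<delta>\<close> on the time range \<open>s \<ge> \<delta>\<^sup>2\<close>.\<close>

lemma heat_weight:
  assumes l: "0 < \<delta>" "\<delta>\<^sup>2 \<le> s" and x: "0 \<le> x" and i: "i \<le> 3"
  shows "\<bar>z / s\<bar> ^ i * heat s z \<le> exp (9 / 2) * (x + 1 / \<delta>) ^ i * exp (x\<^sup>2 * s / 2 - x * z) / sqrt s"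
proof -
  have s: "0 < s" using l zero_less_power[of \<delta> 2] by linarith
  \<comment> \<open>Under the Gaussian weight tilted by \<open>x\<close> the variable
    \<open>z\<close> has mean \<open>x * s\<close> and variance \<open>s\<close>, and
    \<open>v\<close> is its standardization.\<close>
  define v where "v = (z - x * s) / sqrt s"
  have "1 / sqrt s \<le> 1 / \<delta>"
    using l s real_le_rsqrt[of \<delta> s] by (intro divide_left_mono mult_pos_pos) auto
  moreover have zs: "z / s = x + v * (1 / sqrt s)"
    using s by (simp add: v_def field_simps)
  moreover have "\<bar>x + v * (1 / sqrt s)\<bar> \<le> x + \<bar>v\<bar> * (1 / sqrt s)"
    using x s abs_triangle_ineq[of x "v * (1 / sqrt s)"] by (simp add: abs_mult)
  moreover have "\<bar>v\<bar> * (1 / sqrt s) \<le> \<bar>v\<bar> * (1 / \<delta>)"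
    using calculation(1) by (intro mult_left_mono) auto
  moreover have "x + \<bar>v\<bar> * (1 / \<delta>) \<le> (x + 1 / \<delta>) * (1 + \<bar>v\<bar>)"
    using x l by (simp add: algebra_simps)
  ultimately have zb: "\<bar>z / s\<bar> \<le> (x + 1 / \<delta>) * (1 + \<bar>v\<bar>)" by linarith
  \<comment> \<open>At most three factors \<open>1 + |v|\<close> occur; they are bounded by
    \<open>exp (3 * |v|)\<close>, and \<open>3 * |v|\<close> minus half the square of
    \<open>v\<close> never exceeds 9/2. This is the origin of \<open>exp (9 / 2)\<close>.\<close>
  have "(1 + \<bar>v\<bar>) ^ i \<le> exp \<bar>v\<bar> ^ i" by (intro power_mono exp_ge_add_one_self) auto
  also have "\<dots> \<le> exp \<bar>v\<bar> ^ 3" using i by (intro power_increasing) auto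
  also have "\<dots> = exp (3 * \<bar>v\<bar>)" by (simp add: exp_of_nat_mult[symmetric])
  finally have "(1 + \<bar>v\<bar>) ^ i * exp (- v\<^sup>2 / 2) \<le> exp (3 * \<bar>v\<bar>) * exp (- v\<^sup>2 / 2)"
    by (intro mult_right_mono) auto
  also have "\<dots> \<le> exp (9 / 2)"
  proof -
    have "0 \<le> (\<bar>v\<bar> - 3)\<^sup>2" by simp
    then have "3 * \<bar>v\<bar> + - v\<^sup>2 / 2 \<le> 9 / 2" by (simp add: power2_eq_square algebra_simps)
    then show ?thesis by (simp add: exp_add[symmetric])
  qed
  finally have vb: "(1 + \<bar>v\<bar>) ^ i * exp (- v\<^sup>2 / 2) \<le> exp (9 / 2)" .
  have k: "0 \<le> x + 1 / \<delta>" using x l by simp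
  have "- (z / sqrt s)\<^sup>2 / 2 = (x\<^sup>2 * s / 2 - x * z) + - v\<^sup>2 / 2"
    using s by (simp add: v_def power_divide divide_simps) (simp add: power2_eq_square algebra_simps)
  then have d: "std_normal_density (z / sqrt s) \<le> exp (x\<^sup>2 * s / 2 - x * z) * exp (- v\<^sup>2 / 2)"
    using std_normal_density_le[of "z / sqrt s"] by (simp add: exp_add[symmetric])
  have "\<bar>z / s\<bar> ^ i * std_normal_density (z / sqrt s)
      \<le> ((x + 1 / \<delta>) * (1 + \<bar>v\<bar>)) ^ i * (exp (x\<^sup>2 * s / 2 - x * z) * exp (- v\<^sup>2 / 2))"
    using zb d k by (intro mult_mono power_mono) auto
  also have "\<dots> = (x + 1 / \<delta>) ^ i * exp (x\<^sup>2 * s / 2 - x * z) * ((1 + \<bar>v\<bar>) ^ i * exp (- v\<^sup>2 / 2))"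
    by (simp add: power_mult_distrib)
  also have "\<dots> \<le> (x + 1 / \<delta>) ^ i * exp (x\<^sup>2 * s / 2 - x * z) * exp (9 / 2)"
    using vb k by (intro mult_left_mono mult_nonneg_nonneg) auto
  finally show ?thesis
    using s by (simp add: heat_def divide_right_mono mult_ac)
qed

text \<open>Third-order Taylor expansion in space and second-order in time. By the heat equation the
  surviving main terms carry \<open>u\<close> and \<open>u^2 - h\<close>, whose conditional means
  are small; the powers of \<open>x + 1 / \<delta>\<close> count the factors \<open>z / s\<close> in
  the remainders.\<close>

lemma htail_step:
  assumes l: "0 < \<delta>" "\<delta>\<^sup>2 \<le> s" and x: "0 \<le> x" and e: "\<bar>u\<bar> \<le> \<epsilon>" "x * \<epsilon> \<le> 1"
    and h: "0 < h" "x\<^sup>2 * h \<le> 2"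
  shows "\<bar>htail s (z - u) - htail (s + h) z - heat s z * u - heat1 s z * (u\<^sup>2 - h) / 2\<bar>
    \<le> 2 * exp (9 / 2) * (exp (x\<^sup>2 * s / 2 - x * z) / sqrt s)
        * ((x + 1 / \<delta>)\<^sup>2 * \<bar>u\<bar> ^ 3 + (x + 1 / \<delta>) ^ 3 * h\<^sup>2)"
proof -
  define \<kappa> where "\<kappa> = x + 1 / \<delta>"
  define E where "E = exp (x\<^sup>2 * s / 2 - x * z)"
  define K where "K = exp (9 / 2 :: real)"
  have s: "0 < s" using l zero_less_power[of \<delta> 2] by linarith
  have \<kappa>: "0 \<le> \<kappa>" unfolding \<kappa>_def using x l by simp
  have inv_le: "1 / t \<le> \<kappa>\<^sup>2" if "s \<le> t" for t
  proof -
    have "1 / t \<le> 1 / \<delta>\<^sup>2" using l s that by (intro divide_left_mono mult_pos_pos) auto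
    also have "\<dots> = (1 / \<delta>)\<^sup>2" by (simp add: power_divide)
    also have "\<dots> \<le> \<kappa>\<^sup>2" unfolding \<kappa>_def using x l by (intro power_mono) auto
    finally show ?thesis .
  qed
  have E: "0 \<le> E" "0 \<le> K" by (auto simp: E_def K_def)
  have space: "\<bar>htail s (z - u) - htail s z - heat s z * u - heat1 s z * u\<^sup>2 / 2\<bar> \<le> 2 * K * (E / sqrt s) * (\<kappa>\<^sup>2 * \<bar>u\<bar> ^ 3)"
  proof (cases "u = 0")
    case False
    define df where "df m y = (if m = 0 then htail s y else if m = 1 then - heat s y else
        if m = 2 then heat1 s y else (1 / s - (y / s)\<^sup>2) * heat s y)" for m :: nat and y
    have "\<forall>m t. m < 3 \<and> z - \<bar>u\<bar> \<le> t \<and> t \<le> z + \<bar>u\<bar> \<longrightarrow> ((df m) has_real_derivative df (Suc m) t) (at t)"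
    proof (intro allI impI)
      fix m :: nat and t assume "m < 3 \<and> z - \<bar>u\<bar> \<le> t \<and> t \<le> z + \<bar>u\<bar>"
      then consider "m = 0" | "m = 1" | "m = 2" by linarith
      then show "((df m) has_real_derivative df (Suc m) t) (at t)"
      proof cases
        case 1
        then show ?thesis using htail_deriv_z[OF s] by (simp add: df_def[abs_def])
      next
        case 2
        then show ?thesis using DERIV_minus[OF heat_deriv_z[OF s, of t]]
          by (simp add: df_def[abs_def] heat1_def)
      next
        case 3
        then show ?thesis using heat1_deriv_z[OF s] by (simp add: df_def[abs_def])
      qed
    qed
    then have "\<exists>t. (if z - u < z then z - u < t \<and> t < z else z < t \<and> t < z - u) \<and>
      df 0 (z - u) = (\<Sum>m<3. df m z / fact m * (z - u - z) ^ m) + df 3 t / fact 3 * (z - u - z) ^ 3"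
      using False by (intro Taylor[of 3 df "df 0" "z - \<bar>u\<bar>" "z + \<bar>u\<bar>" z "z - u"]) auto
    then obtain t where t: "if z - u < z then z - u < t \<and> t < z else z < t \<and> t < z - u"
      "df 0 (z - u) = (\<Sum>m<3. df m z / fact m * (z - u - z) ^ m) + df 3 t / fact 3 * (z - u - z) ^ 3"
      by blast
    have eq: "htail s (z - u) - htail s z - heat s z * u - heat1 s z * u\<^sup>2 / 2 = - df 3 t / 6 * u ^ 3"
      using t(2) by (simp add: df_def eval_nat_numeral algebra_simps)
    \<comment> \<open>The intermediate point is within \<open>\<epsilon>\<close> of
      \<open>z\<close>, and \<open>x * \<epsilon> \<le> 1\<close>, so the exponential weight there
      is at most \<open>exp 1\<close>, hence at most 3, times the weight at \<open>z\<close>. The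
      bound on \<open>h\<close> plays the same role in the time expansion.\<close>
    have tz: "\<bar>t - z\<bar> \<le> \<epsilon>" using t(1) e(1) by (auto split: if_splits)
    have "- x * (t - z) \<le> x * \<bar>t - z\<bar>" using x by (simp add: mult_left_mono flip: mult_minus_right)
    also have "\<dots> \<le> 1" using tz x e(2) mult_left_mono[of "\<bar>t - z\<bar>" \<epsilon> x] by linarith
    finally have "x\<^sup>2 * s / 2 - x * t \<le> 1 + (x\<^sup>2 * s / 2 - x * z)" by (simp add: algebra_simps)
    then have "exp (x\<^sup>2 * s / 2 - x * t) \<le> exp 1 * E" unfolding E_def exp_add[symmetric] by simp
    also have "\<dots> \<le> 3 * E" using exp_le E by (intro mult_right_mono) auto
    finally have Et: "exp (x\<^sup>2 * s / 2 - x * t) \<le> 3 * E" .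
    have w: "\<bar>t / s\<bar> ^ i * heat s t \<le> K * \<kappa> ^ i * (3 * E) / sqrt s" if "i \<le> 3" for i
    proof -
      have "\<bar>t / s\<bar> ^ i * heat s t \<le> K * \<kappa> ^ i * exp (x\<^sup>2 * s / 2 - x * t) / sqrt s"
        unfolding K_def \<kappa>_def by (rule heat_weight[OF l x that])
      also have "\<dots> \<le> K * \<kappa> ^ i * (3 * E) / sqrt s"
        using Et E \<kappa> s by (intro divide_right_mono mult_left_mono) auto
      finally show ?thesis .
    qed
    have "\<bar>df 3 t\<bar> \<le> (1 / s + \<bar>t / s\<bar> ^ 2) * heat s t"
      unfolding power2_abs
      using s heat_nonneg[OF s, of t] abs_triangle_ineq4[of "1 / s" "(t / s)\<^sup>2"]
      by (auto simp: df_def abs_mult intro!: mult_right_mono)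
    also have "\<dots> = 1 / s * (\<bar>t / s\<bar> ^ 0 * heat s t) + \<bar>t / s\<bar> ^ 2 * heat s t" by (simp add: algebra_simps)
    also have "\<dots> \<le> \<kappa>\<^sup>2 * (K * \<kappa> ^ 0 * (3 * E) / sqrt s) + K * \<kappa> ^ 2 * (3 * E) / sqrt s"
      using inv_le[of s] w[of 0] w[of 2] heat_nonneg[OF s, of t] \<kappa> s
      by (intro add_mono mult_mono) auto
    also have "\<dots> = 6 * (K * (E / sqrt s) * \<kappa>\<^sup>2)" by simp
    finally have "\<bar>df 3 t\<bar> / 6 \<le> 6 * (K * (E / sqrt s) * \<kappa>\<^sup>2) / 6"
      by (intro divide_right_mono) auto
    then have "\<bar>df 3 t\<bar> / 6 * \<bar>u\<bar> ^ 3 \<le> 6 * (K * (E / sqrt s) * \<kappa>\<^sup>2) / 6 * \<bar>u\<bar> ^ 3"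
      by (intro mult_right_mono) auto
    also have "\<dots> = K * (E / sqrt s) * \<kappa>\<^sup>2 * \<bar>u\<bar> ^ 3" by simp
    also have "\<dots> \<le> 2 * (K * (E / sqrt s) * \<kappa>\<^sup>2 * \<bar>u\<bar> ^ 3)"
    proof -
      have "0 \<le> K * (E / sqrt s) * \<kappa>\<^sup>2 * \<bar>u\<bar> ^ 3"
        using E s by (intro mult_nonneg_nonneg divide_nonneg_nonneg) auto
      from mult_right_mono[OF _ this, of 1 2] show ?thesis by simp
    qed
    also have "\<dots> = 2 * K * (E / sqrt s) * (\<kappa>\<^sup>2 * \<bar>u\<bar> ^ 3)" by simp
    finally show ?thesis unfolding eq by (simp add: abs_mult power_abs)
  qed (use E in simp)
  have time: "\<bar>htail (s + h) z - htail s z - heat1 s z * h / 2\<bar> \<le> 2 * K * (E / sqrt s) * (\<kappa> ^ 3 * h\<^sup>2)"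
  proof -
    define df where "df m t = (if m = 0 then htail t z else if m = 1 then heat1 t z / 2 else
        ((z / t) ^ 3 / 2 - 3 / 2 * (z / t) * (1 / t)) * heat t z / 2)" for m :: nat and t
    have "\<forall>m t. m < 2 \<and> s \<le> t \<and> t \<le> s + h \<longrightarrow> ((df m) has_real_derivative df (Suc m) t) (at t)"
    proof (intro allI impI)
      fix m :: nat and t assume a: "m < 2 \<and> s \<le> t \<and> t \<le> s + h"
      then have t: "0 < t" using s by linarith
      from a consider "m = 0" | "m = 1" by linarith
      then show "((df m) has_real_derivative df (Suc m) t) (at t)"
      proof cases
        case 1
        then show ?thesis using htail_deriv_s[OF t] by (simp add: df_def[abs_def] heat1_def)
      next
        case 2
        then show ?thesis using DERIV_cdivide[OF heat1_deriv_s[OF t, of z], of 2]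
          by (simp add: df_def[abs_def])
      qed
    qed
    then have "\<exists>t. (if s + h < s then s + h < t \<and> t < s else s < t \<and> t < s + h) \<and>
      df 0 (s + h) = (\<Sum>m<2. df m s / fact m * (s + h - s) ^ m) + df 2 t / fact 2 * (s + h - s) ^ 2"
      using h(1) by (intro Taylor[of 2 df "df 0" s "s + h" s "s + h"]) auto
    then obtain t where t: "s < t" "t < s + h"
      "df 0 (s + h) = (\<Sum>m<2. df m s / fact m * (s + h - s) ^ m) + df 2 t / fact 2 * (s + h - s) ^ 2"
      using h(1) by auto
    have eq: "htail (s + h) z - htail s z - heat1 s z * h / 2 = df 2 t / 2 * h\<^sup>2"
      using t(3) by (simp add: df_def eval_nat_numeral algebra_simps)
    have tpos: "0 < t" "\<delta>\<^sup>2 \<le> t" using t s l by auto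
    have "x\<^sup>2 * (t - s) / 2 \<le> 1"
      using mult_left_mono[of "t - s" h "x\<^sup>2"] t h by simp
    then have "x\<^sup>2 * t / 2 - x * z \<le> 1 + (x\<^sup>2 * s / 2 - x * z)" by (simp add: algebra_simps)
    then have "exp (x\<^sup>2 * t / 2 - x * z) \<le> exp 1 * E" unfolding E_def exp_add[symmetric] by simp
    also have "\<dots> \<le> 3 * E" using exp_le E by (intro mult_right_mono) auto
    finally have Et: "exp (x\<^sup>2 * t / 2 - x * z) \<le> 3 * E" .
    have w: "\<bar>z / t\<bar> ^ i * heat t z \<le> K * \<kappa> ^ i * (3 * E) / sqrt s" if "i \<le> 3" for i
    proof -
      have "\<bar>z / t\<bar> ^ i * heat t z \<le> K * \<kappa> ^ i * exp (x\<^sup>2 * t / 2 - x * z) / sqrt t"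
        unfolding K_def \<kappa>_def by (rule heat_weight[OF l(1) tpos(2) x that])
      also have "\<dots> \<le> K * \<kappa> ^ i * (3 * E) / sqrt s"
        using Et E \<kappa> s t by (intro frac_le mult_left_mono) auto
      finally show ?thesis .
    qed
    have "\<bar>(z / t) ^ 3 / 2 - 3 / 2 * (z / t) * (1 / t)\<bar> \<le> \<bar>z / t\<bar> ^ 3 / 2 + 3 / 2 * (1 / t) * \<bar>z / t\<bar> ^ 1"
      using abs_triangle_ineq4[of "(z / t) ^ 3 / 2" "3 / 2 * (z / t) * (1 / t)"] tpos
      by (simp add: abs_mult power_abs)
    then have "\<bar>df 2 t\<bar> \<le> (\<bar>z / t\<bar> ^ 3 / 2 + 3 / 2 * (1 / t) * \<bar>z / t\<bar> ^ 1) * heat t z / 2"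
      using heat_nonneg[OF tpos(1), of z]
      by (simp only: df_def) (simp add: abs_mult mult_right_mono)
    also have "\<dots> = (\<bar>z / t\<bar> ^ 3 * heat t z) / 4 + 3 / 4 * ((1 / t) * (\<bar>z / t\<bar> ^ 1 * heat t z))"
      by (simp add: algebra_simps)
    also have "\<dots> \<le> (K * \<kappa> ^ 3 * (3 * E) / sqrt s) / 4 + 3 / 4 * (\<kappa>\<^sup>2 * (K * \<kappa> ^ 1 * (3 * E) / sqrt s))"
      using inv_le[of t] t w[of 3] w[of 1] heat_nonneg[OF tpos(1), of z] \<kappa> s
      by (intro add_mono mult_left_mono mult_mono divide_right_mono) auto
    also have "\<dots> = 3 * (K * (E / sqrt s) * \<kappa> ^ 3)" by (simp add: power2_eq_square power3_eq_cube)
    finally have "\<bar>df 2 t\<bar> / 2 * h\<^sup>2 \<le> 3 * (K * (E / sqrt s) * \<kappa> ^ 3) / 2 * h\<^sup>2"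
      by (intro mult_right_mono divide_right_mono) auto
    also have "\<dots> \<le> 2 * K * (E / sqrt s) * (\<kappa> ^ 3 * h\<^sup>2)"
      using E s \<kappa> by (simp add: divide_simps)
    finally show ?thesis unfolding eq by (simp add: abs_mult)
  qed
  have "htail s (z - u) - htail (s + h) z - heat s z * u - heat1 s z * (u\<^sup>2 - h) / 2
      = (htail s (z - u) - htail s z - heat s z * u - heat1 s z * u\<^sup>2 / 2)
        - (htail (s + h) z - htail s z - heat1 s z * h / 2)"
    by (simp add: algebra_simps diff_divide_distrib)
  then have "\<bar>htail s (z - u) - htail (s + h) z - heat s z * u - heat1 s z * (u\<^sup>2 - h) / 2\<bar>
      \<le> 2 * K * (E / sqrt s) * (\<kappa>\<^sup>2 * \<bar>u\<bar> ^ 3) + 2 * K * (E / sqrt s) * (\<kappa> ^ 3 * h\<^sup>2)"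
    using space time by linarith
  also have "\<dots> = 2 * K * (E / sqrt s) * (\<kappa>\<^sup>2 * \<bar>u\<bar> ^ 3 + \<kappa> ^ 3 * h\<^sup>2)" by (simp add: distrib_left)
  finally show ?thesis unfolding K_def E_def \<kappa>_def .
qed

lemma heat1_weight:
  assumes l: "0 < \<delta>" "\<delta>\<^sup>2 \<le> s" and x: "0 \<le> x"
  shows "\<bar>heat1 s z\<bar> \<le> exp (9 / 2) * (x + 1 / \<delta>) * exp (x\<^sup>2 * s / 2 - x * z) / sqrt s"
proof -
  have s: "0 < s" using l zero_less_power[of \<delta> 2] by linarith
  show ?thesis
    using heat_weight[OF l x, of 1 z] heat_nonneg[OF s, of z] by (simp add: heat1_def abs_mult)
qed

text \<open>Each term is at most twice an increment of the square root, and these telescope. Thus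
  the replacement errors, singular like the inverse root of the remaining variance, add up to a
  constant.\<close>

lemma sum_inverse_sqrt_le: "(\<Sum>i<k. 1 / sqrt (real (Suc i))) \<le> 2 * sqrt (real k)"
proof (induction k)
  case (Suc k)
  have "1 / sqrt (real (Suc k)) \<le> 2 * (sqrt (real (Suc k)) - sqrt (real k))"
  proof -
    have "(sqrt (real (Suc k)) - sqrt (real k)) * (sqrt (real (Suc k)) + sqrt (real k)) = 1"
      by (simp add: algebra_simps)
    then have "1 \<le> (sqrt (real (Suc k)) - sqrt (real k)) * (2 * sqrt (real (Suc k)))"
      using mult_left_mono[of "sqrt (real (Suc k)) + sqrt (real k)" "2 * sqrt (real (Suc k))"
          "sqrt (real (Suc k)) - sqrt (real k)"] by simp
    then have "1 \<le> 2 * (sqrt (real (Suc k)) - sqrt (real k)) * sqrt (real (Suc k))" by (simp only: mult_ac)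
    then show ?thesis by (subst pos_divide_le_eq) (simp, assumption)
  qed
  then show ?case using Suc by simp
qed simp

context preserving
begin

lemma bmeas_htail: "0 < s \<Longrightarrow> bmeas M Z \<Longrightarrow> bmeas M (\<lambda>\<omega>. htail s (Z \<omega>))"
  by (rule bmeas_compose[where F = "htail s"])
    (auto intro!: DERIV_isCont htail_deriv_z continuous_at_imp_continuous_on)

lemma bmeas_heat: "0 < s \<Longrightarrow> bmeas M Z \<Longrightarrow> bmeas M (\<lambda>\<omega>. heat s (Z \<omega>))"
  by (rule bmeas_compose[where F = "heat s"])
    (auto intro!: DERIV_isCont heat_deriv_z continuous_at_imp_continuous_on)

lemma bmeas_heat1: "0 < s \<Longrightarrow> bmeas M Z \<Longrightarrow> bmeas M (\<lambda>\<omega>. heat1 s (Z \<omega>))"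
  by (rule bmeas_compose[where F = "heat1 s"])
    (auto intro!: DERIV_isCont heat1_deriv_z continuous_at_imp_continuous_on)

text \<open>One summand \<open>\<eta>\<close> is exchanged for a Gaussian of variance
  \<open>h\<close>, so the smoothing variance grows from \<open>s\<close> to \<open>s + h\<close>.
  The rest of the sum enters as a function of \<open>T\<close>, which permits conditioning. The four
  error terms come from the conditional mean, the conditional variance, the cubic remainder and the
  time remainder.\<close>

lemma lindeberg_step:
  assumes mean: "cond_in M T (- \<alpha> * h) (\<alpha> * h) \<eta>"
    and var: "cond_in M T ((1 - \<beta>) * h) ((1 + \<beta>) * h) (\<lambda>\<omega>. (\<eta> \<omega>)\<^sup>2)"
    and bd: "\<And>\<omega>. \<omega> \<in> space M \<Longrightarrow> \<bar>\<eta> \<omega>\<bar> \<le> \<epsilon>"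
    and l: "0 < \<delta>" "\<delta>\<^sup>2 \<le> s" and x: "0 \<le> x" "x * \<epsilon> \<le> 1" and h: "0 < h" "x\<^sup>2 * h \<le> 2"
    and nn: "0 \<le> \<alpha>" "0 \<le> \<beta>" "\<beta> \<le> 1" "0 \<le> \<epsilon>" and Z: "bmeas M Z"
  shows "\<bar>(\<integral>\<omega>. htail s (Z (T \<omega>) - \<eta> \<omega>) \<partial>M) - (\<integral>\<omega>. htail (s + h) (Z \<omega>) \<partial>M)\<bar>
    \<le> exp (9 / 2) * (\<alpha> + (x + 1 / \<delta>) * \<beta> + 4 * (x + 1 / \<delta>)\<^sup>2 * \<epsilon> + 2 * (x + 1 / \<delta>) ^ 3 * h)
        * h / sqrt s * (\<integral>\<omega>. exp (x\<^sup>2 * s / 2 - x * Z \<omega>) \<partial>M)"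
proof -
  define \<kappa> where "\<kappa> = x + 1 / \<delta>"
  define K where "K = exp (9 / 2 :: real)"
  define E where "E \<omega> = exp (x\<^sup>2 * s / 2 - x * Z \<omega>)" for \<omega>
  have s: "0 < s" using l zero_less_power[of \<delta> 2] by linarith
  have sh: "0 < s + h" using s h by linarith
  have \<kappa>: "0 \<le> \<kappa>" unfolding \<kappa>_def using x l by simp
  have K: "0 \<le> K" by (simp add: K_def)
  have bE: "bmeas M E" unfolding E_def using Z by auto
  have b\<eta>: "bmeas M \<eta>" by (rule cond_in_bmeas[OF mean])
  note bT = bmeas_T[OF Z]
  let ?I = "\<integral>\<omega>. E \<omega> \<partial>M"
  have mean_term: "\<bar>\<integral>\<omega>. \<eta> \<omega> * heat s (Z (T \<omega>)) \<partial>M\<bar> \<le> \<alpha> * h * (K / sqrt s * ?I)"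
  proof -
    have "\<bar>\<integral>\<omega>. \<eta> \<omega> * heat s (Z (T \<omega>)) \<partial>M\<bar> \<le> \<alpha> * h * (\<integral>\<omega>. \<bar>heat s (Z \<omega>)\<bar> \<partial>M)"
      using mean by (intro cond_in_signed bmeas_heat[OF s Z]) simp
    also have "(\<integral>\<omega>. \<bar>heat s (Z \<omega>)\<bar> \<partial>M) \<le> (\<integral>\<omega>. K / sqrt s * E \<omega> \<partial>M)"
    proof (intro integral_mono_bmeas bmeas_abs bmeas_heat[OF s Z] bmeas_mult bmeas_const bE)
      show "\<bar>heat s (Z \<omega>)\<bar> \<le> K / sqrt s * E \<omega>" for \<omega>
        using heat_weight[OF l x(1), of 0 "Z \<omega>"] heat_nonneg[OF s, of "Z \<omega>"]
        by (simp add: K_def E_def)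
    qed
    finally show ?thesis using nn h by (simp add: mult_left_mono)
  qed
  have "cond_in M T ((1 - \<beta>) * h + - h) ((1 + \<beta>) * h + - h) (\<lambda>\<omega>. (\<eta> \<omega>)\<^sup>2 + - h)"
    by (intro cond_in_add var cond_in_const)
  then have var': "cond_in M T (- (\<beta> * h)) (\<beta> * h) (\<lambda>\<omega>. (\<eta> \<omega>)\<^sup>2 - h)"
    by (simp add: algebra_simps)
  have var_term: "\<bar>\<integral>\<omega>. ((\<eta> \<omega>)\<^sup>2 - h) * heat1 s (Z (T \<omega>)) \<partial>M\<bar> \<le> \<beta> * h * (K * \<kappa> / sqrt s * ?I)"
  proof -
    have "\<bar>\<integral>\<omega>. ((\<eta> \<omega>)\<^sup>2 - h) * heat1 s (Z (T \<omega>)) \<partial>M\<bar> \<le> \<beta> * h * (\<integral>\<omega>. \<bar>heat1 s (Z \<omega>)\<bar> \<partial>M)"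
      using var' by (intro cond_in_signed bmeas_heat1[OF s Z])
    also have "(\<integral>\<omega>. \<bar>heat1 s (Z \<omega>)\<bar> \<partial>M) \<le> (\<integral>\<omega>. K * \<kappa> / sqrt s * E \<omega> \<partial>M)"
    proof (intro integral_mono_bmeas bmeas_abs bmeas_heat1[OF s Z] bmeas_mult bmeas_const bE)
      show "\<bar>heat1 s (Z \<omega>)\<bar> \<le> K * \<kappa> / sqrt s * E \<omega>" for \<omega>
        using heat1_weight[OF l x(1), of "Z \<omega>"] by (simp add: K_def E_def \<kappa>_def)
    qed
    finally show ?thesis using nn h by (simp add: mult_left_mono)
  qed
  \<comment> \<open>One factor of \<open>\<eta>\<close> is bounded by \<open>\<epsilon>\<close>; the
    conditional variance of the other two is at most \<open>2 * h\<close> because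
    \<open>\<beta> \<le> 1\<close>.\<close>
  have cubic: "(\<integral>\<omega>. E (T \<omega>) * \<bar>\<eta> \<omega>\<bar> ^ 3 \<partial>M) \<le> 2 * \<epsilon> * h * ?I"
  proof -
    have "(\<integral>\<omega>. E (T \<omega>) * \<bar>\<eta> \<omega>\<bar> ^ 3 \<partial>M) \<le> (\<integral>\<omega>. \<epsilon> * ((\<eta> \<omega>)\<^sup>2 * E (T \<omega>)) \<partial>M)"
    proof (intro integral_mono_bmeas bmeas_mult bmeas_power bmeas_abs bmeas_const b\<eta> bmeas_T[OF bE])
      fix \<omega> assume \<omega>: "\<omega> \<in> space M"
      have "\<bar>\<eta> \<omega>\<bar> ^ 3 = \<bar>\<eta> \<omega>\<bar> * (\<eta> \<omega>)\<^sup>2" by (simp add: power3_eq_cube power2_eq_square abs_mult[symmetric])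
      also have "\<dots> \<le> \<epsilon> * (\<eta> \<omega>)\<^sup>2" using bd[OF \<omega>] by (intro mult_right_mono) auto
      finally have "E (T \<omega>) * \<bar>\<eta> \<omega>\<bar> ^ 3 \<le> E (T \<omega>) * (\<epsilon> * (\<eta> \<omega>)\<^sup>2)"
        by (intro mult_left_mono) (auto simp: E_def)
      then show "E (T \<omega>) * \<bar>\<eta> \<omega>\<bar> ^ 3 \<le> \<epsilon> * ((\<eta> \<omega>)\<^sup>2 * E (T \<omega>))" by (simp add: mult_ac)
    qed
    also have "\<dots> = \<epsilon> * (\<integral>\<omega>. (\<eta> \<omega>)\<^sup>2 * E (T \<omega>) \<partial>M)" by simp
    also have "\<dots> \<le> \<epsilon> * ((1 + \<beta>) * h * ?I)"
      using nn by (intro mult_left_mono cond_inD(2)[OF var bE]) (auto simp: E_def)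
    also have "\<dots> \<le> \<epsilon> * (2 * h * ?I)"
      using nn h by (intro mult_left_mono mult_right_mono integral_nonneg_AE AE_I2) (auto simp: E_def)
    finally show ?thesis by (simp add: mult_ac)
  qed
  define R where "R \<omega> = htail s (Z (T \<omega>) - \<eta> \<omega>) - htail (s + h) (Z (T \<omega>))
      - \<eta> \<omega> * heat s (Z (T \<omega>)) - ((\<eta> \<omega>)\<^sup>2 - h) * heat1 s (Z (T \<omega>)) / 2" for \<omega>
  have i1: "bmeas M (\<lambda>\<omega>. htail s (Z (T \<omega>) - \<eta> \<omega>))" by (intro bmeas_htail[OF s] bmeas_diff bT b\<eta>)
  have i2: "bmeas M (\<lambda>\<omega>. htail (s + h) (Z (T \<omega>)))" by (intro bmeas_htail[OF sh] bT)
  have i3: "bmeas M (\<lambda>\<omega>. \<eta> \<omega> * heat s (Z (T \<omega>)))" by (intro bmeas_mult bmeas_heat[OF s] bT b\<eta>)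
  have i4: "bmeas M (\<lambda>\<omega>. ((\<eta> \<omega>)\<^sup>2 - h) * heat1 s (Z (T \<omega>)) / 2)"
    by (intro bmeas_divide_const bmeas_mult bmeas_heat1[OF s] bmeas_diff bmeas_power bmeas_const bT b\<eta>)
  have bR: "bmeas M R" unfolding R_def by (intro bmeas_diff i1 i2 i3 i4)
  have bmaj: "bmeas M (\<lambda>\<omega>. 2 * K / sqrt s * (\<kappa>\<^sup>2 * (E (T \<omega>) * \<bar>\<eta> \<omega>\<bar> ^ 3) + \<kappa> ^ 3 * h\<^sup>2 * E (T \<omega>)))"
    by (intro bmeas_mult bmeas_const bmeas_add bmeas_power bmeas_abs b\<eta> bmeas_T[OF bE])
  have "\<bar>\<integral>\<omega>. R \<omega> \<partial>M\<bar> \<le> (\<integral>\<omega>. \<bar>R \<omega>\<bar> \<partial>M)" by (rule integral_abs_bound)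
  also have "\<dots> \<le> (\<integral>\<omega>. 2 * K / sqrt s * (\<kappa>\<^sup>2 * (E (T \<omega>) * \<bar>\<eta> \<omega>\<bar> ^ 3) + \<kappa> ^ 3 * h\<^sup>2 * E (T \<omega>)) \<partial>M)"
  proof (intro integral_mono_bmeas bmeas_abs bR bmaj)
    fix \<omega> assume \<omega>: "\<omega> \<in> space M"
    have "\<bar>R \<omega>\<bar> \<le> 2 * K * (E (T \<omega>) / sqrt s) * (\<kappa>\<^sup>2 * \<bar>\<eta> \<omega>\<bar> ^ 3 + \<kappa> ^ 3 * h\<^sup>2)"
      using htail_step[OF l x(1) bd[OF \<omega>] x(2) h, of "Z (T \<omega>)"]
      by (simp add: R_def K_def E_def \<kappa>_def mult.commute)
    also have "\<dots> = 2 * K / sqrt s * (\<kappa>\<^sup>2 * (E (T \<omega>) * \<bar>\<eta> \<omega>\<bar> ^ 3) + \<kappa> ^ 3 * h\<^sup>2 * E (T \<omega>))"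
      by (simp add: algebra_simps add_divide_distrib)
    finally show "\<bar>R \<omega>\<bar> \<le> 2 * K / sqrt s * (\<kappa>\<^sup>2 * (E (T \<omega>) * \<bar>\<eta> \<omega>\<bar> ^ 3) + \<kappa> ^ 3 * h\<^sup>2 * E (T \<omega>))" .
  qed
  also have "\<dots> = 2 * K / sqrt s * (\<kappa>\<^sup>2 * (\<integral>\<omega>. E (T \<omega>) * \<bar>\<eta> \<omega>\<bar> ^ 3 \<partial>M) + \<kappa> ^ 3 * h\<^sup>2 * ?I)"
  proof -
    have "integrable M (\<lambda>\<omega>. \<kappa>\<^sup>2 * (E (T \<omega>) * \<bar>\<eta> \<omega>\<bar> ^ 3))" "integrable M (\<lambda>\<omega>. \<kappa> ^ 3 * h\<^sup>2 * E (T \<omega>))"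
      by (intro bmeas_integrable bmeas_mult bmeas_const bmeas_power bmeas_abs b\<eta> bmeas_T[OF bE])+
    from Bochner_Integration.integral_add[OF this] show ?thesis
      by (simp add: integral_T[OF bE])
  qed
  also have "\<dots> \<le> 2 * K / sqrt s * (\<kappa>\<^sup>2 * (2 * \<epsilon> * h * ?I) + \<kappa> ^ 3 * h\<^sup>2 * ?I)"
    using cubic K s by (intro mult_left_mono add_right_mono) auto
  finally have R_bound: "\<bar>\<integral>\<omega>. R \<omega> \<partial>M\<bar> \<le> 2 * K / sqrt s * (\<kappa>\<^sup>2 * (2 * \<epsilon> * h * ?I) + \<kappa> ^ 3 * h\<^sup>2 * ?I)" .
  have R_split: "(\<integral>\<omega>. R \<omega> \<partial>M) = (\<integral>\<omega>. htail s (Z (T \<omega>) - \<eta> \<omega>) \<partial>M) - (\<integral>\<omega>. htail (s + h) (Z (T \<omega>)) \<partial>M)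
      - (\<integral>\<omega>. \<eta> \<omega> * heat s (Z (T \<omega>)) \<partial>M) - (\<integral>\<omega>. ((\<eta> \<omega>)\<^sup>2 - h) * heat1 s (Z (T \<omega>)) \<partial>M) / 2"
  proof -
    have "(\<integral>\<omega>. R \<omega> \<partial>M) = (\<integral>\<omega>. htail s (Z (T \<omega>) - \<eta> \<omega>) - htail (s + h) (Z (T \<omega>))
        - \<eta> \<omega> * heat s (Z (T \<omega>)) \<partial>M) - (\<integral>\<omega>. ((\<eta> \<omega>)\<^sup>2 - h) * heat1 s (Z (T \<omega>)) / 2 \<partial>M)"
      unfolding R_def by (intro Bochner_Integration.integral_diff bmeas_integrable bmeas_diff i1 i2 i3 i4)
    also have "(\<integral>\<omega>. htail s (Z (T \<omega>) - \<eta> \<omega>) - htail (s + h) (Z (T \<omega>)) - \<eta> \<omega> * heat s (Z (T \<omega>)) \<partial>M)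
        = (\<integral>\<omega>. htail s (Z (T \<omega>) - \<eta> \<omega>) - htail (s + h) (Z (T \<omega>)) \<partial>M) - (\<integral>\<omega>. \<eta> \<omega> * heat s (Z (T \<omega>)) \<partial>M)"
      by (intro Bochner_Integration.integral_diff bmeas_integrable bmeas_diff i1 i2 i3)
    also have "(\<integral>\<omega>. htail s (Z (T \<omega>) - \<eta> \<omega>) - htail (s + h) (Z (T \<omega>)) \<partial>M)
        = (\<integral>\<omega>. htail s (Z (T \<omega>) - \<eta> \<omega>) \<partial>M) - (\<integral>\<omega>. htail (s + h) (Z (T \<omega>)) \<partial>M)"
      by (intro Bochner_Integration.integral_diff bmeas_integrable i1 i2)
    finally show ?thesis by simp
  qed
  have T_split: "(\<integral>\<omega>. htail (s + h) (Z (T \<omega>)) \<partial>M) = (\<integral>\<omega>. htail (s + h) (Z \<omega>) \<partial>M)"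
    by (rule integral_T[OF bmeas_htail[OF sh Z]])
  have "\<bar>(\<integral>\<omega>. htail s (Z (T \<omega>) - \<eta> \<omega>) \<partial>M) - (\<integral>\<omega>. htail (s + h) (Z \<omega>) \<partial>M)\<bar>
    \<le> \<alpha> * h * (K / sqrt s * ?I) + \<beta> * h * (K * \<kappa> / sqrt s * ?I) / 2
      + 2 * K / sqrt s * (\<kappa>\<^sup>2 * (2 * \<epsilon> * h * ?I) + \<kappa> ^ 3 * h\<^sup>2 * ?I)"
  proof -
    define a r m v where "a = (\<integral>\<omega>. htail s (Z (T \<omega>) - \<eta> \<omega>) \<partial>M) - (\<integral>\<omega>. htail (s + h) (Z \<omega>) \<partial>M)"
      and "r = (\<integral>\<omega>. R \<omega> \<partial>M)" and "m = (\<integral>\<omega>. \<eta> \<omega> * heat s (Z (T \<omega>)) \<partial>M)"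
      and "v = (\<integral>\<omega>. ((\<eta> \<omega>)\<^sup>2 - h) * heat1 s (Z (T \<omega>)) \<partial>M)"
    have "r = (\<integral>\<omega>. htail s (Z (T \<omega>) - \<eta> \<omega>) \<partial>M) - (\<integral>\<omega>. htail (s + h) (Z (T \<omega>)) \<partial>M) - m - v / 2"
      "(\<integral>\<omega>. htail (s + h) (Z (T \<omega>)) \<partial>M) = (\<integral>\<omega>. htail (s + h) (Z \<omega>) \<partial>M)"
      unfolding r_def m_def v_def by (fact R_split, fact T_split)
    then have "a = m + v / 2 + r" unfolding a_def by linarith
    then have "\<bar>a\<bar> \<le> \<bar>m\<bar> + \<bar>v\<bar> / 2 + \<bar>r\<bar>" by linarith
    also have "\<dots> \<le> \<alpha> * h * (K / sqrt s * ?I) + \<beta> * h * (K * \<kappa> / sqrt s * ?I) / 2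
      + 2 * K / sqrt s * (\<kappa>\<^sup>2 * (2 * \<epsilon> * h * ?I) + \<kappa> ^ 3 * h\<^sup>2 * ?I)"
      using R_bound mean_term var_term unfolding r_def m_def v_def
      by (intro add_mono divide_right_mono) auto
    finally show ?thesis unfolding a_def .
  qed
  also have "\<dots> \<le> \<alpha> * h * (K / sqrt s * ?I) + \<beta> * h * (K * \<kappa> / sqrt s * ?I)
      + 2 * K / sqrt s * (\<kappa>\<^sup>2 * (2 * \<epsilon> * h * ?I) + \<kappa> ^ 3 * h\<^sup>2 * ?I)"
  proof -
    have "0 \<le> \<beta> * h * (K * \<kappa> / sqrt s * ?I)"
      using nn h K \<kappa> s by (intro mult_nonneg_nonneg divide_nonneg_nonneg integral_nonneg_AE AE_I2) (auto simp: E_def)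
    moreover have "y / 2 \<le> y" if "0 \<le> y" for y :: real using that by simp
    ultimately show ?thesis by (intro add_mono order_refl)
  qed
  also have "\<dots> = K * (\<alpha> + \<kappa> * \<beta> + 4 * \<kappa>\<^sup>2 * \<epsilon> + 2 * \<kappa> ^ 3 * h) * h / sqrt s * ?I"
    by (simp add: add_divide_distrib distrib_left distrib_right power2_eq_square mult_ac)
  finally show ?thesis unfolding K_def \<kappa>_def E_def .
qed

text \<open>Telescoping over \<open>A j\<close>, in which the first \<open>j\<close> summands are
  kept and the others are replaced by Gaussian variance: \<open>A 0\<close> is purely Gaussian, and
  \<open>A k\<close> retains only the smoothing of variance \<open>\<delta>^2\<close>.\<close>

lemma lindeberg:
  assumes mean: "cond_in M T (- \<alpha> / real k) (\<alpha> / real k) \<eta>"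
    and var: "cond_in M T ((1 - \<beta>) / real k) ((1 + \<beta>) / real k) (\<lambda>\<omega>. (\<eta> \<omega>)\<^sup>2)"
    and bd: "\<And>\<omega>. \<omega> \<in> space M \<Longrightarrow> \<bar>\<eta> \<omega>\<bar> \<le> \<epsilon>"
    and k: "k > 0" and l: "0 < \<delta>" "1 / real k \<le> \<delta>\<^sup>2"
    and x: "0 \<le> x" "x * \<epsilon> \<le> 1" "x\<^sup>2 \<le> 2 * real k"
    and nn: "0 \<le> \<alpha>" "0 \<le> \<beta>" "\<beta> \<le> 1" "0 \<le> \<epsilon>"
  shows "\<bar>(\<integral>\<omega>. htail (\<delta>\<^sup>2) (y - orbit_sum T \<eta> k \<omega>) \<partial>M) - htail (1 + \<delta>\<^sup>2) y\<bar>
    \<le> 2 * exp (9 / 2) * (\<alpha> + (x + 1 / \<delta>) * \<beta> + 4 * (x + 1 / \<delta>)\<^sup>2 * \<epsilon> + 2 * (x + 1 / \<delta>) ^ 3 / real k)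
        * exp (x\<^sup>2 / 2 - x * y + (x\<^sup>2 * \<delta>\<^sup>2 / 2 + x * \<alpha> + x\<^sup>2 * (\<beta> / 2 + x * \<epsilon>)))"
proof -
  define h where "h = 1 / real k"
  have h: "0 < h" "x\<^sup>2 * h \<le> 2" using k x(3) by (auto simp: h_def divide_le_eq)
  define S where "S j = \<delta>\<^sup>2 + real (k - j) * h" for j
  define Err where "Err = exp (9 / 2) * (\<alpha> + (x + 1 / \<delta>) * \<beta> + 4 * (x + 1 / \<delta>)\<^sup>2 * \<epsilon> + 2 * (x + 1 / \<delta>) ^ 3 * h)"
  define G where "G = exp (x\<^sup>2 / 2 - x * y + (x\<^sup>2 * \<delta>\<^sup>2 / 2 + x * \<alpha> + x\<^sup>2 * (\<beta> / 2 + x * \<epsilon>)))"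
  have Err: "0 \<le> Err" unfolding Err_def using nn x l h
    by (intro mult_nonneg_nonneg add_nonneg_nonneg) auto
  have b\<eta>: "bmeas M \<eta>" by (rule cond_in_bmeas[OF mean])
  define A where "A j = (\<integral>\<omega>. htail (S j) (y - orbit_sum T \<eta> j \<omega>) \<partial>M)" for j
  have step: "\<bar>A (Suc j) - A j\<bar> \<le> Err * G * h / sqrt (real (k - j) * h)" if j: "j < k" for j
  proof -
    have Sj: "S j = S (Suc j) + h" using j by (simp add: S_def Suc_diff_Suc[symmetric] algebra_simps)
    have lS: "\<delta>\<^sup>2 \<le> S (Suc j)" using h by (simp add: S_def)
    have "A (Suc j) = (\<integral>\<omega>. htail (S (Suc j)) ((y - orbit_sum T \<eta> j (T \<omega>)) - \<eta> \<omega>) \<partial>M)"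
      by (simp add: A_def orbit_sum_Suc algebra_simps)
    then have f1: "\<bar>A (Suc j) - A j\<bar> \<le> Err * h / sqrt (S (Suc j))
        * (\<integral>\<omega>. exp (x\<^sup>2 * S (Suc j) / 2 - x * (y - orbit_sum T \<eta> j \<omega>)) \<partial>M)"
      using lindeberg_step[OF _ _ bd l(1) lS x(1,2) h nn, where Z = "\<lambda>\<omega>. y - orbit_sum T \<eta> j \<omega>"] mean var b\<eta>
      by (simp add: A_def Sj Err_def h_def bmeas_orbit_sum bmeas_diff)
    have "(\<integral>\<omega>. exp (x\<^sup>2 * S (Suc j) / 2 - x * (y - orbit_sum T \<eta> j \<omega>)) \<partial>M)
        = exp (x\<^sup>2 * S (Suc j) / 2 - x * y) * (\<integral>\<omega>. exp (x * orbit_sum T \<eta> j \<omega>) \<partial>M)"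
      by (subst integral_mult_right_zero[symmetric]) (simp add: exp_add[symmetric] algebra_simps)
    also have "\<dots> \<le> exp (x\<^sup>2 * S (Suc j) / 2 - x * y)
        * exp (real j / real k * (x * \<alpha> + x\<^sup>2 / 2 * ((1 + x * \<epsilon>) * (1 + \<beta>))))"
      using laplace_upper_sum[OF mean var bd x(1,2) _ nn(1,2,4), of j] k by (intro mult_left_mono) auto
    \<comment> \<open>The weight contributes the variance still to be replaced and the Laplace
      transform the variance already summed. Their total is essentially 1, so the same bound
      \<open>G\<close> serves all \<open>j\<close>.\<close>
    also have "\<dots> \<le> G"
      unfolding G_def exp_add[symmetric] exp_le_cancel_iff
    proof -
      define t where "t = real j / real k"
      have t: "0 \<le> t" "t \<le> 1" using j by (auto simp: t_def)
      have "real (k - Suc j) * h = 1 - t - h"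
        using j k by (simp add: h_def t_def of_nat_diff field_simps)
      then have "S (Suc j) \<le> \<delta>\<^sup>2 + (1 - t)" using h by (simp add: S_def)
      then have "x\<^sup>2 * S (Suc j) \<le> x\<^sup>2 * (\<delta>\<^sup>2 + (1 - t))" by (intro mult_left_mono) auto
      moreover have "t * (x * \<alpha>) \<le> 1 * (x * \<alpha>)" using t x nn by (intro mult_right_mono) auto
      moreover have "(1 + x * \<epsilon>) * (1 + \<beta>) \<le> 1 + (\<beta> + 2 * (x * \<epsilon>))"
        using x nn mult_left_mono[of \<beta> 1 "x * \<epsilon>"] by (simp add: algebra_simps)
      then have "t * (x\<^sup>2 / 2 * ((1 + x * \<epsilon>) * (1 + \<beta>))) \<le> t * (x\<^sup>2 / 2 * (1 + (\<beta> + 2 * (x * \<epsilon>))))"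
        using t by (intro mult_left_mono) auto
      moreover have "t * (x\<^sup>2 / 2 * (\<beta> + 2 * (x * \<epsilon>))) \<le> 1 * (x\<^sup>2 / 2 * (\<beta> + 2 * (x * \<epsilon>)))"
        using t x nn by (intro mult_right_mono mult_nonneg_nonneg add_nonneg_nonneg) auto
      moreover have "x\<^sup>2 * (\<delta>\<^sup>2 + (1 - t)) / 2 + t * (x\<^sup>2 / 2 * (1 + (\<beta> + 2 * (x * \<epsilon>))))
          = x\<^sup>2 * \<delta>\<^sup>2 / 2 + x\<^sup>2 / 2 + t * (x\<^sup>2 / 2 * (\<beta> + 2 * (x * \<epsilon>)))"
        by (simp add: field_simps)
      moreover have "x\<^sup>2 / 2 * (\<beta> + 2 * (x * \<epsilon>)) = x\<^sup>2 * (\<beta> / 2 + x * \<epsilon>)" by (simp add: field_simps)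
      ultimately show "x\<^sup>2 * S (Suc j) / 2 - x * y + real j / real k * (x * \<alpha> + x\<^sup>2 / 2 * ((1 + x * \<epsilon>) * (1 + \<beta>)))
          \<le> x\<^sup>2 / 2 - x * y + (x\<^sup>2 * \<delta>\<^sup>2 / 2 + x * \<alpha> + x\<^sup>2 * (\<beta> / 2 + x * \<epsilon>))"
        unfolding t_def[symmetric] distrib_left[of t "x * \<alpha>"] by linarith
    qed
    finally have "(\<integral>\<omega>. exp (x\<^sup>2 * S (Suc j) / 2 - x * (y - orbit_sum T \<eta> j \<omega>)) \<partial>M) \<le> G" .
    moreover have "0 \<le> S (Suc j)" using lS zero_le_power2[of \<delta>] by linarith
    ultimately have "\<bar>A (Suc j) - A j\<bar> \<le> Err * h / sqrt (S (Suc j)) * G"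
      using Err h by (intro order_trans[OF f1] mult_left_mono) auto
    also have "\<dots> = Err * G * h / sqrt (S (Suc j))" by simp
    \<comment> \<open>The smoothing variance is at least \<open>1 / k\<close>, which compensates the
      index shift from \<open>k - Suc j\<close> to \<open>k - j\<close> and avoids a zero
      denominator at the last step.\<close>
    also have "\<dots> \<le> Err * G * h / sqrt (real (k - j) * h)"
    proof -
      have "real (k - j) * h \<le> S (Suc j)"
        using j l(2) by (simp add: S_def Suc_diff_Suc[symmetric] h_def algebra_simps add_divide_distrib)
      moreover have "0 < real (k - j) * h" using h j by simp
      ultimately show ?thesis
        using Err h by (intro divide_left_mono mult_nonneg_nonneg mult_pos_pos) (auto simp: G_def simp del: of_nat_diff)
    qed
    finally show ?thesis .
  qed
  have "A k - A 0 = (\<Sum>j<k. A (Suc j) - A j)" by (rule sum_lessThan_telescope[symmetric])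
  then have "\<bar>A k - A 0\<bar> \<le> (\<Sum>j<k. \<bar>A (Suc j) - A j\<bar>)" by simp
  also have "\<dots> \<le> (\<Sum>j<k. Err * G * h / sqrt (real (k - j) * h))" using step by (intro sum_mono) auto
  also have "\<dots> = (\<Sum>j<k. Err * G * h / sqrt (real (Suc j) * h))"
    by (subst sum.nat_diff_reindex[symmetric]) (auto intro!: sum.cong simp: Suc_diff_Suc)
  also have "\<dots> = Err * G * sqrt h * (\<Sum>j<k. 1 / sqrt (real (Suc j)))"
    unfolding sum_distrib_left
  proof (intro sum.cong refl)
    fix j
    have "Err * G * h / sqrt (real (Suc j) * h) = Err * G * (h / sqrt h) * (1 / sqrt (real (Suc j)))"
      by (simp add: real_sqrt_mult)
    also have "h / sqrt h = sqrt h" using h by (intro real_div_sqrt) simp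
    finally show "Err * G * h / sqrt (real (Suc j) * h) = Err * G * sqrt h * (1 / sqrt (real (Suc j)))" .
  qed
  also have "\<dots> \<le> Err * G * sqrt h * (2 * sqrt (real k))"
    using Err h by (intro mult_left_mono sum_inverse_sqrt_le) (auto simp: G_def)
  also have "\<dots> = 2 * Err * G"
    using k by (simp add: h_def real_sqrt_divide)
  finally have "\<bar>A k - A 0\<bar> \<le> 2 * Err * G" .
  moreover have "A 0 = htail (1 + \<delta>\<^sup>2) y" using k by (simp add: A_def S_def h_def prob_space add.commute)
  moreover have "A k = (\<integral>\<omega>. htail (\<delta>\<^sup>2) (y - orbit_sum T \<eta> k \<omega>) \<partial>M)" by (simp add: A_def S_def)
  ultimately show ?thesis by (simp add: Err_def G_def h_def)
qed

end

section \<open>Blocks\<close>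

context preserving
begin

lemma cond_in_zero_signed:
  assumes "cond_in M T 0 0 q" "bmeas M \<phi>"
  shows "(\<integral>\<omega>. q \<omega> * \<phi> (T \<omega>) \<partial>M) = 0"
  using cond_in_signed[of 0 q \<phi>] assms by simp

lemma block_mean:
  assumes q: "cond_in M T 0 0 q"
  shows "bmeas M \<phi> \<Longrightarrow> (\<integral>\<omega>. orbit_sum T q m \<omega> * \<phi> ((T ^^ m) \<omega>) \<partial>M) = 0"
proof (induction m arbitrary: \<phi>)
  case (Suc m)
  have bq: "bmeas M q" by (rule cond_in_bmeas[OF q])
  note b = bmeas_iter[OF Suc.prems, of m]
  have "(\<integral>\<omega>. orbit_sum T q (Suc m) \<omega> * \<phi> ((T ^^ Suc m) \<omega>) \<partial>M)
      = (\<integral>\<omega>. q \<omega> * \<phi> ((T ^^ m) (T \<omega>)) + orbit_sum T q m (T \<omega>) * \<phi> ((T ^^ m) (T \<omega>)) \<partial>M)"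
    by (simp add: orbit_sum_Suc distrib_right funpow_swap1)
  also have "\<dots> = (\<integral>\<omega>. q \<omega> * \<phi> ((T ^^ m) (T \<omega>)) \<partial>M) + (\<integral>\<omega>. orbit_sum T q m (T \<omega>) * \<phi> ((T ^^ m) (T \<omega>)) \<partial>M)"
    by (intro Bochner_Integration.integral_add bmeas_integrable bmeas_mult bq
        bmeas_T[OF b] bmeas_T[OF bmeas_orbit_sum[OF bq]])
  also have "(\<integral>\<omega>. q \<omega> * \<phi> ((T ^^ m) (T \<omega>)) \<partial>M) = 0" by (rule cond_in_zero_signed[OF q b])
  also have "(\<integral>\<omega>. orbit_sum T q m (T \<omega>) * \<phi> ((T ^^ m) (T \<omega>)) \<partial>M) = (\<integral>\<omega>. orbit_sum T q m \<omega> * \<phi> ((T ^^ m) \<omega>) \<partial>M)"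
    by (rule integral_T[OF bmeas_mult[OF bmeas_orbit_sum[OF bq] b]])
  finally show ?case using Suc by simp
qed simp

text \<open>After splitting off the first term, its square stands \<open>Suc m\<close> steps before
  the test function and errs by \<open>v m\<close>; the cross term vanishes since the rest is a
  function of \<open>T\<close>. The errors therefore add along the block.\<close>

lemma block_variance:
  assumes q: "cond_in M T 0 0 q"
    and var: "\<And>i. cond_in M (T ^^ Suc i) (s2 - v i) (s2 + v i) (\<lambda>\<omega>. (q \<omega>)\<^sup>2)"
    and \<phi>: "bmeas M \<phi>" "\<forall>\<omega>\<in>space M. 0 \<le> \<phi> \<omega>"
  shows "\<bar>(\<integral>\<omega>. (orbit_sum T q m \<omega>)\<^sup>2 * \<phi> ((T ^^ m) \<omega>) \<partial>M) - real m * s2 * (\<integral>\<omega>. \<phi> \<omega> \<partial>M)\<bar>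
    \<le> (\<Sum>i<m. v i) * (\<integral>\<omega>. \<phi> \<omega> \<partial>M)"
proof (induction m)
  case (Suc m)
  have bq: "bmeas M q" by (rule cond_in_bmeas[OF q])
  note bo = bmeas_orbit_sum[OF bq, of m]
  note b = bmeas_iter[OF \<phi>(1), of m]
  let ?I = "\<integral>\<omega>. \<phi> \<omega> \<partial>M"
  let ?q2 = "\<lambda>\<omega>. (q \<omega>)\<^sup>2 * \<phi> ((T ^^ Suc m) \<omega>)"
  let ?cross = "\<lambda>\<omega>. orbit_sum T q m \<omega> * \<phi> ((T ^^ m) \<omega>)"
  let ?o2 = "\<lambda>\<omega>. (orbit_sum T q m \<omega>)\<^sup>2 * \<phi> ((T ^^ m) \<omega>)"
  have bc: "bmeas M ?cross" and bo2: "bmeas M ?o2"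
    by (intro bmeas_mult bmeas_power bo b)+
  have bq2: "bmeas M ?q2" by (intro bmeas_mult bmeas_power bq bmeas_iter[OF \<phi>(1)])
  have "(\<integral>\<omega>. (orbit_sum T q (Suc m) \<omega>)\<^sup>2 * \<phi> ((T ^^ Suc m) \<omega>) \<partial>M)
      = (\<integral>\<omega>. ?q2 \<omega> + (2 * (q \<omega> * ?cross (T \<omega>)) + ?o2 (T \<omega>)) \<partial>M)"
    by (intro Bochner_Integration.integral_cong refl)
      (simp add: orbit_sum_Suc funpow_swap1 power2_eq_square algebra_simps)
  also have "\<dots> = (\<integral>\<omega>. ?q2 \<omega> \<partial>M) + (\<integral>\<omega>. 2 * (q \<omega> * ?cross (T \<omega>)) + ?o2 (T \<omega>) \<partial>M)"
    by (intro Bochner_Integration.integral_add bmeas_integrable bq2 bmeas_add bmeas_mult bmeas_const bq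
        bmeas_T[OF bc] bmeas_T[OF bo2])
  also have "(\<integral>\<omega>. 2 * (q \<omega> * ?cross (T \<omega>)) + ?o2 (T \<omega>) \<partial>M)
      = (\<integral>\<omega>. 2 * (q \<omega> * ?cross (T \<omega>)) \<partial>M) + (\<integral>\<omega>. ?o2 (T \<omega>) \<partial>M)"
    by (intro Bochner_Integration.integral_add bmeas_integrable bmeas_mult bmeas_const bq
        bmeas_T[OF bc] bmeas_T[OF bo2])
  also have "(\<integral>\<omega>. 2 * (q \<omega> * ?cross (T \<omega>)) \<partial>M) = 0"
    using cond_in_zero_signed[OF q bc] by simp
  also have "(\<integral>\<omega>. ?o2 (T \<omega>) \<partial>M) = (\<integral>\<omega>. ?o2 \<omega> \<partial>M)" by (rule integral_T[OF bo2])
  finally have e: "(\<integral>\<omega>. (orbit_sum T q (Suc m) \<omega>)\<^sup>2 * \<phi> ((T ^^ Suc m) \<omega>) \<partial>M)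
      = (\<integral>\<omega>. ?q2 \<omega> \<partial>M) + (\<integral>\<omega>. ?o2 \<omega> \<partial>M)" by simp
  interpret S: preserving M "T ^^ Suc m" by (rule iter_preserving)
  define a b where "a = (\<integral>\<omega>. ?q2 \<omega> \<partial>M)" and "b = (\<integral>\<omega>. ?o2 \<omega> \<partial>M)"
  have "(s2 - v m) * ?I \<le> a" "a \<le> (s2 + v m) * ?I"
    using S.cond_inD(1,2)[OF var \<phi>] unfolding a_def by auto
  then have "\<bar>a - s2 * ?I\<bar> \<le> v m * ?I" by (simp add: abs_le_iff algebra_simps)
  moreover have "\<bar>b - real m * s2 * ?I\<bar> \<le> (\<Sum>i<m. v i) * ?I" using Suc unfolding b_def .
  moreover have "\<bar>(a + b) - real (Suc m) * s2 * ?I\<bar> \<le> \<bar>a - s2 * ?I\<bar> + \<bar>b - real m * s2 * ?I\<bar>"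
    using abs_triangle_ineq[of "a - s2 * ?I" "b - real m * s2 * ?I"] by (simp add: algebra_simps)
  ultimately have "\<bar>(a + b) - real (Suc m) * s2 * ?I\<bar> \<le> v m * ?I + (\<Sum>i<m. v i) * ?I" by linarith
  also have "\<dots> = (\<Sum>i<Suc m. v i) * ?I" by (simp add: algebra_simps)
  finally show ?case unfolding e a_def b_def .
qed simp

text \<open>The geometric errors sum to a constant independent of \<open>m\<close>, and within a
  block the coboundary telescopes to a coboundary of \<open>T ^^ m\<close> with the same
  \<open>p\<close>. A single pair \<open>C\<close>, \<open>p\<close> thus serves all block
  lengths.\<close>

lemma block_decomposition:
  assumes "mg_decomposition M T g s2"
  obtains C p where "0 < C" "bmeas M p" "\<And>\<omega>. \<omega> \<in> space M \<Longrightarrow> \<bar>p \<omega>\<bar> \<le> C"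
    "\<And>m. \<exists>d. cond_in M (T ^^ m) 0 0 d \<and>
        cond_in M (T ^^ m) (real m * s2 - C) (real m * s2 + C) (\<lambda>\<omega>. (d \<omega>)\<^sup>2) \<and>
        (\<forall>\<omega>\<in>space M. \<bar>d \<omega>\<bar> \<le> C * real m \<and> orbit_sum T g m \<omega> = d \<omega> + (p ((T ^^ m) \<omega>) - p \<omega>))"
proof -
  obtain q p C \<rho> where qp: "bmeas M q" "bmeas M p" and C: "0 \<le> C" "0 \<le> \<rho>" "\<rho> < 1"
    and g: "\<forall>x\<in>space M. g x = q x + (p (T x) - p x)" and q: "cond_in M T 0 0 q"
    and var: "\<And>i. cond_in M (T ^^ Suc i) (s2 - C * \<rho> ^ i) (s2 + C * \<rho> ^ i) (\<lambda>x. (q x)\<^sup>2)"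
    using assms unfolding mg_decomposition_def by blast
  obtain Cq where Cq: "Cq > 0" "\<And>\<omega>. \<omega> \<in> space M \<Longrightarrow> \<bar>q \<omega>\<bar> \<le> Cq" using bmeas_bound[OF qp(1)] by blast
  obtain Cp where Cp: "Cp > 0" "\<And>\<omega>. \<omega> \<in> space M \<Longrightarrow> \<bar>p \<omega>\<bar> \<le> Cp" using bmeas_bound[OF qp(2)] by blast
  define D where "D = Cq + Cp + C / (1 - \<rho>)"
  have pos: "0 \<le> C / (1 - \<rho>)" using C by simp
  have D: "Cq \<le> D" "Cp \<le> D" "C / (1 - \<rho>) \<le> D" "0 < D" using Cq Cp pos by (auto simp: D_def)
  show ?thesis
  proof (rule that[of D p])
    fix m
    let ?d = "orbit_sum T q m"
    have bd: "bmeas M ?d" by (rule bmeas_orbit_sum[OF qp(1)])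
    have "cond_in M (T ^^ m) 0 0 ?d" unfolding cond_in_def using block_mean[OF q] bd by simp
    moreover have "cond_in M (T ^^ m) (real m * s2 - D) (real m * s2 + D) (\<lambda>\<omega>. (?d \<omega>)\<^sup>2)"
      unfolding cond_in_def
    proof (intro conjI allI impI bmeas_power bd)
      fix \<phi> assume \<phi>: "bmeas M \<phi>" "\<forall>x\<in>space M. 0 \<le> \<phi> x"
      let ?I = "\<integral>\<omega>. \<phi> \<omega> \<partial>M"
      have I: "0 \<le> ?I" using \<phi> by (intro integral_nonneg_AE AE_I2) auto
      have "(\<Sum>i<m. C * \<rho> ^ i) = C * (\<Sum>i<m. \<rho> ^ i)" by (simp add: sum_distrib_left)
      also have "(\<Sum>i<m. \<rho> ^ i) \<le> 1 / (1 - \<rho>)"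
        using C by (simp add: sum_gp_strict divide_right_mono)
      finally have "(\<Sum>i<m. C * \<rho> ^ i) \<le> D" using D(3) C by (simp add: mult_left_mono)
      then have "(\<Sum>i<m. C * \<rho> ^ i) * ?I \<le> D * ?I" using I by (intro mult_right_mono)
      then have "\<bar>(\<integral>\<omega>. (?d \<omega>)\<^sup>2 * \<phi> ((T ^^ m) \<omega>) \<partial>M) - real m * s2 * ?I\<bar> \<le> D * ?I"
        using block_variance[OF q var \<phi>, of m] by linarith
      then show "(real m * s2 - D) * ?I \<le> (\<integral>\<omega>. (?d \<omega>)\<^sup>2 * \<phi> ((T ^^ m) \<omega>) \<partial>M)"
        "(\<integral>\<omega>. (?d \<omega>)\<^sup>2 * \<phi> ((T ^^ m) \<omega>) \<partial>M) \<le> (real m * s2 + D) * ?I"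
        unfolding left_diff_distrib distrib_right by linarith+
    qed
    moreover have "\<bar>?d \<omega>\<bar> \<le> D * real m \<and> orbit_sum T g m \<omega> = ?d \<omega> + (p ((T ^^ m) \<omega>) - p \<omega>)"
      if \<omega>: "\<omega> \<in> space M" for \<omega>
    proof
      have "\<bar>?d \<omega>\<bar> \<le> (\<Sum>i<m. \<bar>q ((T ^^ i) \<omega>)\<bar>)" unfolding orbit_sum_def by (rule sum_abs)
      also have "\<dots> \<le> (\<Sum>i<m. D)"
        by (intro sum_mono order_trans[OF Cq(2)[OF iter_space[OF \<omega>]] D(1)])
      finally show "\<bar>?d \<omega>\<bar> \<le> D * real m" by (simp add: mult.commute)
      have "orbit_sum T g m \<omega> = (\<Sum>i<m. q ((T ^^ i) \<omega>) + (p ((T ^^ Suc i) \<omega>) - p ((T ^^ i) \<omega>)))"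
        unfolding orbit_sum_def using g \<omega> by (intro sum.cong) auto
      also have "\<dots> = ?d \<omega> + (p ((T ^^ m) \<omega>) - p ((T ^^ 0) \<omega>))"
        using sum_lessThan_telescope[of "\<lambda>i. p ((T ^^ i) \<omega>)" m] by (simp add: orbit_sum_def sum.distrib)
      finally show "orbit_sum T g m \<omega> = ?d \<omega> + (p ((T ^^ m) \<omega>) - p \<omega>)" by simp
    qed
    ultimately show "\<exists>d. cond_in M (T ^^ m) 0 0 d \<and>
        cond_in M (T ^^ m) (real m * s2 - D) (real m * s2 + D) (\<lambda>\<omega>. (d \<omega>)\<^sup>2) \<and>
        (\<forall>\<omega>\<in>space M. \<bar>d \<omega>\<bar> \<le> D * real m \<and> orbit_sum T g m \<omega> = d \<omega> + (p ((T ^^ m) \<omega>) - p \<omega>))"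
      by blast
  qed (use D Cp qp in \<open>auto intro: order_trans\<close>)
qed

end

text \<open>Applied with \<open>T\<close> the block map and \<open>s\<close> a block sum. A
  vanishing denominator yields 0, in agreement with \<open>block_self_normalized\<close>.\<close>

definition self_normalized :: "('a \<Rightarrow> 'a) \<Rightarrow> ('a \<Rightarrow> real) \<Rightarrow> nat \<Rightarrow> 'a \<Rightarrow> real" where
  "self_normalized T s k \<omega> = orbit_sum T s k \<omega> / sqrt (orbit_sum T (\<lambda>\<omega>. (s \<omega>)\<^sup>2) k \<omega>)"

lemma self_normalized_scale:
  assumes "0 < B"
  shows "self_normalized T (\<lambda>\<omega>. s \<omega> / B) k \<omega> = self_normalized T s k \<omega>"
proof -
  have "orbit_sum T (\<lambda>\<omega>. s \<omega> / B) k \<omega> = orbit_sum T s k \<omega> / B"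
    "orbit_sum T (\<lambda>\<omega>. (s \<omega> / B)\<^sup>2) k \<omega> = orbit_sum T (\<lambda>\<omega>. (s \<omega>)\<^sup>2) k \<omega> / B\<^sup>2"
    by (simp_all add: orbit_sum_def sum_divide_distrib power_divide)
  then show ?thesis using assms by (simp add: self_normalized_def real_sqrt_divide)
qed

text \<open>What the block decomposition says about the block sums \<open>s\<close>, rescaled to unit total variance:
  they are a martingale array \<open>\<eta>\<close> up to an error that telescopes in the numerator (\<open>R\<close>) and is
  small in \<open>\<ell>\<^sup>2\<close> in the denominator (\<open>\<tau>\<close>).\<close>

definition approx_array ::
    "'a measure \<Rightarrow> ('a \<Rightarrow> 'a) \<Rightarrow> ('a \<Rightarrow> real) \<Rightarrow> nat \<Rightarrow> ('a \<Rightarrow> real) \<Rightarrow>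
       real \<Rightarrow> real \<Rightarrow> real \<Rightarrow> real \<Rightarrow> bool" where
  "approx_array M T s k \<eta> \<epsilon> \<beta> \<tau> R \<longleftrightarrow>
     bmeas M s \<and> 0 < k \<and> 0 \<le> \<epsilon> \<and> 0 \<le> \<beta> \<and> 0 \<le> \<tau> \<and> 0 \<le> R \<and>
     cond_in M T 0 0 \<eta> \<and>
     cond_in M T ((1 - \<beta>) / real k) ((1 + \<beta>) / real k) (\<lambda>\<omega>. (\<eta> \<omega>)\<^sup>2) \<and>
     (\<forall>\<omega>\<in>space M. \<bar>\<eta> \<omega>\<bar> \<le> \<epsilon> \<and> \<bar>orbit_sum T s k \<omega> - orbit_sum T \<eta> k \<omega>\<bar> \<le> R \<and>
        \<bar>sqrt (orbit_sum T (\<lambda>\<omega>. (s \<omega>)\<^sup>2) k \<omega>) - sqrt (orbit_sum T (\<lambda>\<omega>. (\<eta> \<omega>)\<^sup>2) k \<omega>)\<bar> \<le> \<tau>)"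

text \<open>The reverse triangle inequality for the Euclidean norm; it compares the two
  normalizations without any cross terms.\<close>

lemma L2_diff_le:
  fixes a b :: "nat \<Rightarrow> real"
  shows "\<bar>sqrt (\<Sum>i<k. (a i)\<^sup>2) - sqrt (\<Sum>i<k. (b i)\<^sup>2)\<bar> \<le> sqrt (\<Sum>i<k. (a i - b i)\<^sup>2)"
proof -
  have 1: "L2_set a {..<k} \<le> L2_set (\<lambda>i. a i - b i) {..<k} + L2_set b {..<k}"
    using L2_set_triangle_ineq[of "\<lambda>i. a i - b i" b "{..<k}"] by simp
  have "L2_set (\<lambda>i. b i - a i) {..<k} = L2_set (\<lambda>i. a i - b i) {..<k}"
    by (simp add: L2_set_def power2_commute)
  then have 2: "L2_set b {..<k} \<le> L2_set (\<lambda>i. a i - b i) {..<k} + L2_set a {..<k}"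
    using L2_set_triangle_ineq[of "\<lambda>i. b i - a i" a "{..<k}"] by simp
  show ?thesis using 1 2 unfolding L2_set_def by linarith
qed

context preserving
begin

text \<open>The scale is \<open>sqrt (s2 * m * k)\<close>. A block bounded by a multiple of
  \<open>m\<close> gives the first size, a bounded variance error against \<open>m * s2\<close> the
  second. Each of the \<open>k\<close> coboundary terms has size \<open>1 / sqrt (m * k)\<close>: in
  the numerator they telescope to one such term, in the denominator their Euclidean norm is of size
  \<open>1 / sqrt m\<close>.\<close>

lemma approx_array_blocks:
  assumes decomp: "mg_decomposition M T g s2" and s2: "0 < s2" and g: "bmeas M g"
  obtains C where "0 < C"
    "\<And>m k. 0 < m \<Longrightarrow> 0 < k \<Longrightarrow>
       \<exists>\<eta>. approx_array M (T ^^ m) (\<lambda>\<omega>. orbit_sum T g m \<omega> / sqrt (s2 * real (m * k))) k \<eta>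
         (C * real m / sqrt (real (m * k))) (C / real m) (C / sqrt (real m)) (C / sqrt (real (m * k)))"
proof -
  obtain D p where D: "0 < D" and p: "bmeas M p" "\<And>\<omega>. \<omega> \<in> space M \<Longrightarrow> \<bar>p \<omega>\<bar> \<le> D"
    and dec: "\<And>m. \<exists>d. cond_in M (T ^^ m) 0 0 d \<and>
        cond_in M (T ^^ m) (real m * s2 - D) (real m * s2 + D) (\<lambda>\<omega>. (d \<omega>)\<^sup>2) \<and>
        (\<forall>\<omega>\<in>space M. \<bar>d \<omega>\<bar> \<le> D * real m \<and> orbit_sum T g m \<omega> = d \<omega> + (p ((T ^^ m) \<omega>) - p \<omega>))"
    using block_decomposition[OF decomp] by blast
  define C where "C = D / s2 + 2 * D / sqrt s2"
  have pos: "0 \<le> D / s2" "0 \<le> D / sqrt s2" using D s2 by auto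
  have C: "D / s2 \<le> C" "D / sqrt s2 \<le> C" "2 * D / sqrt s2 \<le> C" using pos unfolding C_def by auto
  have Cpos: "0 < C" unfolding C_def using D s2 by (intro add_pos_pos divide_pos_pos) auto
  show ?thesis
  proof (rule that[OF Cpos])
    fix m k :: nat assume m: "0 < m" and k: "0 < k"
    obtain d where d: "cond_in M (T ^^ m) 0 0 d"
        "cond_in M (T ^^ m) (real m * s2 - D) (real m * s2 + D) (\<lambda>\<omega>. (d \<omega>)\<^sup>2)"
      and dd: "\<And>\<omega>. \<omega> \<in> space M \<Longrightarrow> \<bar>d \<omega>\<bar> \<le> D * real m"
        "\<And>\<omega>. \<omega> \<in> space M \<Longrightarrow> orbit_sum T g m \<omega> = d \<omega> + (p ((T ^^ m) \<omega>) - p \<omega>)"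
      using dec[of m] by blast
    interpret U: preserving M "T ^^ m" by (rule iter_preserving)
    let ?U = "T ^^ m"
    define B where "B = sqrt (s2 * real (m * k))"
    have "0 < s2 * real (m * k)" using m k s2 by simp
    then have B: "0 < B" "B = sqrt s2 * sqrt (real (m * k))" "B\<^sup>2 = s2 * real m * real k"
      unfolding B_def by (simp_all add: real_sqrt_mult[symmetric] mult.assoc)
    define \<eta> where "\<eta> \<omega> = d \<omega> / B" for \<omega>
    define s where "s \<omega> = orbit_sum T g m \<omega> / B" for \<omega>
    have s_eq: "s \<omega> = \<eta> \<omega> + (p (?U \<omega>) - p \<omega>) / B" if "\<omega> \<in> space M" for \<omega>
      using dd(2)[OF that] by (simp add: s_def \<eta>_def add_divide_distrib)
    have mean: "cond_in M ?U 0 0 \<eta>"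
    proof -
      have "0 \<le> inverse B" using B(1) by simp
      from U.cond_in_cmult[OF d(1) this] show ?thesis
        by (simp add: \<eta>_def[abs_def] divide_inverse mult.commute)
    qed
    have var: "cond_in M ?U ((1 - C / real m) / real k) ((1 + C / real m) / real k) (\<lambda>\<omega>. (\<eta> \<omega>)\<^sup>2)"
    proof -
      have "cond_in M ?U (inverse (B\<^sup>2) * (real m * s2 - D)) (inverse (B\<^sup>2) * (real m * s2 + D)) (\<lambda>\<omega>. inverse (B\<^sup>2) * (d \<omega>)\<^sup>2)"
        by (intro U.cond_in_cmult d(2)) simp
      moreover have "inverse (B\<^sup>2) * (real m * s2 - D) = (1 - (D / s2) / real m) / real k"
        "inverse (B\<^sup>2) * (real m * s2 + D) = (1 + (D / s2) / real m) / real k"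
        using m k s2 unfolding B(3) by (simp_all add: field_simps)
      moreover have "(\<lambda>\<omega>. inverse (B\<^sup>2) * (d \<omega>)\<^sup>2) = (\<lambda>\<omega>. (\<eta> \<omega>)\<^sup>2)"
        by (simp add: \<eta>_def divide_inverse power_mult_distrib power_inverse mult.commute fun_eq_iff)
      ultimately have "cond_in M ?U ((1 - (D / s2) / real m) / real k) ((1 + (D / s2) / real m) / real k) (\<lambda>\<omega>. (\<eta> \<omega>)\<^sup>2)"
        by simp
      moreover have "D / s2 / real m \<le> C / real m" by (rule divide_right_mono[OF C(1)]) simp
      ultimately show ?thesis
        by (elim U.cond_in_weaken) (auto intro!: divide_right_mono)
    qed
    have DB: "D / B \<le> C / sqrt (real (m * k))"
    proof -
      have "D / B = (D / sqrt s2) / sqrt (real (m * k))" unfolding B(2) by simp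
      also have "\<dots> \<le> C / sqrt (real (m * k))" by (intro divide_right_mono C(2)) simp
      finally show ?thesis .
    qed
    have DB2: "2 * D / B \<le> C / sqrt (real (m * k))"
    proof -
      have "2 * D / B = (2 * D / sqrt s2) / sqrt (real (m * k))" unfolding B(2) by simp
      also have "\<dots> \<le> C / sqrt (real (m * k))" by (intro divide_right_mono C(3)) simp
      finally show ?thesis .
    qed
    have "\<bar>\<eta> \<omega>\<bar> \<le> C * real m / sqrt (real (m * k))" if \<omega>: "\<omega> \<in> space M" for \<omega>
    proof -
      have "\<bar>\<eta> \<omega>\<bar> \<le> D * real m / B" unfolding \<eta>_def using dd(1)[OF \<omega>] B by (simp add: divide_right_mono)
      also have "\<dots> = D / B * real m" by simp
      also have "\<dots> \<le> C / sqrt (real (m * k)) * real m" by (intro mult_right_mono DB) simp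
      finally show ?thesis by simp
    qed
    moreover have pdiff: "\<bar>p \<omega>' - p \<omega>\<bar> \<le> 2 * D" if "\<omega> \<in> space M" "\<omega>' \<in> space M" for \<omega> \<omega>'
      using p(2)[OF that(1)] p(2)[OF that(2)] by linarith
    have "\<bar>orbit_sum ?U s k \<omega> - orbit_sum ?U \<eta> k \<omega>\<bar> \<le> C / sqrt (real (m * k))" if \<omega>: "\<omega> \<in> space M" for \<omega>
    proof -
      have "orbit_sum ?U s k \<omega> - orbit_sum ?U \<eta> k \<omega> = (\<Sum>i<k. p ((?U ^^ Suc i) \<omega>) / B - p ((?U ^^ i) \<omega>) / B)"
        unfolding orbit_sum_def sum_subtractf[symmetric]
        using s_eq[OF U.iter_space[OF \<omega>]] by (intro sum.cong) (auto simp: diff_divide_distrib)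
      also have "\<dots> = (p ((?U ^^ k) \<omega>) - p \<omega>) / B"
        by (subst sum_lessThan_telescope) (simp add: diff_divide_distrib)
      also have "\<bar>\<dots>\<bar> \<le> 2 * D / B"
        using pdiff[OF \<omega> U.iter_space[OF \<omega>]] B by (simp add: divide_right_mono)
      finally show ?thesis using DB2 by linarith
    qed
    moreover have "\<bar>sqrt (orbit_sum ?U (\<lambda>\<omega>. (s \<omega>)\<^sup>2) k \<omega>) - sqrt (orbit_sum ?U (\<lambda>\<omega>. (\<eta> \<omega>)\<^sup>2) k \<omega>)\<bar> \<le> C / sqrt (real m)"
      if \<omega>: "\<omega> \<in> space M" for \<omega>
    proof -
      have "\<bar>sqrt (orbit_sum ?U (\<lambda>\<omega>. (s \<omega>)\<^sup>2) k \<omega>) - sqrt (orbit_sum ?U (\<lambda>\<omega>. (\<eta> \<omega>)\<^sup>2) k \<omega>)\<bar>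
          \<le> sqrt (\<Sum>i<k. (s ((?U ^^ i) \<omega>) - \<eta> ((?U ^^ i) \<omega>))\<^sup>2)"
        unfolding orbit_sum_def by (rule L2_diff_le)
      also have "\<dots> \<le> sqrt (\<Sum>i<k. (C / sqrt (real (m * k)))\<^sup>2)"
      proof (intro real_sqrt_le_mono sum_mono)
        fix i
        have "\<bar>s ((?U ^^ i) \<omega>) - \<eta> ((?U ^^ i) \<omega>)\<bar> \<le> 2 * D / B"
          using s_eq[OF U.iter_space[OF \<omega>, of i]]
            pdiff[OF U.iter_space[OF \<omega>, of i] U.T_space[OF U.iter_space[OF \<omega>, of i]]] B
          by (simp add: divide_right_mono)
        then have "\<bar>s ((?U ^^ i) \<omega>) - \<eta> ((?U ^^ i) \<omega>)\<bar> \<le> C / sqrt (real (m * k))" using DB2 by linarith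
        then show "(s ((?U ^^ i) \<omega>) - \<eta> ((?U ^^ i) \<omega>))\<^sup>2 \<le> (C / sqrt (real (m * k)))\<^sup>2"
          by (metis abs_ge_zero power2_abs power_mono)
      qed
      also have "\<dots> = sqrt ((C / sqrt (real m))\<^sup>2)"
        using m k by (simp add: power_divide real_sqrt_mult power_mult_distrib)
      also have "\<dots> = C / sqrt (real m)" using Cpos by (simp add: real_sqrt_abs)
      finally show ?thesis .
    qed
    moreover have "bmeas M s" unfolding s_def by (intro bmeas_divide_const bmeas_orbit_sum g)
    ultimately have "approx_array M ?U s k \<eta> (C * real m / sqrt (real (m * k))) (C / real m)
        (C / sqrt (real m)) (C / sqrt (real (m * k)))"
      unfolding approx_array_def using mean var k Cpos by auto
    then show "\<exists>\<eta>. approx_array M ?U (\<lambda>\<omega>. orbit_sum T g m \<omega> / sqrt (s2 * real (m * k))) k \<eta>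
         (C * real m / sqrt (real (m * k))) (C / real m) (C / sqrt (real m)) (C / sqrt (real (m * k)))"
      unfolding s_def[abs_def] B_def by blast
  qed
qed

end

section \<open>Cramer bounds for the self-normalized sum\<close>

text \<open>With \<open>Q = y^2\<close> this expands the square root around \<open>Q = 1\<close>
  with an explicit global remainder; the gap has the nonnegative factor \<open>(y - 1)^2\<close> and
  a second factor that is nonnegative for \<open>y \<ge> 0\<close>.\<close>

lemma sqrt_lower_quadratic:
  assumes "0 \<le> (y::real)"
  shows "1 + (y\<^sup>2 - 1) / 2 - (y\<^sup>2 - 1)\<^sup>2 / 2 \<le> y"
proof -
  have "y - (1 + (y\<^sup>2 - 1) / 2 - (y\<^sup>2 - 1)\<^sup>2 / 2) = (y - 1)\<^sup>2 / 2 * ((y + 1)\<^sup>2 - 1)"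
    by (simp add: power2_eq_square field_simps)
  moreover have "0 \<le> (y - 1)\<^sup>2 / 2 * ((y + 1)\<^sup>2 - 1)"
    using assms power_mono[of 1 "y + 1" 2] by (intro mult_nonneg_nonneg) auto
  ultimately show ?thesis by linarith
qed

lemma sqrt_upper_linear:
  assumes "0 \<le> (y::real)"
  shows "y \<le> 1 + (y\<^sup>2 - 1) / 2"
proof -
  have "0 \<le> (y - 1)\<^sup>2" by simp
  then show ?thesis by (simp add: power2_eq_square field_simps)
qed

context preserving
begin

lemma measure_le_integral:
  assumes P: "{\<omega> \<in> space M. P \<omega>} \<in> sets M" and Z: "bmeas M Z" and c: "0 \<le> c"
    and "\<And>\<omega>. \<omega> \<in> space M \<Longrightarrow> 0 \<le> Z \<omega>" "\<And>\<omega>. \<omega> \<in> space M \<Longrightarrow> P \<omega> \<Longrightarrow> c \<le> Z \<omega>"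
  shows "measure M {\<omega> \<in> space M. P \<omega>} * c \<le> (\<integral>\<omega>. Z \<omega> \<partial>M)"
proof -
  have "measure M {\<omega> \<in> space M. P \<omega>} * c = (\<integral>\<omega>. indicator {\<omega> \<in> space M. P \<omega>} \<omega> * c \<partial>M)"
    using P by simp
  also have "\<dots> \<le> (\<integral>\<omega>. Z \<omega> \<partial>M)"
    by (intro integral_mono_bmeas bmeas_mult bmeas_indicator P bmeas_const Z)
      (use assms in \<open>auto simp: indicator_def\<close>)
  finally show ?thesis .
qed

text \<open>\<open>Z\<close> is a smoothed indicator of the event, and \<open>Y\<close> absorbs the
  smoothing tail outside it.\<close>

lemma integral_le_measure:
  assumes P: "{\<omega> \<in> space M. P \<omega>} \<in> sets M" and Z: "bmeas M Z" and Y: "bmeas M Y"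
    and "\<And>\<omega>. \<omega> \<in> space M \<Longrightarrow> P \<omega> \<Longrightarrow> Z \<omega> \<le> 1 + Y \<omega>" "\<And>\<omega>. \<omega> \<in> space M \<Longrightarrow> \<not> P \<omega> \<Longrightarrow> Z \<omega> \<le> Y \<omega>"
  shows "(\<integral>\<omega>. Z \<omega> \<partial>M) \<le> measure M {\<omega> \<in> space M. P \<omega>} + (\<integral>\<omega>. Y \<omega> \<partial>M)"
proof -
  have "(\<integral>\<omega>. Z \<omega> \<partial>M) \<le> (\<integral>\<omega>. indicator {\<omega> \<in> space M. P \<omega>} \<omega> + Y \<omega> \<partial>M)"
    by (intro integral_mono_bmeas bmeas_add bmeas_indicator P Z Y)
      (use assms in \<open>auto simp: indicator_def\<close>)
  also have "\<dots> = (\<integral>\<omega>. indicator {\<omega> \<in> space M. P \<omega>} \<omega> \<partial>M) + (\<integral>\<omega>. Y \<omega> \<partial>M)"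
    by (intro Bochner_Integration.integral_add bmeas_integrable bmeas_indicator P Y)
  finally show ?thesis using P by simp
qed

text \<open>Subtracting half of the quadratic variation linearizes the event \<open>M \<ge> x * sqrt Q\<close>, since
  \<open>sqrt Q \<approx> 1 + (Q - 1) / 2\<close>.\<close>

lemma linearized_array:
  assumes mean: "cond_in M T 0 0 \<eta>"
    and var: "cond_in M T ((1 - \<beta>) / real k) ((1 + \<beta>) / real k) (\<lambda>\<omega>. (\<eta> \<omega>)\<^sup>2)"
    and bdd: "\<forall>\<omega>\<in>space M. \<bar>\<eta> \<omega>\<bar> \<le> \<epsilon>"
    and k: "0 < k" "1 / real k \<le> \<epsilon>\<^sup>2" and x: "0 \<le> x" "x \<le> X" "X * \<epsilon> \<le> 1"
    and nn: "0 \<le> \<beta>" "\<beta> \<le> 1" "0 \<le> \<epsilon>"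
  defines "\<zeta> \<equiv> (\<lambda>\<omega>. \<eta> \<omega> - x / 2 * ((\<eta> \<omega>)\<^sup>2 - 1 / real k))"
  shows "cond_in M T (- (X * \<beta>) / real k) (X * \<beta> / real k) \<zeta>"
    "cond_in M T ((1 - (\<beta> + 6 * X * \<epsilon>)) / real k) ((1 + (\<beta> + 6 * X * \<epsilon>)) / real k) (\<lambda>\<omega>. (\<zeta> \<omega>)\<^sup>2)"
    "\<And>\<omega>. \<omega> \<in> space M \<Longrightarrow> \<bar>\<zeta> \<omega>\<bar> \<le> 2 * \<epsilon>"
    "\<And>\<omega>. orbit_sum T \<zeta> k \<omega> = orbit_sum T \<eta> k \<omega> - x / 2 * (orbit_sum T (\<lambda>\<omega>. (\<eta> \<omega>)\<^sup>2) k \<omega> - 1)"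
proof -
  note bd = bspec[OF bdd]
  have b\<eta>: "bmeas M \<eta>" by (rule cond_in_bmeas[OF mean])
  have xe: "x * \<epsilon> \<le> X * \<epsilon>" using x nn by (intro mult_right_mono)
  let ?D = "\<lambda>\<omega>. (\<eta> \<omega>)\<^sup>2 - 1 / real k"
  have D: "\<bar>?D \<omega>\<bar> \<le> \<epsilon>\<^sup>2" "\<bar>?D \<omega>\<bar> \<le> (\<eta> \<omega>)\<^sup>2 + 1 / real k" if "\<omega> \<in> space M" for \<omega>
  proof -
    have a: "(\<eta> \<omega>)\<^sup>2 \<le> \<epsilon>\<^sup>2" using bd[OF that] by (simp add: abs_le_square_iff[symmetric])
    have "0 \<le> (\<eta> \<omega>)\<^sup>2" "0 \<le> 1 / real k" by auto
    then show "\<bar>?D \<omega>\<bar> \<le> \<epsilon>\<^sup>2" "\<bar>?D \<omega>\<bar> \<le> (\<eta> \<omega>)\<^sup>2 + 1 / real k" using a k(2) by linarith+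
  qed
  have b\<zeta>: "bmeas M \<zeta>" unfolding \<zeta>_def by (intro bmeas_diff bmeas_mult bmeas_const bmeas_power b\<eta>)
  have "cond_in M T ((1 - \<beta>) / real k + - (1 / real k)) ((1 + \<beta>) / real k + - (1 / real k)) (\<lambda>\<omega>. (\<eta> \<omega>)\<^sup>2 + - (1 / real k))"
    by (intro cond_in_add var cond_in_const)
  then have "cond_in M T (- (\<beta> / real k)) (\<beta> / real k) ?D"
    by (simp add: add_divide_distrib diff_divide_distrib)
  from cond_in_add[OF mean cond_in_uminus[OF cond_in_cmult[OF this, of "x / 2"]]] x(1)
  have "cond_in M T (- (x / 2 * (\<beta> / real k))) (x / 2 * (\<beta> / real k)) \<zeta>"
    by (simp add: \<zeta>_def)
  moreover have "x / 2 * (\<beta> / real k) \<le> X * \<beta> / real k"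
    using x nn mult_right_mono[of "x / 2" X "\<beta> / real k"] by simp
  moreover have "- (X * \<beta>) / real k = - (X * \<beta> / real k)" by simp
  ultimately show "cond_in M T (- (X * \<beta>) / real k) (X * \<beta> / real k) \<zeta>"
    by (elim cond_in_weaken) (simp_all only: neg_le_iff_le)
  show "\<bar>\<zeta> \<omega>\<bar> \<le> 2 * \<epsilon>" if \<omega>: "\<omega> \<in> space M" for \<omega>
  proof -
    have "\<bar>x / 2 * ?D \<omega>\<bar> \<le> x / 2 * \<epsilon>\<^sup>2"
      using D(1)[OF \<omega>] x by (simp add: abs_mult mult_left_mono)
    also have "\<dots> = (x * \<epsilon>) / 2 * \<epsilon>" by (simp add: power2_eq_square)
    also have "\<dots> \<le> 1 * \<epsilon>" using xe x nn by (intro mult_right_mono) auto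
    finally show ?thesis using bd[OF \<omega>] unfolding \<zeta>_def by linarith
  qed
  show "orbit_sum T \<zeta> k \<omega> = orbit_sum T \<eta> k \<omega> - x / 2 * (orbit_sum T (\<lambda>\<omega>. (\<eta> \<omega>)\<^sup>2) k \<omega> - 1)" for \<omega>
  proof -
    have "orbit_sum T \<zeta> k \<omega> = orbit_sum T \<eta> k \<omega> - x / 2 * (orbit_sum T (\<lambda>\<omega>. (\<eta> \<omega>)\<^sup>2) k \<omega> - (\<Sum>i<k. 1 / real k))"
      unfolding orbit_sum_def \<zeta>_def by (simp only: sum_subtractf sum_distrib_left[symmetric])
    then show ?thesis using k by simp
  qed
  \<comment> \<open>The change of the square is bounded by a multiple of
    \<open>\<eta>^2 + 1 / k\<close> instead of a constant: conditionally this is of order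
    \<open>1 / k\<close>, so the change is a relative error \<open>X * \<epsilon>\<close> of the
    variance.\<close>
  have cross: "\<bar>(\<zeta> \<omega>)\<^sup>2 - (\<eta> \<omega>)\<^sup>2\<bar> \<le> 2 * X * \<epsilon> * ((\<eta> \<omega>)\<^sup>2 + 1 / real k)" if \<omega>: "\<omega> \<in> space M" for \<omega>
  proof -
    have "(\<zeta> \<omega>)\<^sup>2 - (\<eta> \<omega>)\<^sup>2 = x * ?D \<omega> * (x / 4 * ?D \<omega> - \<eta> \<omega>)"
    proof -
      have "(a - x / 2 * b)\<^sup>2 - a\<^sup>2 = x * b * (x / 4 * b - a)" for a b :: real
        by (simp add: power2_eq_square field_simps)
      then show ?thesis unfolding \<zeta>_def .
    qed
    then have "\<bar>(\<zeta> \<omega>)\<^sup>2 - (\<eta> \<omega>)\<^sup>2\<bar> = x * \<bar>?D \<omega>\<bar> * \<bar>x / 4 * ?D \<omega> - \<eta> \<omega>\<bar>"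
      using x by (simp add: abs_mult)
    also have "\<bar>x / 4 * ?D \<omega> - \<eta> \<omega>\<bar> \<le> 2 * \<epsilon>"
    proof -
      have "\<bar>x / 4 * ?D \<omega>\<bar> \<le> x / 4 * \<epsilon>\<^sup>2"
        using D(1)[OF \<omega>] x by (simp add: abs_mult mult_left_mono)
      also have "\<dots> = (x * \<epsilon>) / 4 * \<epsilon>" by (simp add: power2_eq_square)
      also have "\<dots> \<le> 1 * \<epsilon>" using xe x nn by (intro mult_right_mono) auto
      finally show ?thesis using bd[OF \<omega>] by linarith
    qed
    finally have "\<bar>(\<zeta> \<omega>)\<^sup>2 - (\<eta> \<omega>)\<^sup>2\<bar> \<le> x * \<bar>?D \<omega>\<bar> * (2 * \<epsilon>)" using x by (simp add: mult_left_mono)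
    also have "\<dots> \<le> X * ((\<eta> \<omega>)\<^sup>2 + 1 / real k) * (2 * \<epsilon>)"
      using x nn D(2)[OF \<omega>] by (intro mult_right_mono mult_mono) auto
    finally show ?thesis by (simp add: mult_ac)
  qed
  define c where "c = 2 * X * \<epsilon>"
  have c: "0 \<le> c" unfolding c_def using x nn by simp
  have hi: "cond_in M T ((1 - \<beta>) / real k + c * ((1 - \<beta>) / real k + 1 / real k)) ((1 + \<beta>) / real k + c * ((1 + \<beta>) / real k + 1 / real k))
      (\<lambda>\<omega>. (\<eta> \<omega>)\<^sup>2 + c * ((\<eta> \<omega>)\<^sup>2 + 1 / real k))"
    by (intro cond_in_add cond_in_cmult var cond_in_const c)
  have lo: "cond_in M T ((1 - \<beta>) / real k + - (c * ((1 + \<beta>) / real k + 1 / real k))) ((1 + \<beta>) / real k + - (c * ((1 - \<beta>) / real k + 1 / real k)))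
      (\<lambda>\<omega>. (\<eta> \<omega>)\<^sup>2 + - (c * ((\<eta> \<omega>)\<^sup>2 + 1 / real k)))"
    by (intro cond_in_add cond_in_uminus cond_in_cmult var cond_in_const c)
  have mid: "cond_in M T ((1 - \<beta>) / real k + - (c * ((1 + \<beta>) / real k + 1 / real k)))
     ((1 + \<beta>) / real k + c * ((1 + \<beta>) / real k + 1 / real k)) (\<lambda>\<omega>. (\<zeta> \<omega>)\<^sup>2)"
  proof (rule cond_in_mono[OF lo hi bmeas_power[OF b\<zeta>]])
    fix \<omega> assume "\<omega> \<in> space M"
    from cross[OF this] show "(\<eta> \<omega>)\<^sup>2 + - (c * ((\<eta> \<omega>)\<^sup>2 + 1 / real k)) \<le> (\<zeta> \<omega>)\<^sup>2"
      "(\<zeta> \<omega>)\<^sup>2 \<le> (\<eta> \<omega>)\<^sup>2 + c * ((\<eta> \<omega>)\<^sup>2 + 1 / real k)"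
      unfolding c_def[symmetric] by linarith+
  qed
  have "c * (2 + \<beta>) \<le> c * 3" using c nn by (intro mult_left_mono) auto
  then have "c * ((1 + \<beta>) / real k + 1 / real k) \<le> 6 * X * \<epsilon> / real k"
    using k by (simp add: c_def divide_right_mono flip: add_divide_distrib)
  then show "cond_in M T ((1 - (\<beta> + 6 * X * \<epsilon>)) / real k) ((1 + (\<beta> + 6 * X * \<epsilon>)) / real k) (\<lambda>\<omega>. (\<zeta> \<omega>)\<^sup>2)"
    by (intro cond_in_weaken[OF mid]) (auto simp: add_divide_distrib diff_divide_distrib)
qed

text \<open>For a positive denominator the event compares numerator and threshold times denominator,
  and both are then exchanged for those of \<open>\<eta>\<close> at the costs \<open>R\<close> and
  \<open>x * \<tau>\<close>. Positivity follows since \<open>sqrt Q\<close> is at least 1/2 and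
  \<open>\<tau>\<close> is smaller.\<close>

lemma self_normalized_sandwich:
  assumes A: "approx_array M T s k \<eta> \<epsilon> \<beta> \<tau> R" and \<omega>: "\<omega> \<in> space M"
    and Q: "1 / 4 \<le> orbit_sum T (\<lambda>\<omega>. (\<eta> \<omega>)\<^sup>2) k \<omega>" and \<tau>: "\<tau> < 1 / 2" and x: "0 \<le> x"
  shows "x \<le> self_normalized T s k \<omega> \<Longrightarrow>
      x * sqrt (orbit_sum T (\<lambda>\<omega>. (\<eta> \<omega>)\<^sup>2) k \<omega>) - x * \<tau> - R \<le> orbit_sum T \<eta> k \<omega>"
    "x * sqrt (orbit_sum T (\<lambda>\<omega>. (\<eta> \<omega>)\<^sup>2) k \<omega>) + x * \<tau> + R \<le> orbit_sum T \<eta> k \<omega> \<Longrightarrow>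
      x \<le> self_normalized T s k \<omega>"
proof -
  let ?q = "sqrt (orbit_sum T (\<lambda>\<omega>. (\<eta> \<omega>)\<^sup>2) k \<omega>)" and ?v = "sqrt (orbit_sum T (\<lambda>\<omega>. (s \<omega>)\<^sup>2) k \<omega>)"
  have a: "\<bar>orbit_sum T s k \<omega> - orbit_sum T \<eta> k \<omega>\<bar> \<le> R" "\<bar>?v - ?q\<bar> \<le> \<tau>"
    using A \<omega> unfolding approx_array_def by auto
  have "1 / 2 \<le> ?q" using Q by (intro real_le_rsqrt) (simp add: power2_eq_square)
  then have v: "0 < ?v" using a(2) \<tau> by linarith
  have xv: "x * ?q - x * \<tau> \<le> x * ?v" "x * ?v \<le> x * ?q + x * \<tau>"
    using a(2) x mult_left_mono[of "?q - \<tau>" ?v x] mult_left_mono[of ?v "?q + \<tau>" x]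
    by (auto simp: algebra_simps)
  have W: "x \<le> self_normalized T s k \<omega> \<longleftrightarrow> x * ?v \<le> orbit_sum T s k \<omega>"
    unfolding self_normalized_def using v by (rule pos_le_divide_eq)
  show "x \<le> self_normalized T s k \<omega> \<Longrightarrow> x * ?q - x * \<tau> - R \<le> orbit_sum T \<eta> k \<omega>"
    unfolding W using xv a(1) by linarith
  show "x * ?q + x * \<tau> + R \<le> orbit_sum T \<eta> k \<omega> \<Longrightarrow> x \<le> self_normalized T s k \<omega>"
    unfolding W using xv a(1) by linarith
qed

lemma self_normalized_measurable:
  assumes "bmeas M s"
  shows "self_normalized T s k \<in> borel_measurable M"
proof -
  have [measurable]: "orbit_sum T s k \<in> borel_measurable M"
    "orbit_sum T (\<lambda>\<omega>. (s \<omega>)\<^sup>2) k \<in> borel_measurable M"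
    by (intro bmeas_measurable bmeas_orbit_sum bmeas_power assms)+
  show ?thesis unfolding self_normalized_def[abs_def] by measurable
qed

text \<open>The constant is 9 for \<open>exp 2\<close> times 6, as \<open>3 * (1 + x)\<close> is at
  most \<open>6 * X\<close>.\<close>

lemma weight_le_ntail:
  assumes "0 \<le> x" "x \<le> X" "1 \<le> X" "a \<le> 2 - x\<^sup>2 / 2"
  shows "exp a \<le> 54 * X * ntail x"
proof -
  have "exp a \<le> exp 2 * exp (- x\<^sup>2 / 2)" using assms(4) by (simp add: exp_add[symmetric])
  also have "\<dots> \<le> 9 * (6 * X * ntail x)"
  proof (intro mult_mono)
    have "exp 2 = exp 1 * exp (1::real)" by (simp add: exp_add[symmetric])
    also have "\<dots> \<le> 3 * 3" by (intro mult_mono exp_le) auto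
    finally show "exp 2 \<le> (9::real)" by simp
    have "exp (- x\<^sup>2 / 2) \<le> 3 * (1 + x) * ntail x" by (rule exp_le_ntail[OF assms(1)])
    also have "\<dots> \<le> (6 * X) * ntail x"
      using assms ntail_nonneg by (intro mult_right_mono) auto
    finally show "exp (- x\<^sup>2 / 2) \<le> 6 * X * ntail x" .
  qed auto
  finally show ?thesis by simp
qed

text \<open>\<open>\<gamma> / X\<close> is the tolerated deviation of the quadratic variation from \<open>1\<close>; the Gaussian
  smoothing has standard deviation \<open>\<delta>\<close> and is cut off at \<open>\<delta> * L\<close>, so \<open>d\<close> is the total shift of
  the threshold \<open>x\<close>.\<close>

lemma self_normalized_cramer:
  assumes A: "approx_array M T s k \<eta> \<epsilon> \<beta> \<tau> R"
    and x: "0 \<le> x" "x \<le> X" "1 \<le> X" and L: "1 \<le> L"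
    and \<gamma>: "0 < \<gamma>" "\<gamma> \<le> X / 2" "2 * X ^ 3 * \<epsilon>\<^sup>2 \<le> \<gamma>"
      "2 * X ^ 3 * \<beta> / \<gamma> + 8 * X ^ 6 * \<epsilon>\<^sup>2 / \<gamma>\<^sup>2 \<le> 2"
    and h: "1 / real k \<le> h" "h \<le> \<epsilon>\<^sup>2" "h \<le> \<delta>\<^sup>2" and \<delta>: "0 < \<delta>"
    and small: "\<beta> + 6 * X * \<epsilon> \<le> 1" "2 * X * \<epsilon> \<le> 1" "\<tau> < 1 / 2"
      "X\<^sup>2 * \<delta>\<^sup>2 + 2 * X\<^sup>2 * \<beta> + 8 * X ^ 3 * \<epsilon> \<le> 1"
    and d: "d = (\<gamma>\<^sup>2 / 2 + X\<^sup>2 * \<tau> + X * R) / X + \<delta> * L + X * \<delta>\<^sup>2" "X * d \<le> 1"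
    and err: "err = 108 * exp (9 / 2) * X * (X * \<beta> + (X + 1 / \<delta>) * (\<beta> + 6 * X * \<epsilon>)
        + 8 * (X + 1 / \<delta>)\<^sup>2 * \<epsilon> + 2 * (X + 1 / \<delta>) ^ 3 * h)"
  shows "measure M {\<omega> \<in> space M. x \<le> self_normalized T s k \<omega>} * ntail (- L)
      \<le> (1 + 18 * X * d + err + 108 * X * exp (- X\<^sup>2)) * ntail x" (is ?upper)
    "(1 - 18 * X * d - err - 54 * X * exp (- L\<^sup>2 / 4) - 108 * X * exp (- X\<^sup>2)) * ntail x
      \<le> measure M {\<omega> \<in> space M. x \<le> self_normalized T s k \<omega>}" (is ?lower)
proof -
  have s: "bmeas M s" and k: "0 < k" and nn: "0 \<le> \<epsilon>" "0 \<le> \<beta>" "0 \<le> \<tau>" "0 \<le> R"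
    and mean: "cond_in M T 0 0 \<eta>"
    and var: "cond_in M T ((1 - \<beta>) / real k) ((1 + \<beta>) / real k) (\<lambda>\<omega>. (\<eta> \<omega>)\<^sup>2)"
    and bd: "\<And>\<omega>. \<omega> \<in> space M \<Longrightarrow> \<bar>\<eta> \<omega>\<bar> \<le> \<epsilon>"
    using A unfolding approx_array_def by auto
  have b\<eta>: "bmeas M \<eta>" by (rule cond_in_bmeas[OF mean])
  have X0: "0 < X" "0 \<le> X" using x by auto
  have Xe: "0 \<le> X * \<epsilon>" using X0 nn by simp
  have \<beta>1: "\<beta> \<le> 1" "X * \<epsilon> \<le> 1" using small(1,2) Xe nn by linarith+
  define Q where "Q = orbit_sum T (\<lambda>\<omega>. (\<eta> \<omega>)\<^sup>2) k"
  define \<zeta> where "\<zeta> = (\<lambda>\<omega>. \<eta> \<omega> - x / 2 * ((\<eta> \<omega>)\<^sup>2 - 1 / real k))"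
  define Z where "Z = orbit_sum T \<zeta> k"
  \<comment> \<open>\<open>\<theta> / X\<close> is the total threshold shift from three sources: the
    quadratic error of the square root, the coboundary in the denominator and the coboundary in the
    numerator.\<close>
  define \<theta> where "\<theta> = \<gamma>\<^sup>2 / 2 + X\<^sup>2 * \<tau> + X * R"
  define P where "P = measure M {\<omega> \<in> space M. x \<le> self_normalized T s k \<omega>}"
  define bad where "bad = measure M {\<omega> \<in> space M. \<gamma> / X \<le> \<bar>Q \<omega> - 1\<bar>}"
  have kh: "1 / real k \<le> \<epsilon>\<^sup>2" "1 / real k \<le> \<delta>\<^sup>2" using h by auto
  have bdd: "\<forall>\<omega>\<in>space M. \<bar>\<eta> \<omega>\<bar> \<le> \<epsilon>" using bd by blast
  note LA = linearized_array[OF mean var bdd k kh(1) x(1,2) \<beta>1(2) nn(2) \<beta>1(1) nn(1)]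
  have lin: "cond_in M T (- (X * \<beta>) / real k) (X * \<beta> / real k) \<zeta>"
    "cond_in M T ((1 - (\<beta> + 6 * X * \<epsilon>)) / real k) ((1 + (\<beta> + 6 * X * \<epsilon>)) / real k) (\<lambda>\<omega>. (\<zeta> \<omega>)\<^sup>2)"
    "\<And>\<omega>. \<omega> \<in> space M \<Longrightarrow> \<bar>\<zeta> \<omega>\<bar> \<le> 2 * \<epsilon>"
    "\<And>\<omega>. orbit_sum T \<zeta> k \<omega> = orbit_sum T \<eta> k \<omega> - x / 2 * (orbit_sum T (\<lambda>\<omega>. (\<eta> \<omega>)\<^sup>2) k \<omega> - 1)"
    unfolding \<zeta>_def by (rule LA(1), rule LA(2), erule LA(3), rule LA(4))
  have Z_eq: "Z \<omega> = orbit_sum T \<eta> k \<omega> - x / 2 * (Q \<omega> - 1)" for \<omega>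
    unfolding Z_def Q_def by (rule lin(4))
  have b\<zeta>: "bmeas M \<zeta>" by (rule cond_in_bmeas[OF lin(1)])
  have bZ: "bmeas M Z" and bQ: "bmeas M Q" unfolding Z_def Q_def by (intro bmeas_orbit_sum bmeas_power b\<zeta> b\<eta>)+
  have [measurable]: "Z \<in> borel_measurable M" "Q \<in> borel_measurable M"
    "self_normalized T s k \<in> borel_measurable M"
    using bZ bQ self_normalized_measurable[OF s] by (auto intro: bmeas_measurable)
  have \<theta>: "0 \<le> \<theta> / X" unfolding \<theta>_def using X0 nn by simp
  have \<theta>X: "\<theta> / X = \<gamma>\<^sup>2 / (2 * X) + X * \<tau> + R"
    using X0 by (simp add: \<theta>_def field_simps power2_eq_square)
  have \<delta>L: "0 \<le> \<delta> * L" "0 \<le> X * \<delta>\<^sup>2" using \<delta> L X0 by auto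
  have d_eq: "d = \<theta> / X + \<delta> * L + X * \<delta>\<^sup>2" unfolding d(1) \<theta>_def ..
  have d0: "0 \<le> d" "x * d \<le> 1" using d_eq \<theta> \<delta>L d(2) mult_right_mono[OF x(2), of d] by auto
  have x2: "x\<^sup>2 \<le> X\<^sup>2" using x by (intro power_mono) auto

  \<comment> \<open>Deviation of the quadratic variation from 1\<close>
  have bad_le: "bad \<le> 108 * X * exp (- X\<^sup>2) * ntail x"
  proof -
    \<comment> \<open>With this choice \<open>c * (\<gamma> / X)\<close> equals
      \<open>2 * X^2\<close>. One half of it pays for \<open>ntail x\<close>, the other remains as
      the factor \<open>exp (- X^2)\<close>.\<close>
    define c where "c = 2 * X ^ 3 / \<gamma>"
    have c: "0 \<le> c" unfolding c_def using X0 \<gamma> by simp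
    have "c * \<epsilon>\<^sup>2 = 2 * X ^ 3 * \<epsilon>\<^sup>2 / \<gamma>" by (simp add: c_def)
    also have "\<dots> \<le> 1" using \<gamma> by (simp add: divide_le_eq)
    finally have ce: "c * \<epsilon>\<^sup>2 \<le> 1" .
    have "bad \<le> 2 * exp (- c * (\<gamma> / X) + c * \<beta> + 2 * c\<^sup>2 * \<epsilon>\<^sup>2)"
      unfolding bad_def Q_def by (rule quadratic_concentration[OF var b\<eta> bd c ce k nn(2) \<beta>1(1)])
    also have "- c * (\<gamma> / X) + c * \<beta> + 2 * c\<^sup>2 * \<epsilon>\<^sup>2 = - 2 * X\<^sup>2 + (2 * X ^ 3 * \<beta> / \<gamma> + 8 * X ^ 6 * \<epsilon>\<^sup>2 / \<gamma>\<^sup>2)"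
      using X0 \<gamma> by (simp add: c_def power_divide power2_eq_square power3_eq_cube numeral_eq_Suc)
    also have "exp \<dots> \<le> exp (- X\<^sup>2 + (2 - X\<^sup>2))" using \<gamma>(4) by simp
    also have "\<dots> = exp (- X\<^sup>2) * exp (2 - X\<^sup>2)" by (rule exp_add)
    also have "exp (2 - X\<^sup>2) \<le> 54 * X * ntail x"
      using x2 zero_le_power2[of X] by (intro weight_le_ntail x) linarith
    finally show ?thesis by (simp add: mult_ac)
  qed
  \<comment> \<open>The smallness assumptions keep both exponents within 1 of their Gaussian values,
    so they change the weights by a bounded factor only.\<close>
  have \<Gamma>: "x\<^sup>2 * \<delta>\<^sup>2 / 2 + x * (X * \<beta>) + x\<^sup>2 * ((\<beta> + 6 * X * \<epsilon>) / 2 + x * (2 * \<epsilon>)) \<le> 1"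
    "x * (X * \<beta>) + x\<^sup>2 / 2 * ((1 + x * (2 * \<epsilon>)) * (1 + (\<beta> + 6 * X * \<epsilon>))) \<le> x\<^sup>2 / 2 + 1"
  proof -
    have 1: "x\<^sup>2 * \<delta>\<^sup>2 \<le> X\<^sup>2 * \<delta>\<^sup>2" "x * (X * \<beta>) \<le> X\<^sup>2 * \<beta>" "x\<^sup>2 * \<beta> \<le> X\<^sup>2 * \<beta>" "x\<^sup>2 * (X * \<epsilon>) \<le> X ^ 3 * \<epsilon>" "x\<^sup>2 * (x * \<epsilon>) \<le> X ^ 3 * \<epsilon>"
    proof -
      show "x\<^sup>2 * \<delta>\<^sup>2 \<le> X\<^sup>2 * \<delta>\<^sup>2" "x\<^sup>2 * \<beta> \<le> X\<^sup>2 * \<beta>" using x2 nn by (auto intro: mult_right_mono)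
      show "x * (X * \<beta>) \<le> X\<^sup>2 * \<beta>" using mult_right_mono[OF x(2), of "X * \<beta>"] X0 nn by (simp add: power2_eq_square mult.assoc)
      show "x\<^sup>2 * (X * \<epsilon>) \<le> X ^ 3 * \<epsilon>" using mult_right_mono[OF x2 Xe] by (simp add: power2_eq_square power3_eq_cube mult.assoc)
      have "x\<^sup>2 * (x * \<epsilon>) \<le> X\<^sup>2 * (X * \<epsilon>)" using x2 x nn by (intro mult_mono) auto
      then show "x\<^sup>2 * (x * \<epsilon>) \<le> X ^ 3 * \<epsilon>" by (simp add: power2_eq_square power3_eq_cube mult.assoc)
    qed
    have 2: "0 \<le> X\<^sup>2 * \<delta>\<^sup>2" "0 \<le> X\<^sup>2 * \<beta>" "0 \<le> X ^ 3 * \<epsilon>" using X0 nn by auto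
    have "x\<^sup>2 * \<delta>\<^sup>2 / 2 + x * (X * \<beta>) + x\<^sup>2 * ((\<beta> + 6 * X * \<epsilon>) / 2 + x * (2 * \<epsilon>))
      = x\<^sup>2 * \<delta>\<^sup>2 / 2 + x * (X * \<beta>) + (x\<^sup>2 * \<beta>) / 2 + 3 * (x\<^sup>2 * (X * \<epsilon>)) + 2 * (x\<^sup>2 * (x * \<epsilon>))"
      by (simp add: field_simps)
    also have "\<dots> \<le> 1" using 1 2 small(4) by linarith
    finally show "x\<^sup>2 * \<delta>\<^sup>2 / 2 + x * (X * \<beta>) + x\<^sup>2 * ((\<beta> + 6 * X * \<epsilon>) / 2 + x * (2 * \<epsilon>)) \<le> 1" .
    have "x * (2 * \<epsilon>) * (\<beta> + 6 * X * \<epsilon>) \<le> x * (2 * \<epsilon>) * 1"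
      using x nn small(1) by (intro mult_left_mono) auto
    then have "(1 + x * (2 * \<epsilon>)) * (1 + (\<beta> + 6 * X * \<epsilon>)) \<le> 1 + (\<beta> + 6 * X * \<epsilon> + 4 * (x * \<epsilon>))"
      by (simp add: algebra_simps)
    then have "x\<^sup>2 / 2 * ((1 + x * (2 * \<epsilon>)) * (1 + (\<beta> + 6 * X * \<epsilon>))) \<le> x\<^sup>2 / 2 * (1 + (\<beta> + 6 * X * \<epsilon> + 4 * (x * \<epsilon>)))"
      by (intro mult_left_mono) auto
    also have "\<dots> = x\<^sup>2 / 2 + (x\<^sup>2 * \<beta>) / 2 + 3 * (x\<^sup>2 * (X * \<epsilon>)) + 2 * (x\<^sup>2 * (x * \<epsilon>))"
      by (simp add: field_simps)
    finally show "x * (X * \<beta>) + x\<^sup>2 / 2 * ((1 + x * (2 * \<epsilon>)) * (1 + (\<beta> + 6 * X * \<epsilon>))) \<le> x\<^sup>2 / 2 + 1"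
      using 1 2 small(4) by linarith
  qed
  have xe2: "x * (2 * \<epsilon>) \<le> 1" using mult_right_mono[OF x(2), of "2 * \<epsilon>"] nn small(2) by simp
  have x2k: "x\<^sup>2 \<le> 2 * real k"
  proof -
    have "X\<^sup>2 * (1 / real k) \<le> X\<^sup>2 * \<epsilon>\<^sup>2" using kh(1) by (intro mult_left_mono) auto
    also have "\<dots> = (X * \<epsilon>)\<^sup>2" by (simp add: power_mult_distrib)
    also have "\<dots> \<le> 1" using Xe \<beta>1(2) by (simp add: power_le_one)
    finally show ?thesis using x2 k by (simp add: divide_le_eq)
  qed
  have Xb: "0 \<le> X * \<beta>" "0 \<le> \<beta> + 6 * X * \<epsilon>" "0 \<le> 2 * \<epsilon>" using X0 nn Xe by auto

  \<comment> \<open>Gaussian comparison for the linearized sum\<close>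
  have lindeberg: "\<bar>(\<integral>\<omega>. htail (\<delta>\<^sup>2) (y - Z \<omega>) \<partial>M) - htail (1 + \<delta>\<^sup>2) y\<bar> \<le> err * ntail x"
    if y: "x - d \<le> y" for y
  proof -
    have "\<bar>(\<integral>\<omega>. htail (\<delta>\<^sup>2) (y - Z \<omega>) \<partial>M) - htail (1 + \<delta>\<^sup>2) y\<bar>
      \<le> 2 * exp (9 / 2) * (X * \<beta> + (x + 1 / \<delta>) * (\<beta> + 6 * X * \<epsilon>) + 4 * (x + 1 / \<delta>)\<^sup>2 * (2 * \<epsilon>) + 2 * (x + 1 / \<delta>) ^ 3 / real k)
        * exp (x\<^sup>2 / 2 - x * y + (x\<^sup>2 * \<delta>\<^sup>2 / 2 + x * (X * \<beta>) + x\<^sup>2 * ((\<beta> + 6 * X * \<epsilon>) / 2 + x * (2 * \<epsilon>))))"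
      unfolding Z_def
      by (rule lindeberg[OF lin(1-3) k \<delta> kh(2) x(1) xe2 x2k Xb(1,2) small(1) Xb(3)])
    also have "\<dots> \<le> 2 * exp (9 / 2) * (X * \<beta> + (X + 1 / \<delta>) * (\<beta> + 6 * X * \<epsilon>) + 4 * (X + 1 / \<delta>)\<^sup>2 * (2 * \<epsilon>) + 2 * (X + 1 / \<delta>) ^ 3 * h)
        * (54 * X * ntail x)"
    proof (intro mult_mono add_mono power_mono weight_le_ntail x)
      \<comment> \<open>Thresholds as low as \<open>x - d\<close> are allowed: as
        \<open>x * d \<le> 1\<close>, the weight at \<open>y\<close> remains within a bounded factor
        of \<open>exp (- x^2 / 2)\<close>, hence comparable to \<open>ntail x\<close> up to
        \<open>X\<close>.\<close>
      have "x * (x - d) \<le> x * y" using y x by (intro mult_left_mono)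
      then have "x\<^sup>2 / 2 - x * y \<le> 1 - x\<^sup>2 / 2" using d0(2) by (simp add: power2_eq_square algebra_simps)
      then show "x\<^sup>2 / 2 - x * y + (x\<^sup>2 * \<delta>\<^sup>2 / 2 + x * (X * \<beta>) + x\<^sup>2 * ((\<beta> + 6 * X * \<epsilon>) / 2 + x * (2 * \<epsilon>))) \<le> 2 - x\<^sup>2 / 2"
        using \<Gamma>(1) by linarith
      have "2 * (x + 1 / \<delta>) ^ 3 / real k = 2 * (x + 1 / \<delta>) ^ 3 * (1 / real k)" by simp
      also have "\<dots> \<le> 2 * (X + 1 / \<delta>) ^ 3 * h"
        using x \<delta> h(1) by (intro mult_mono power_mono) auto
      finally show "2 * (x + 1 / \<delta>) ^ 3 / real k \<le> 2 * (X + 1 / \<delta>) ^ 3 * h" .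
      have "0 \<le> h" using h(1) order_trans[of 0 "1 / real k" h] by simp
      then show "0 \<le> 2 * exp (9 / 2) * (X * \<beta> + (X + 1 / \<delta>) * (\<beta> + 6 * X * \<epsilon>) + 4 * (X + 1 / \<delta>)\<^sup>2 * (2 * \<epsilon>) + 2 * (X + 1 / \<delta>) ^ 3 * h)"
        "0 \<le> X * \<beta> + (x + 1 / \<delta>) * (\<beta> + 6 * X * \<epsilon>) + 4 * (x + 1 / \<delta>)\<^sup>2 * (2 * \<epsilon>) + 2 * (x + 1 / \<delta>) ^ 3 / real k"
        using X0 x nn \<delta> Xb by (auto intro!: add_nonneg_nonneg mult_nonneg_nonneg)
    qed (use x \<delta> Xb X0 nn in auto)
    also have "\<dots> = err * ntail x" unfolding err by (simp add: algebra_simps)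
    finally show ?thesis .
  qed
  have sqrt_\<delta>: "sqrt (\<delta>\<^sup>2) = \<delta>" using \<delta> by simp

  \<comment> \<open>Reduction of the self-normalized event to the linearized sum\<close>
  have sandwich: "x \<le> self_normalized T s k \<omega> \<Longrightarrow> x - \<theta> / X \<le> Z \<omega>"
    "x + \<theta> / X \<le> Z \<omega> \<Longrightarrow> x \<le> self_normalized T s k \<omega>"
    if \<omega>: "\<omega> \<in> space M" and q: "\<bar>Q \<omega> - 1\<bar> < \<gamma> / X" for \<omega>
  proof -
    have "\<gamma> / X \<le> 1 / 2" using \<gamma> X0 by (simp add: divide_le_eq)
    then have Q: "1 / 4 \<le> Q \<omega>" using q by linarith
    note sw = self_normalized_sandwich[OF A \<omega> Q[unfolded Q_def] small(3) x(1), folded Q_def]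
    define y where "y = sqrt (Q \<omega>)"
    have y: "0 \<le> y" "y\<^sup>2 = Q \<omega>" using Q by (auto simp: y_def)
    have "(Q \<omega> - 1)\<^sup>2 \<le> (\<gamma> / X)\<^sup>2" using power_mono[OF less_imp_le[OF q], of 2] by simp
    then have "1 + (Q \<omega> - 1) / 2 - (\<gamma> / X)\<^sup>2 / 2 \<le> y"
      using sqrt_lower_quadratic[OF y(1)] unfolding y(2) by linarith
    then have "x * (1 + (Q \<omega> - 1) / 2 - (\<gamma> / X)\<^sup>2 / 2) \<le> x * y" using x by (intro mult_left_mono)
    moreover have "x * ((\<gamma> / X)\<^sup>2 / 2) \<le> \<gamma>\<^sup>2 / (2 * X)"
    proof -
      have "x * ((\<gamma> / X)\<^sup>2 / 2) \<le> X * ((\<gamma> / X)\<^sup>2 / 2)" using x by (intro mult_right_mono) auto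
      also have "\<dots> = \<gamma>\<^sup>2 / (2 * X)" using X0 by (simp add: power2_eq_square)
      finally show ?thesis .
    qed
    moreover have "x * (1 + (Q \<omega> - 1) / 2 - (\<gamma> / X)\<^sup>2 / 2) = x + x / 2 * (Q \<omega> - 1) - x * ((\<gamma> / X)\<^sup>2 / 2)"
      by (simp add: algebra_simps)
    ultimately have lo: "x + x / 2 * (Q \<omega> - 1) - \<gamma>\<^sup>2 / (2 * X) \<le> x * y" by linarith
    have "x * y \<le> x * (1 + (Q \<omega> - 1) / 2)"
      using sqrt_upper_linear[OF y(1)] x unfolding y(2) by (intro mult_left_mono)
    then have hi: "x * y \<le> x + x / 2 * (Q \<omega> - 1)" by (simp add: algebra_simps)
    have x\<tau>: "x * \<tau> \<le> X * \<tau>" using x nn by (intro mult_right_mono)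
    show "x - \<theta> / X \<le> Z \<omega>" if "x \<le> self_normalized T s k \<omega>"
      using sw(1)[OF that] lo x\<tau> unfolding Z_eq \<theta>X y_def[symmetric] by linarith
    have "0 \<le> \<gamma>\<^sup>2 / (2 * X)" using X0 by simp
    then show "x \<le> self_normalized T s k \<omega>" if "x + \<theta> / X \<le> Z \<omega>"
      using that hi x\<tau> unfolding Z_eq \<theta>X y_def by (intro sw(2)) linarith
  qed
  have nt1: "0 \<le> ntail (- L)" "ntail (- L) \<le> 1" by (rule ntail_nonneg, rule ntail_le_1)
  have dx: "9 * (1 + x) * d * ntail x \<le> 18 * X * d * ntail x"
    using x d0 ntail_nonneg[of x] by (intro mult_right_mono) auto

  \<comment> \<open>Upper bound for the tail\<close>
  show ?upper
  proof -
    \<comment> \<open>Smoothing is centred \<open>L\<close> standard deviations below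
      \<open>y0\<close>, so on the event the smoothed indicator is at least
      \<open>ntail (- L)\<close>, which is close to 1.\<close>
    define y0 y where "y0 = x - \<theta> / X" and "y = y0 - \<delta> * L"
    have "P \<le> measure M ({\<omega> \<in> space M. y0 \<le> Z \<omega>} \<union> {\<omega> \<in> space M. \<gamma> / X \<le> \<bar>Q \<omega> - 1\<bar>})"
      unfolding P_def y0_def using sandwich(1) by (intro finite_measure_mono) (auto simp: not_le[symmetric])
    also have "\<dots> \<le> measure M {\<omega> \<in> space M. y0 \<le> Z \<omega>} + bad"
      unfolding bad_def by (intro measure_Un_le) auto
    finally have 1: "P \<le> measure M {\<omega> \<in> space M. y0 \<le> Z \<omega>} + bad" .
    have \<delta>2: "0 < \<delta>\<^sup>2" using \<delta> by simp
    have "measure M {\<omega> \<in> space M. y0 \<le> Z \<omega>} * ntail (- L) \<le> (\<integral>\<omega>. htail (\<delta>\<^sup>2) (y - Z \<omega>) \<partial>M)"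
    proof (rule measure_le_integral)
      show "bmeas M (\<lambda>\<omega>. htail (\<delta>\<^sup>2) (y - Z \<omega>))" by (intro bmeas_htail[OF \<delta>2] bmeas_diff bmeas_const bZ)
      fix \<omega> assume "y0 \<le> Z \<omega>"
      then have "y - Z \<omega> \<le> - L * \<delta>" by (simp add: y_def mult.commute)
      then have "(y - Z \<omega>) / \<delta> \<le> - L" using \<delta> by (simp add: pos_divide_le_eq)
      then show "ntail (- L) \<le> htail (\<delta>\<^sup>2) (y - Z \<omega>)" unfolding htail_def sqrt_\<delta> by (rule ntail_antimono)
    qed (auto simp: htail_def ntail_nonneg)
    also have "\<dots> \<le> htail (1 + \<delta>\<^sup>2) y + err * ntail x"
      using lindeberg[of y] d_eq \<delta>L unfolding y_def y0_def by (simp add: abs_le_iff)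
    also have "htail (1 + \<delta>\<^sup>2) y \<le> ntail (x - d)"
      unfolding htail_def
    proof (rule ntail_antimono)
      define r where "r = sqrt (1 + \<delta>\<^sup>2)"
      have r: "1 \<le> r" "r \<le> 1 + \<delta>\<^sup>2" unfolding r_def using self_le_power[of "1 + \<delta>\<^sup>2" 2] by (auto intro!: real_le_lsqrt)
      show "x - d \<le> y / r"
      proof (cases "0 \<le> y")
        case True
        \<comment> \<open>Returning from variance \<open>1 + \<delta>^2\<close> to 1 divides the
          threshold by \<open>r \<le> 1 + \<delta>^2\<close>. As \<open>y \<le> X\<close>, this
          lowers it by at most \<open>X * \<delta>^2\<close>, the last summand of
          \<open>d\<close>.\<close>
        have "y \<le> X" using True x \<theta> \<delta>L unfolding y_def y0_def by linarith
        have "(y - X * \<delta>\<^sup>2) * r \<le> y"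
        proof (cases "0 \<le> y - X * \<delta>\<^sup>2")
          case True
          then have "(y - X * \<delta>\<^sup>2) * r \<le> (y - X * \<delta>\<^sup>2) * (1 + \<delta>\<^sup>2)" using r by (intro mult_left_mono)
          also have "\<dots> = y + (y - X) * \<delta>\<^sup>2 - X * \<delta>\<^sup>2 * \<delta>\<^sup>2" by (simp add: algebra_simps)
          also have "\<dots> \<le> y"
          proof -
            have "(y - X) * \<delta>\<^sup>2 \<le> 0" using \<open>y \<le> X\<close> by (intro mult_nonpos_nonneg) auto
            moreover have "0 \<le> X * \<delta>\<^sup>2 * \<delta>\<^sup>2" using X0 by simp
            ultimately show ?thesis by linarith
          qed
          finally show ?thesis .
        next
          case False
          then have "(y - X * \<delta>\<^sup>2) * r \<le> 0" using r by (intro mult_nonpos_nonneg) auto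
          then show ?thesis using True by linarith
        qed
        then have "y - X * \<delta>\<^sup>2 \<le> y / r" using r by (simp add: pos_le_divide_eq)
        then show ?thesis unfolding d_eq y_def y0_def by linarith
      next
        case False
        then have "y * r \<le> y" using r mult_left_mono_neg[of 1 r y] by simp
        then have "y \<le> y / r" using r by (simp add: pos_le_divide_eq)
        then show ?thesis unfolding d_eq y_def y0_def using \<delta>L by linarith
      qed
    qed
    also have "ntail (x - d) \<le> ntail x + 18 * X * d * ntail x"
      using ntail_shift(1)[OF x(1) d0] dx by (simp add: distrib_right)
    finally have 2: "measure M {\<omega> \<in> space M. y0 \<le> Z \<omega>} * ntail (- L) \<le> ntail x + 18 * X * d * ntail x + err * ntail x"
      by simp
    have "P * ntail (- L) \<le> (measure M {\<omega> \<in> space M. y0 \<le> Z \<omega>} + bad) * ntail (- L)"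
      using 1 nt1 by (intro mult_right_mono)
    also have "\<dots> \<le> measure M {\<omega> \<in> space M. y0 \<le> Z \<omega>} * ntail (- L) + bad"
      using nt1 mult_left_mono[of "ntail (- L)" 1 bad] by (simp add: distrib_right bad_def)
    finally have "P * ntail (- L) \<le> ntail x + 18 * X * d * ntail x + err * ntail x + 108 * X * exp (- X\<^sup>2) * ntail x"
      using 2 bad_le by linarith
    then show ?thesis unfolding P_def by (simp add: distrib_right)
  qed

  \<comment> \<open>Lower bound for the tail\<close>
  show ?lower
  proof -
    define y0 y where "y0 = x + \<theta> / X" and "y = y0 + \<delta> * L"
    have "measure M {\<omega> \<in> space M. y0 \<le> Z \<omega>} \<le> measure M ({\<omega> \<in> space M. x \<le> self_normalized T s k \<omega>} \<union> {\<omega> \<in> space M. \<gamma> / X \<le> \<bar>Q \<omega> - 1\<bar>})"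
      unfolding y0_def using sandwich(2) by (intro finite_measure_mono) (auto simp: not_le[symmetric])
    also have "\<dots> \<le> P + bad"
      unfolding bad_def P_def by (intro measure_Un_le) auto
    finally have 1: "measure M {\<omega> \<in> space M. y0 \<le> Z \<omega>} \<le> P + bad" .
    have \<delta>2: "0 < \<delta>\<^sup>2" using \<delta> by simp
    \<comment> \<open>Off the event the smoothed indicator is evaluated at some
      \<open>w \<ge> L\<close>. Half of the exponent \<open>w^2 / 2\<close> yields the cutoff
      factor; the other half absorbs the tilt through
      \<open>x * w * \<delta> \<le> w^2 / 4 + x^2 * \<delta>^2\<close>.\<close>
    define Y where "Y \<omega> = exp (- L\<^sup>2 / 4) * exp (x\<^sup>2 * \<delta>\<^sup>2 - x * y) * exp (x * Z \<omega>)" for \<omega>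
    have bY: "bmeas M Y" unfolding Y_def by (intro bmeas_mult bmeas_const bmeas_exp bZ)
    have "ntail (x + d) \<le> htail (1 + \<delta>\<^sup>2) y"
      unfolding htail_def
    proof (rule ntail_antimono)
      have y: "0 \<le> y" unfolding y_def y0_def using x \<theta> \<delta>L by linarith
      have "1 \<le> sqrt (1 + \<delta>\<^sup>2)" by simp
      then have "y / sqrt (1 + \<delta>\<^sup>2) \<le> y" using y mult_left_mono[of 1 "sqrt (1 + \<delta>\<^sup>2)" y] by (simp add: pos_divide_le_eq add_pos_nonneg)
      then show "y / sqrt (1 + \<delta>\<^sup>2) \<le> x + d" unfolding d_eq y_def y0_def using \<delta>L by linarith
    qed
    moreover have "htail (1 + \<delta>\<^sup>2) y \<le> (\<integral>\<omega>. htail (\<delta>\<^sup>2) (y - Z \<omega>) \<partial>M) + err * ntail x"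
      using lindeberg[of y] d0 \<theta> \<delta>L unfolding y_def y0_def by (simp add: abs_le_iff)
    moreover have "(\<integral>\<omega>. htail (\<delta>\<^sup>2) (y - Z \<omega>) \<partial>M) \<le> measure M {\<omega> \<in> space M. y0 \<le> Z \<omega>} + (\<integral>\<omega>. Y \<omega> \<partial>M)"
    proof (rule integral_le_measure)
      show "bmeas M (\<lambda>\<omega>. htail (\<delta>\<^sup>2) (y - Z \<omega>))" by (intro bmeas_htail[OF \<delta>2] bmeas_diff bmeas_const bZ)
      show "htail (\<delta>\<^sup>2) (y - Z \<omega>) \<le> 1 + Y \<omega>" for \<omega>
        using ntail_le_1 by (simp add: htail_def Y_def add_increasing2)
      fix \<omega> assume "\<not> y0 \<le> Z \<omega>"
      define w where "w = (y - Z \<omega>) / \<delta>"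
      have w: "L \<le> w" "y - Z \<omega> = w * \<delta>"
        using \<delta> \<open>\<not> y0 \<le> Z \<omega>\<close> by (auto simp: w_def y_def pos_le_divide_eq mult.commute)
      have "ntail w \<le> exp (- w\<^sup>2 / 2)" using w L by (intro ntail_upper) linarith
      also have "\<dots> \<le> exp (- L\<^sup>2 / 4 + (x\<^sup>2 * \<delta>\<^sup>2 - x * y) + x * Z \<omega>)"
      proof -
        have "L\<^sup>2 \<le> w\<^sup>2" using w L by (intro power_mono) auto
        moreover have "0 \<le> (w / 2 - x * \<delta>)\<^sup>2" by simp
        then have "x * (w * \<delta>) \<le> w\<^sup>2 / 4 + x\<^sup>2 * \<delta>\<^sup>2" by (simp add: power2_eq_square algebra_simps)
        moreover have "x * (w * \<delta>) = x * y - x * Z \<omega>" unfolding w(2)[symmetric] by (simp add: algebra_simps)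
        ultimately show ?thesis by simp
      qed
      also have "\<dots> = Y \<omega>" unfolding Y_def by (simp only: exp_add)
      finally show "htail (\<delta>\<^sup>2) (y - Z \<omega>) \<le> Y \<omega>" unfolding htail_def sqrt_\<delta> w_def .
    qed (auto intro: bY)
    moreover have "(\<integral>\<omega>. Y \<omega> \<partial>M) \<le> 54 * X * exp (- L\<^sup>2 / 4) * ntail x"
    proof -
      have lap: "(\<integral>\<omega>. exp (x * Z \<omega>) \<partial>M) \<le> exp (x\<^sup>2 / 2 + 1)"
      proof -
        have "(\<integral>\<omega>. exp (x * Z \<omega>) \<partial>M)
          \<le> exp (real k / real k * (x * (X * \<beta>) + x\<^sup>2 / 2 * ((1 + x * (2 * \<epsilon>)) * (1 + (\<beta> + 6 * X * \<epsilon>)))))"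
          unfolding Z_def using k by (intro laplace_upper_sum[OF lin(1-3) x(1) xe2 _ Xb]) auto
        also have "\<dots> \<le> exp (x\<^sup>2 / 2 + 1)" using \<Gamma>(2) k by simp
        finally show ?thesis .
      qed
      have "(\<integral>\<omega>. Y \<omega> \<partial>M) = exp (- L\<^sup>2 / 4) * exp (x\<^sup>2 * \<delta>\<^sup>2 - x * y) * (\<integral>\<omega>. exp (x * Z \<omega>) \<partial>M)"
        unfolding Y_def by simp
      also have "\<dots> \<le> exp (- L\<^sup>2 / 4) * exp (x\<^sup>2 * \<delta>\<^sup>2 - x * y) * exp (x\<^sup>2 / 2 + 1)"
        by (intro mult_left_mono lap) auto
      also have "\<dots> = exp (- L\<^sup>2 / 4) * exp (x\<^sup>2 * \<delta>\<^sup>2 - x * y + (x\<^sup>2 / 2 + 1))"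
        by (simp only: exp_add mult.assoc)
      also have "\<dots> \<le> exp (- L\<^sup>2 / 4) * (54 * X * ntail x)"
      proof (intro mult_left_mono weight_le_ntail x)
        have "x * x \<le> x * y" unfolding y_def y0_def using x \<theta> \<delta>L by (intro mult_left_mono) auto
        moreover have "x\<^sup>2 * \<delta>\<^sup>2 \<le> X\<^sup>2 * \<delta>\<^sup>2" using x2 by (intro mult_right_mono) auto
        moreover have "0 \<le> X\<^sup>2 * \<beta>" "0 \<le> X ^ 3 * \<epsilon>" using X0 nn by auto
        ultimately show "x\<^sup>2 * \<delta>\<^sup>2 - x * y + (x\<^sup>2 / 2 + 1) \<le> 2 - x\<^sup>2 / 2"
          using small(4) unfolding power2_eq_square[of x] by linarith
      qed simp
      finally show ?thesis by (simp add: mult_ac)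
    qed
    moreover have "ntail x - 18 * X * d * ntail x \<le> ntail (x + d)"
      using ntail_shift(2)[OF x(1) d0] dx by (simp add: left_diff_distrib)
    ultimately have "ntail x - 18 * X * d * ntail x - err * ntail x - 54 * X * exp (- L\<^sup>2 / 4) * ntail x
        - 108 * X * exp (- X\<^sup>2) * ntail x \<le> P"
      using 1 bad_le by linarith
    then show ?thesis unfolding P_def by (simp add: left_diff_distrib)
  qed
qed

end

section \<open>Moderate deviations\<close>

context preserving
begin

lemma orbit_sum_tail_upper:
  assumes mean: "cond_in M T 0 0 \<eta>"
    and var: "cond_in M T ((1 - \<beta>) / real k) ((1 + \<beta>) / real k) (\<lambda>\<omega>. (\<eta> \<omega>)\<^sup>2)"
    and bd: "\<And>\<omega>. \<omega> \<in> space M \<Longrightarrow> \<bar>\<eta> \<omega>\<bar> \<le> \<epsilon>" and k: "0 < k"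
    and x: "0 \<le> x" "x * \<epsilon> \<le> 1" and nn: "0 \<le> \<epsilon>" "0 \<le> \<beta>"
  shows "measure M {\<omega> \<in> space M. y \<le> orbit_sum T \<eta> k \<omega>}
    \<le> exp (- x * y + x\<^sup>2 / 2 * ((1 + x * \<epsilon>) * (1 + \<beta>)))"
proof -
  have "measure M {\<omega> \<in> space M. y \<le> orbit_sum T \<eta> k \<omega>}
      \<le> exp (- x * y) * (\<integral>\<omega>. exp (x * orbit_sum T \<eta> k \<omega>) \<partial>M)"
    by (intro chernoff bmeas_orbit_sum cond_in_bmeas[OF mean] x(1))
  also have "(\<integral>\<omega>. exp (x * orbit_sum T \<eta> k \<omega>) \<partial>M) \<le> exp (x\<^sup>2 / 2 * ((1 + x * \<epsilon>) * (1 + \<beta>)))"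
    using laplace_upper_sum[OF _ var bd x _ order_refl nn(2,1), of k] mean k by simp
  finally show ?thesis by (simp only: exp_add) (simp add: mult_left_mono)
qed

text \<open>Exponential tilting: under the density \<open>exp (u * M)\<close> the sum concentrates around \<open>u\<close>, so the
  event \<open>M \<ge> u * (1 - h)\<close> carries at least half of the Laplace transform at \<open>u\<close>.\<close>

lemma orbit_sum_tail_lower:
  assumes mean: "cond_in M T 0 0 \<eta>"
    and var: "cond_in M T ((1 - \<beta>) / real k) ((1 + \<beta>) / real k) (\<lambda>\<omega>. (\<eta> \<omega>)\<^sup>2)"
    and bd: "\<And>\<omega>. \<omega> \<in> space M \<Longrightarrow> \<bar>\<eta> \<omega>\<bar> \<le> \<epsilon>" and k: "0 < k"
    and u: "0 \<le> u" "2 * u * \<epsilon> \<le> 1" "u\<^sup>2 \<le> real k" and nn: "0 \<le> \<epsilon>" "0 \<le> \<beta>" "\<beta> \<le> 1"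
    and h: "0 < h" "h < 1" and err: "\<beta> + 4 * u * \<epsilon> + u\<^sup>2 / real k \<le> h\<^sup>2 / 16" and big: "8 \<le> u\<^sup>2 * h\<^sup>2"
  shows "exp (- u\<^sup>2 / 2 - 2 * u\<^sup>2 * h) \<le> measure M {\<omega> \<in> space M. u * (1 - h) \<le> orbit_sum T \<eta> k \<omega>}"
proof -
  let ?S = "orbit_sum T \<eta> k"
  have b\<eta>: "bmeas M \<eta>" by (rule cond_in_bmeas[OF mean])
  have bS: "bmeas M ?S" by (rule bmeas_orbit_sum[OF b\<eta>])
  have [measurable]: "?S \<in> borel_measurable M" using bS by (rule bmeas_measurable)
  have ue: "0 \<le> u * \<epsilon>" "u * \<epsilon> \<le> 1" using u nn by auto
  have uk: "0 \<le> u\<^sup>2 / real k" by simp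
  let ?E = "u\<^sup>2 / 2 - u\<^sup>2 * h\<^sup>2 / 8"
  have lower: "exp (u\<^sup>2 / 2 - u\<^sup>2 * h\<^sup>2 / 16) \<le> (\<integral>\<omega>. exp (u * ?S \<omega>) \<partial>M)"
  proof -
    have "exp (u\<^sup>2 / 2 * ((1 - u * \<epsilon>) * (1 - \<beta>)) - (u\<^sup>2)\<^sup>2 / real k) \<le> (\<integral>\<omega>. exp (u * ?S \<omega>) \<partial>M)"
      by (rule laplace_lower_sum[OF mean var bd u(1) ue(2) u(3) k nn])
    moreover have "u\<^sup>2 / 2 - u\<^sup>2 * h\<^sup>2 / 16 \<le> u\<^sup>2 / 2 * ((1 - u * \<epsilon>) * (1 - \<beta>)) - (u\<^sup>2)\<^sup>2 / real k"
    proof -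
      have "1 - \<beta> - u * \<epsilon> \<le> (1 - u * \<epsilon>) * (1 - \<beta>)" using ue nn by (simp add: algebra_simps)
      then have "u\<^sup>2 / 2 * (1 - \<beta> - u * \<epsilon>) \<le> u\<^sup>2 / 2 * ((1 - u * \<epsilon>) * (1 - \<beta>))" by (intro mult_left_mono) auto
      moreover have "(b + e) / 2 + v \<le> w" if "b + 4 * e + v \<le> w" "0 \<le> b" "0 \<le> e" for b e v w :: real
      proof -
        have "(b + e) / 2 \<le> b + 4 * e" using that by (simp add: field_simps)
        then show ?thesis using that by linarith
      qed
      from this[OF _ nn(2) ue(1)] have "(\<beta> + u * \<epsilon>) / 2 + u\<^sup>2 / real k \<le> h\<^sup>2 / 16"
        using err by (simp only: mult.assoc)
      then have "u\<^sup>2 * ((\<beta> + u * \<epsilon>) / 2 + u\<^sup>2 / real k) \<le> u\<^sup>2 * (h\<^sup>2 / 16)"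
        by (intro mult_left_mono) auto
      ultimately show ?thesis by (simp add: field_simps power2_eq_square)
    qed
    ultimately show ?thesis by (meson exp_le_cancel_iff order_trans)
  qed
  \<comment> \<open>Used at \<open>t = h\<close> and \<open>t = - h\<close>: changing the tilt
    slightly in either direction controls the mass on either side of the window around
    \<open>u\<close>.\<close>
  have tilt: "(\<integral>\<omega>. exp ((u * (1 + t)) * ?S \<omega>) \<partial>M) \<le> exp ((u * (1 + t))\<^sup>2 / 2 + u\<^sup>2 * h\<^sup>2 / 8)"
    if t: "\<bar>t\<bar> \<le> h" for t
  proof -
    have t1: "0 \<le> 1 + t" "1 + t \<le> 2" using t h by auto
    have ut: "0 \<le> u * (1 + t)" using u t1 by simp
    have "u * \<epsilon> * (1 + t) \<le> u * \<epsilon> * 2" using ue t1 by (intro mult_left_mono)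
    then have ute: "u * (1 + t) * \<epsilon> \<le> 2 * u * \<epsilon>" by (simp add: mult_ac)
    then have ute1: "u * (1 + t) * \<epsilon> \<le> 1" using u by linarith
    have "(\<integral>\<omega>. exp ((u * (1 + t)) * ?S \<omega>) \<partial>M)
        \<le> exp ((u * (1 + t))\<^sup>2 / 2 * ((1 + u * (1 + t) * \<epsilon>) * (1 + \<beta>)))"
      using laplace_upper_sum[OF _ var bd ut ute1 _ order_refl nn(2,1), of k] mean k by simp
    moreover have "(u * (1 + t))\<^sup>2 / 2 * ((1 + u * (1 + t) * \<epsilon>) * (1 + \<beta>)) \<le> (u * (1 + t))\<^sup>2 / 2 + u\<^sup>2 * h\<^sup>2 / 8"
    proof -
      define w where "w = u * (1 + t) * \<epsilon>"
      have "w * \<beta> \<le> w * 1" unfolding w_def using ut nn by (intro mult_left_mono) auto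
      moreover have "w \<le> 2 * u * \<epsilon>" unfolding w_def by (rule ute)
      moreover have "\<beta> + 4 * u * \<epsilon> \<le> h\<^sup>2 / 16" by (rule order_trans[OF _ err]) simp
      moreover have "(1 + w) * (1 + \<beta>) = 1 + \<beta> + w + w * \<beta>" by (simp add: algebra_simps)
      ultimately have "(1 + w) * (1 + \<beta>) \<le> 1 + h\<^sup>2 / 16" by linarith
      then have "(1 + u * (1 + t) * \<epsilon>) * (1 + \<beta>) \<le> 1 + h\<^sup>2 / 16" unfolding w_def .
      then have "(u * (1 + t))\<^sup>2 / 2 * ((1 + u * (1 + t) * \<epsilon>) * (1 + \<beta>)) \<le> (u * (1 + t))\<^sup>2 / 2 * (1 + h\<^sup>2 / 16)"
        by (intro mult_left_mono) auto
      also have "\<dots> = (u * (1 + t))\<^sup>2 / 2 + (u\<^sup>2 * (1 + t)\<^sup>2) * (h\<^sup>2 / 32)"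
      proof -
        have "a / 2 * (1 + b / 16) = a / 2 + a * (b / 32)" for a b :: real by (simp add: field_simps)
        then show ?thesis by (simp only: power_mult_distrib)
      qed
      also have "(u\<^sup>2 * (1 + t)\<^sup>2) * (h\<^sup>2 / 32) \<le> (u\<^sup>2 * 2\<^sup>2) * (h\<^sup>2 / 32)"
        using t1 by (intro mult_right_mono mult_left_mono power_mono) auto
      finally show ?thesis by simp
    qed
    ultimately show ?thesis by (meson exp_le_cancel_iff order_trans)
  qed
  define p where "p = measure M {\<omega> \<in> space M. u * (1 - h) \<le> ?S \<omega>}"
  \<comment> \<open>Above or below the window from \<open>u * (1 - h)\<close> to
    \<open>u * (1 + h)\<close>, the exponential is dominated by the one with the larger or smaller
    rate, normalized to agree at the edge; inside, its maximum is at the right end.\<close>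
  have point: "exp (u * z) \<le> exp (u\<^sup>2 * (1 + h)) * (if u * (1 - h) \<le> z then 1 else 0)
      + exp (- h * u * (u * (1 + h))) * exp (u * (1 + h) * z) + exp (h * u * (u * (1 - h))) * exp (u * (1 + - h) * z)" for z
  proof -
    have e1: "exp (- h * u * (u * (1 + h))) * exp (u * (1 + h) * z) = exp (u * z + h * u * (z - u * (1 + h)))"
      by (simp add: exp_add[symmetric] algebra_simps)
    have e2: "exp (h * u * (u * (1 - h))) * exp (u * (1 + - h) * z) = exp (u * z + h * u * (u * (1 - h) - z))"
      by (simp add: exp_add[symmetric] algebra_simps)
    have hu: "0 \<le> h * u" using h u by simp
    have i: "0 \<le> exp (u\<^sup>2 * (1 + h)) * (if u * (1 - h) \<le> z then 1 else 0)" by simp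
    have j: "0 \<le> exp (u * z + h * u * (z - u * (1 + h)))" "0 \<le> exp (u * z + h * u * (u * (1 - h) - z))" by auto
    consider "u * (1 + h) \<le> z" | "z < u * (1 - h)" | "u * (1 - h) \<le> z" "z \<le> u * (1 + h)" by linarith
    then show ?thesis
    proof cases
      case 1
      then have "exp (u * z) \<le> exp (u * z + h * u * (z - u * (1 + h)))" using hu by simp
      then show ?thesis unfolding e1 e2 using i j by linarith
    next
      case 2
      then have "exp (u * z) \<le> exp (u * z + h * u * (u * (1 - h) - z))" using hu by simp
      then show ?thesis unfolding e1 e2 using i j by linarith
    next
      case 3
      then have "u * z \<le> u\<^sup>2 * (1 + h)" using mult_left_mono[OF 3(2) u(1)] by (simp add: power2_eq_square mult.assoc)
      then have "exp (u * z) \<le> exp (u\<^sup>2 * (1 + h))" by simp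
      then have "exp (u * z) \<le> exp (u\<^sup>2 * (1 + h)) * (if u * (1 - h) \<le> z then 1 else 0)" using 3 by simp
      then show ?thesis unfolding e1 e2 using j by linarith
    qed
  qed
  let ?I = "indicator {\<omega> \<in> space M. u * (1 - h) \<le> ?S \<omega>} :: 'a \<Rightarrow> real"
  have bI: "bmeas M ?I" by (rule bmeas_indicator) measurable
  have bE: "bmeas M (\<lambda>\<omega>. exp (c * ?S \<omega>))" for c by (intro bmeas_exp bmeas_mult bmeas_const bS)
  have "(\<integral>\<omega>. exp (u * ?S \<omega>) \<partial>M) \<le> (\<integral>\<omega>. exp (u\<^sup>2 * (1 + h)) * ?I \<omega>
      + exp (- h * u * (u * (1 + h))) * exp (u * (1 + h) * ?S \<omega>) + exp (h * u * (u * (1 - h))) * exp (u * (1 + - h) * ?S \<omega>) \<partial>M)"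
  proof (intro integral_mono_bmeas bmeas_add bmeas_mult bmeas_const bI bE)
    fix \<omega> assume "\<omega> \<in> space M"
    then have I\<omega>: "?I \<omega> = (if u * (1 - h) \<le> ?S \<omega> then 1 else 0)" by (simp add: indicator_def)
    show "exp (u * ?S \<omega>) \<le> exp (u\<^sup>2 * (1 + h)) * ?I \<omega>
      + exp (- h * u * (u * (1 + h))) * exp (u * (1 + h) * ?S \<omega>) + exp (h * u * (u * (1 - h))) * exp (u * (1 + - h) * ?S \<omega>)"
      unfolding I\<omega> by (rule point)
  qed
  also have "\<dots> = (\<integral>\<omega>. exp (u\<^sup>2 * (1 + h)) * ?I \<omega> + exp (- h * u * (u * (1 + h))) * exp (u * (1 + h) * ?S \<omega>) \<partial>M)
      + (\<integral>\<omega>. exp (h * u * (u * (1 - h))) * exp (u * (1 + - h) * ?S \<omega>) \<partial>M)"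
    by (intro Bochner_Integration.integral_add bmeas_integrable bmeas_add bmeas_mult bmeas_const bI bE)
  also have "(\<integral>\<omega>. exp (u\<^sup>2 * (1 + h)) * ?I \<omega> + exp (- h * u * (u * (1 + h))) * exp (u * (1 + h) * ?S \<omega>) \<partial>M)
      = (\<integral>\<omega>. exp (u\<^sup>2 * (1 + h)) * ?I \<omega> \<partial>M) + (\<integral>\<omega>. exp (- h * u * (u * (1 + h))) * exp (u * (1 + h) * ?S \<omega>) \<partial>M)"
    by (intro Bochner_Integration.integral_add bmeas_integrable bmeas_mult bmeas_const bI bE)
  also have "(\<integral>\<omega>. exp (u\<^sup>2 * (1 + h)) * ?I \<omega> \<partial>M) = exp (u\<^sup>2 * (1 + h)) * p"
    by (simp add: p_def)
  also have "(\<integral>\<omega>. exp (- h * u * (u * (1 + h))) * exp (u * (1 + h) * ?S \<omega>) \<partial>M) \<le> exp (u\<^sup>2 / 2 - u\<^sup>2 * h\<^sup>2 * (3 / 8))"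
  proof -
    have "(\<integral>\<omega>. exp (- h * u * (u * (1 + h))) * exp (u * (1 + h) * ?S \<omega>) \<partial>M)
        \<le> exp (- h * u * (u * (1 + h))) * exp ((u * (1 + h))\<^sup>2 / 2 + u\<^sup>2 * h\<^sup>2 / 8)"
      using tilt[of h] h by simp
    also have "\<dots> = exp (u\<^sup>2 / 2 - u\<^sup>2 * h\<^sup>2 * (3 / 8))"
      by (simp add: exp_add[symmetric] power2_eq_square field_simps)
    finally show ?thesis .
  qed
  also have "(\<integral>\<omega>. exp (h * u * (u * (1 - h))) * exp (u * (1 + - h) * ?S \<omega>) \<partial>M) \<le> exp (u\<^sup>2 / 2 - u\<^sup>2 * h\<^sup>2 * (3 / 8))"
  proof -
    have "(\<integral>\<omega>. exp (h * u * (u * (1 - h))) * exp (u * (1 + - h) * ?S \<omega>) \<partial>M)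
        \<le> exp (h * u * (u * (1 - h))) * exp ((u * (1 + - h))\<^sup>2 / 2 + u\<^sup>2 * h\<^sup>2 / 8)"
      using tilt[of "- h"] h by simp
    also have "\<dots> = exp (u\<^sup>2 / 2 - u\<^sup>2 * h\<^sup>2 * (3 / 8))"
      by (simp add: exp_add[symmetric] power2_eq_square field_simps)
    finally show ?thesis .
  qed
  finally have "exp (u\<^sup>2 / 2 - u\<^sup>2 * h\<^sup>2 / 16) \<le> exp (u\<^sup>2 * (1 + h)) * p + 2 * exp (u\<^sup>2 / 2 - u\<^sup>2 * h\<^sup>2 * (3 / 8))"
    using lower by linarith
  \<comment> \<open>The outer terms lose 3/8 of \<open>u^2 * h^2\<close> in the exponent, the lower
    bound only 1/16. The gap of 5/16 is at least 2 by \<open>big\<close>, and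
    \<open>exp 2 \<ge> 4\<close>, so the outer terms take at most half of the Laplace
    transform.\<close>
  moreover have "4 * exp (u\<^sup>2 / 2 - u\<^sup>2 * h\<^sup>2 * (3 / 8)) \<le> exp (u\<^sup>2 / 2 - u\<^sup>2 * h\<^sup>2 / 16)"
  proof -
    have "(2::real) \<le> exp 1" using exp_ge_add_one_self[of 1] by simp
    then have "2 * 2 \<le> exp 1 * exp (1::real)" by (intro mult_mono) auto
    also have "\<dots> = exp 2" by (simp add: exp_add[symmetric])
    finally have "4 * exp (u\<^sup>2 / 2 - u\<^sup>2 * h\<^sup>2 * (3 / 8)) \<le> exp 2 * exp (u\<^sup>2 / 2 - u\<^sup>2 * h\<^sup>2 * (3 / 8))"
      by (intro mult_right_mono) auto
    also have "\<dots> \<le> exp (u\<^sup>2 / 2 - u\<^sup>2 * h\<^sup>2 / 16)"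
      using big by (simp add: exp_add[symmetric])
    finally show ?thesis .
  qed
  ultimately have "exp (u\<^sup>2 / 2 - u\<^sup>2 * h\<^sup>2 / 16) / 2 \<le> exp (u\<^sup>2 * (1 + h)) * p" by linarith
  moreover have "exp (u\<^sup>2 * (1 + h)) * exp (- u\<^sup>2 / 2 - 2 * u\<^sup>2 * h) \<le> exp (u\<^sup>2 / 2 - u\<^sup>2 * h\<^sup>2 / 16) / 2"
  proof -
    have "u\<^sup>2 * h\<^sup>2 \<le> u\<^sup>2 * h" using h by (intro mult_left_mono) (auto simp: power2_eq_square)
    have "(2::real) \<le> exp 1" using exp_ge_add_one_self[of 1] by simp
    then have "exp (u\<^sup>2 * (1 + h)) * exp (- u\<^sup>2 / 2 - 2 * u\<^sup>2 * h) * 2 \<le> exp (u\<^sup>2 * (1 + h)) * exp (- u\<^sup>2 / 2 - 2 * u\<^sup>2 * h) * exp 1"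
      by (intro mult_left_mono) auto
    also have "\<dots> = exp (u\<^sup>2 / 2 - u\<^sup>2 * h + 1)"
      by (simp add: exp_add[symmetric] algebra_simps)
    also have "\<dots> \<le> exp (u\<^sup>2 / 2 - u\<^sup>2 * h\<^sup>2 / 16)"
      using \<open>u\<^sup>2 * h\<^sup>2 \<le> u\<^sup>2 * h\<close> big by simp
    finally show ?thesis by simp
  qed
  ultimately have "exp (u\<^sup>2 * (1 + h)) * exp (- u\<^sup>2 / 2 - 2 * u\<^sup>2 * h) \<le> exp (u\<^sup>2 * (1 + h)) * p" by linarith
  then show ?thesis by (simp add: p_def)
qed

end

section \<open>Asymptotics\<close>

lemma approx_array_mono:
  assumes A: "approx_array M T s k \<eta> \<epsilon> \<beta> \<tau> R" and "\<epsilon> \<le> \<epsilon>'" "\<beta> \<le> \<beta>'" "\<tau> \<le> \<tau>'" "R \<le> R'"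
    and "preserving M T"
  shows "approx_array M T s k \<eta> \<epsilon>' \<beta>' \<tau>' R'"
proof -
  interpret preserving M T by fact
  have "cond_in M T ((1 - \<beta>') / real k) ((1 + \<beta>') / real k) (\<lambda>\<omega>. (\<eta> \<omega>)\<^sup>2)"
    by (rule cond_in_weaken[of "(1 - \<beta>) / real k" "(1 + \<beta>) / real k"])
      (use assms in \<open>auto simp: approx_array_def intro!: divide_right_mono\<close>)
  moreover have "\<bar>\<eta> \<omega>\<bar> \<le> \<epsilon>' \<and> \<bar>orbit_sum T s k \<omega> - orbit_sum T \<eta> k \<omega>\<bar> \<le> R' \<and>
      \<bar>sqrt (orbit_sum T (\<lambda>\<omega>. (s \<omega>)\<^sup>2) k \<omega>) - sqrt (orbit_sum T (\<lambda>\<omega>. (\<eta> \<omega>)\<^sup>2) k \<omega>)\<bar> \<le> \<tau>'"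
    if "\<omega> \<in> space M" for \<omega>
    using A assms(2-5) that unfolding approx_array_def by (meson order_trans)
  ultimately show ?thesis
    using A assms(2-5) unfolding approx_array_def by (auto intro: order_trans)
qed

lemma ntail_at_bot: "(ntail \<longlongrightarrow> 1) at_bot"
proof -
  interpret real_distribution std_normal_distribution by (rule real_dist_normal_dist)
  have "((\<lambda>z. 1 - cdf std_normal_distribution z) \<longlongrightarrow> 1 - 0) at_bot"
    by (intro tendsto_intros cdf_lim_at_bot)
  then show ?thesis by (simp add: ntail_def[abs_def] std_normal_cdf_def)
qed

text \<open>At least one full block fits and the discarded remainder is shorter than a block, so at
  least half of the observations are kept.\<close>

lemma block_count_bounds:
  assumes "0 < m" "m \<le> n"
  shows "0 < n div m" "real n / 2 \<le> real (m * (n div m))" "real (m * (n div m)) \<le> real n"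
proof -
  show k: "0 < n div m" using assms by (simp add: div_greater_zero_iff)
  have "n < m * (n div m) + m" using assms dividend_less_times_div[of m n] by simp
  moreover have "m * 1 \<le> m * (n div m)" using k by (intro mult_le_mono) auto
  ultimately have "n \<le> 2 * (m * (n div m))" by linarith
  then have "real n \<le> real (2 * (m * (n div m)))" by (rule of_nat_mono)
  then show "real n / 2 \<le> real (m * (n div m))" by simp
  show "real (m * (n div m)) \<le> real n" by (rule of_nat_mono) simp
qed

context preserving
begin

lemma cramer_asymptotics:
  assumes decomp: "mg_decomposition M T g s2" and s2: "0 < s2" and g: "bmeas M g"
    and b: "b \<in> o(\<lambda>n. real n powr (1/14) / sqrt (ln (real n)))" and e: "0 < e"
  defines "m \<equiv> \<lambda>n. nat \<lfloor>real n powr (2/7)\<rfloor>"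
  shows "\<forall>\<^sub>F n in sequentially. \<forall>x\<in>{0..b n}.
     \<bar>measure M {\<omega> \<in> space M. x \<le> self_normalized (T ^^ m n) (orbit_sum T g (m n)) (n div m n) \<omega>} / ntail x - 1\<bar> < e"
proof -
  obtain C where C: "0 < C" and blocks: "\<And>m k. 0 < m \<Longrightarrow> 0 < k \<Longrightarrow>
       \<exists>\<eta>. approx_array M (T ^^ m) (\<lambda>\<omega>. orbit_sum T g m \<omega> / sqrt (s2 * real (m * k))) k \<eta>
         (C * real m / sqrt (real (m * k))) (C / real m) (C / sqrt (real m)) (C / sqrt (real (m * k)))"
    using approx_array_blocks[OF decomp s2 g] by blast
  define X where "X n = real n powr (1/14) / sqrt (ln (real n))" for n :: nat
  \<comment> \<open>The factor \<open>ln (ln n)\<close> eventually exceeds any multiple of the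
    unknown constant \<open>C\<close>. The sizes become explicit functions of \<open>n\<close>,
    whose limits can be computed mechanically.\<close>
  define \<epsilon> where "\<epsilon> n = ln (ln (real n)) * real n powr (-3/14)" for n :: nat
  define \<beta> where "\<beta> n = ln (ln (real n)) * real n powr (-2/7)" for n :: nat
  define \<tau> where "\<tau> n = ln (ln (real n)) * real n powr (-1/7)" for n :: nat
  define R where "R n = ln (ln (real n)) * real n powr (-1/2)" for n :: nat
  define h where "h n = 2 * real n powr (-5/7)" for n :: nat
  \<comment> \<open>The shift needs \<open>X * \<delta> * L\<close> small, the cubic error
    \<open>X * \<epsilon> / \<delta>^2\<close> small; up to \<open>ln (ln n)\<close> the logarithmic
    exponent 1/6 balances the two. \<open>\<gamma>\<close> tends to 0 but slowly enough for
    concentration of the quadratic variation, and \<open>L\<close> makes the cutoff factor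
    \<open>n powr (- 1/4)\<close>, which beats \<open>X\<close>.\<close>
  define \<delta> where "\<delta> n = real n powr (-1/14) * ln (real n) powr (-1/6)" for n :: nat
  define \<gamma> where "\<gamma> n = ln (real n) powr (-1/2)" for n :: nat
  define L where "L n = sqrt (ln (real n))" for n :: nat
  define d where "d n = ((\<gamma> n)\<^sup>2 / 2 + (X n)\<^sup>2 * \<tau> n + X n * R n) / X n + \<delta> n * L n + X n * (\<delta> n)\<^sup>2" for n
  define err where "err n = 108 * exp (9 / 2) * X n * (X n * \<beta> n + (X n + 1 / \<delta> n) * (\<beta> n + 6 * X n * \<epsilon> n)
        + 8 * (X n + 1 / \<delta> n)\<^sup>2 * \<epsilon> n + 2 * (X n + 1 / \<delta> n) ^ 3 * h n)" for n
  note defs = X_def \<epsilon>_def \<beta>_def \<tau>_def R_def h_def \<delta>_def \<gamma>_def L_def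
  have lims: "(\<lambda>n. X n * d n) \<longlonglongrightarrow> 0" "err \<longlonglongrightarrow> 0"
    "(\<lambda>n. X n * exp (- (X n)\<^sup>2)) \<longlonglongrightarrow> 0"
    unfolding d_def err_def defs by real_asymp+
  have lim_XL: "(\<lambda>n. X n * exp (- (L n)\<^sup>2 / 4)) \<longlonglongrightarrow> 0"
  proof (rule Lim_transform_eventually)
    show "(\<lambda>n. X n * real n powr (- 1/4)) \<longlonglongrightarrow> 0" unfolding X_def by real_asymp
    show "\<forall>\<^sub>F n in sequentially. X n * real n powr (- 1/4) = X n * exp (- (L n)\<^sup>2 / 4)"
      using eventually_gt_at_top[of 1] by eventually_elim (simp add: L_def powr_def)
  qed
  have lim_L: "(\<lambda>n. ntail (- L n)) \<longlonglongrightarrow> 1"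
  proof -
    have "filterlim (\<lambda>n. - L n) at_bot sequentially" unfolding L_def by real_asymp
    then show ?thesis by (rule filterlim_compose[OF ntail_at_bot])
  qed
  have "(\<lambda>n. (1 + 18 * (X n * d n) + err n + 108 * (X n * exp (- (X n)\<^sup>2))) / ntail (- L n)) \<longlonglongrightarrow> (1 + 18 * 0 + 0 + 108 * 0) / 1"
    by (intro tendsto_intros lims lim_L) simp
  then have up: "\<forall>\<^sub>F n in sequentially. (1 + 18 * (X n * d n) + err n + 108 * (X n * exp (- (X n)\<^sup>2))) / ntail (- L n) < 1 + e"
    using e by (intro order_tendstoD) auto
  have "(\<lambda>n. 1 - 18 * (X n * d n) - err n - 54 * (X n * exp (- (L n)\<^sup>2 / 4)) - 108 * (X n * exp (- (X n)\<^sup>2))) \<longlonglongrightarrow> 1 - 18 * 0 - 0 - 54 * 0 - 108 * 0"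
    by (intro tendsto_intros lims lim_XL)
  then have low: "\<forall>\<^sub>F n in sequentially. 1 - e < 1 - 18 * (X n * d n) - err n - 54 * (X n * exp (- (L n)\<^sup>2 / 4)) - 108 * (X n * exp (- (X n)\<^sup>2))"
    using e by (intro order_tendstoD) auto
  have ev: "\<forall>\<^sub>F n in sequentially. 1 \<le> X n" "\<forall>\<^sub>F n in sequentially. 1 \<le> L n"
    "\<forall>\<^sub>F n in sequentially. 0 < \<gamma> n" "\<forall>\<^sub>F n in sequentially. \<gamma> n \<le> X n / 2"
    "\<forall>\<^sub>F n in sequentially. 2 * X n ^ 3 * (\<epsilon> n)\<^sup>2 \<le> \<gamma> n"
    "\<forall>\<^sub>F n in sequentially. 2 * X n ^ 3 * \<beta> n / \<gamma> n + 8 * X n ^ 6 * (\<epsilon> n)\<^sup>2 / (\<gamma> n)\<^sup>2 \<le> 2"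
    "\<forall>\<^sub>F n in sequentially. h n \<le> (\<epsilon> n)\<^sup>2" "\<forall>\<^sub>F n in sequentially. h n \<le> (\<delta> n)\<^sup>2"
    "\<forall>\<^sub>F n in sequentially. 0 < \<delta> n" "\<forall>\<^sub>F n in sequentially. \<beta> n + 6 * X n * \<epsilon> n \<le> 1"
    "\<forall>\<^sub>F n in sequentially. 2 * X n * \<epsilon> n \<le> 1" "\<forall>\<^sub>F n in sequentially. \<tau> n < 1 / 2"
    "\<forall>\<^sub>F n in sequentially. (X n)\<^sup>2 * (\<delta> n)\<^sup>2 + 2 * (X n)\<^sup>2 * \<beta> n + 8 * X n ^ 3 * \<epsilon> n \<le> 1"
    unfolding defs by real_asymp+
  have dle: "\<forall>\<^sub>F n in sequentially. X n * d n \<le> 1"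
    using order_tendstoD(2)[OF lims(1), of 1] by (auto elim: eventually_mono)
  have big: "\<forall>\<^sub>F n in sequentially. 2 * C \<le> ln (ln (real n))"
  proof -
    have "filterlim (\<lambda>n. ln (ln (real n))) at_top sequentially" by real_asymp
    then show ?thesis by (simp add: filterlim_at_top)
  qed
  have ev2: "\<forall>\<^sub>F n in sequentially. 2 \<le> real n powr (2/7)" "\<forall>\<^sub>F n in sequentially. real n powr (2/7) \<le> real n"
    by real_asymp+
  \<comment> \<open>All thresholds up to \<open>b n\<close> lie below \<open>X n\<close>, and the
    bounds formed with \<open>X n\<close> do not depend on \<open>x\<close>; this gives
    uniformity.\<close>
  have bX: "\<forall>\<^sub>F n in sequentially. b n \<le> X n"
  proof -
    have "\<forall>\<^sub>F n in sequentially. norm (b n) \<le> 1 * norm (X n)"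
      unfolding X_def by (rule landau_o.smallD[OF b]) simp
    then show ?thesis using ev(1) by eventually_elim simp
  qed
  from up low ev dle big ev2 bX eventually_gt_at_top[of 0] show ?thesis
  proof eventually_elim
    case (elim n)
    have m: "real (m n) \<le> real n powr (2/7)" "real n powr (2/7) / 2 \<le> real (m n)" "0 < m n"
    proof -
      have "real (m n) = of_int \<lfloor>real n powr (2/7)\<rfloor>" using elim unfolding m_def by simp
      then show "real (m n) \<le> real n powr (2/7)" "real n powr (2/7) / 2 \<le> real (m n)" "0 < m n"
        using elim floor_correct[of "real n powr (2/7)"] by linarith+
    qed
    have mn: "m n \<le> n" using m(1) elim by linarith
    define k where "k = n div m n"
    note kb = block_count_bounds[OF m(3) mn, folded k_def]
    have n: "0 < real n" using elim by simp
    have sq2: "sqrt (real n) / 2 \<le> sqrt (real (m n * k))"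
    proof -
      have "sqrt (real n) / 2 = sqrt (real n / 4)" by (simp add: real_sqrt_divide)
      also have "\<dots> \<le> sqrt (real (m n * k))" using kb n by (intro real_sqrt_le_mono) linarith
      finally show ?thesis .
    qed
    have sqn: "sqrt (real n) = real n powr (1/2)" by (simp add: powr_half_sqrt)
    have inv: "1 / sqrt (real (m n * k)) \<le> 2 * real n powr (-1/2)"
    proof -
      have "1 / sqrt (real (m n * k)) \<le> 1 / (sqrt (real n) / 2)"
        using sq2 n kb m(3) by (intro divide_left_mono mult_pos_pos) auto
      also have "\<dots> = 2 * real n powr (-1/2)" using n by (simp add: sqn powr_minus_divide)
      finally show ?thesis .
    qed
    have R: "C / sqrt (real (m n * k)) \<le> R n"
    proof -
      have "C / sqrt (real (m n * k)) = C * (1 / sqrt (real (m n * k)))" by simp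
      also have "\<dots> \<le> C * (2 * real n powr (-1/2))" using inv C by (intro mult_left_mono) auto
      also have "\<dots> = 2 * C * real n powr (-1/2)" by simp
      also have "\<dots> \<le> R n" unfolding R_def using elim by (intro mult_right_mono) auto
      finally show ?thesis .
    qed
    have \<epsilon>: "C * real (m n) / sqrt (real (m n * k)) \<le> \<epsilon> n"
    proof -
      have "C * real (m n) / sqrt (real (m n * k)) = C * real (m n) * (1 / sqrt (real (m n * k)))" by simp
      also have "\<dots> \<le> C * real n powr (2/7) * (2 * real n powr (-1/2))"
        using inv C m(1) by (intro mult_mono) auto
      also have "\<dots> = 2 * C * (real n powr (2/7) * real n powr (-1/2))" by simp
      also have "real n powr (2/7) * real n powr (-1/2) = real n powr (-3/14)" by (simp add: powr_add[symmetric])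
      also have "2 * C * \<dots> \<le> \<epsilon> n" unfolding \<epsilon>_def using elim by (intro mult_right_mono) auto
      finally show ?thesis .
    qed
    have minv: "1 / real (m n) \<le> 2 * real n powr (-2/7)"
    proof -
      have "1 / real (m n) \<le> 1 / (real n powr (2/7) / 2)"
        using m elim by (intro divide_left_mono mult_pos_pos) auto
      also have "\<dots> = 2 * real n powr (-2/7)" using n by (simp add: powr_minus_divide)
      finally show ?thesis .
    qed
    have \<beta>: "C / real (m n) \<le> \<beta> n"
    proof -
      have "C / real (m n) = C * (1 / real (m n))" by simp
      also have "\<dots> \<le> C * (2 * real n powr (-2/7))" using minv C by (intro mult_left_mono) auto
      also have "\<dots> = 2 * C * real n powr (-2/7)" by simp
      also have "\<dots> \<le> \<beta> n" unfolding \<beta>_def using elim by (intro mult_right_mono) auto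
      finally show ?thesis .
    qed
    have \<tau>: "C / sqrt (real (m n)) \<le> \<tau> n"
    proof -
      have "sqrt (1 / real (m n)) \<le> sqrt (4 * real n powr (-2/7))"
        using minv by (intro real_sqrt_le_mono) (simp add: order_trans[OF minv])
      also have "\<dots> = 2 * real n powr (-1/7)"
        using n by (simp add: real_sqrt_mult powr_half_sqrt[symmetric] powr_powr)
      finally have "C * sqrt (1 / real (m n)) \<le> C * (2 * real n powr (-1/7))" using C by (intro mult_left_mono) auto
      also have "\<dots> = 2 * C * real n powr (-1/7)" by simp
      also have "\<dots> \<le> \<tau> n" unfolding \<tau>_def using elim by (intro mult_right_mono) auto
      finally show ?thesis by (simp add: real_sqrt_divide)
    qed
    have hk: "1 / real k \<le> h n"
    proof -
      have "real n / 2 \<le> real n powr (2/7) * real k"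
        using kb(2) mult_right_mono[OF m(1), of "real k"] by simp
      then have "1 / real k \<le> real n powr (2/7) / (real n / 2)"
        using kb(1) n by (simp add: field_simps)
      also have "\<dots> = 2 * (real n powr (2/7) * real n powr (-1))" using n by (simp add: powr_minus_divide)
      also have "real n powr (2/7) * real n powr (-1) = real n powr (-5/7)"
        by (subst powr_add[symmetric]) simp
      finally show ?thesis unfolding h_def .
    qed
    define B where "B = sqrt (s2 * real (m n * k))"
    have B: "0 < B" unfolding B_def using s2 m(3) kb(1) by simp
    let ?U = "T ^^ m n"
    interpret U: preserving M ?U by (rule iter_preserving)
    obtain \<eta> where "approx_array M ?U (\<lambda>\<omega>. orbit_sum T g (m n) \<omega> / B) k \<eta>
         (C * real (m n) / sqrt (real (m n * k))) (C / real (m n)) (C / sqrt (real (m n))) (C / sqrt (real (m n * k)))"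
      using blocks[OF m(3) kb(1)] unfolding B_def by blast
    then have A: "approx_array M ?U (\<lambda>\<omega>. orbit_sum T g (m n) \<omega> / B) k \<eta> (\<epsilon> n) (\<beta> n) (\<tau> n) (R n)"
      by (rule approx_array_mono[OF _ \<epsilon> \<beta> \<tau> R iter_preserving])
    show ?case
    proof
      fix x assume x: "x \<in> {0..b n}"
      then have x: "0 \<le> x" "x \<le> X n" using elim by auto
      have X0: "0 < X n" "0 \<le> X n" using elim by auto
      note cr = U.self_normalized_cramer[OF A x _ _ _ _ _ _ hk _ _ _ _ _ _ _ d_def _ err_def]
      define p where "p = measure M {\<omega> \<in> space M. x \<le> self_normalized ?U (orbit_sum T g (m n)) k \<omega>}"
      have nx: "0 < ntail x" and nL: "0 < ntail (- L n)" by (rule ntail_pos)+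
      have 1: "p * ntail (- L n) \<le> (1 + 18 * X n * d n + err n + 108 * X n * exp (- (X n)\<^sup>2)) * ntail x"
        and 2: "(1 - 18 * X n * d n - err n - 54 * X n * exp (- (L n)\<^sup>2 / 4) - 108 * X n * exp (- (X n)\<^sup>2)) * ntail x \<le> p"
        using cr elim unfolding p_def self_normalized_scale[OF B] by auto
      have "p / ntail x \<le> (1 + 18 * (X n * d n) + err n + 108 * (X n * exp (- (X n)\<^sup>2))) / ntail (- L n)"
        using 1 nx nL by (simp add: field_simps)
      moreover have "1 - 18 * (X n * d n) - err n - 54 * (X n * exp (- (L n)\<^sup>2 / 4)) - 108 * (X n * exp (- (X n)\<^sup>2)) \<le> p / ntail x"
        using 2 nx by (simp add: pos_le_divide_eq mult.assoc)
      ultimately have "\<bar>p / ntail x - 1\<bar> < e" using elim by (simp add: abs_less_iff)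
      then show "\<bar>measure M {\<omega> \<in> space M. x \<le> self_normalized (T ^^ m n) (orbit_sum T g (m n)) (n div m n) \<omega>} / ntail x - 1\<bar> < e"
        unfolding p_def k_def .
    qed
  qed
qed

end

context preserving
begin

lemma self_normalized_mdp:
  assumes A: "approx_array M T s k \<eta> \<epsilon> \<beta> \<tau> R"
    and \<theta>: "0 < \<theta>" "\<theta> \<le> 1 / 32" and x: "0 < x" and \<epsilon>: "0 < \<epsilon>"
    and small: "\<beta> + 8 * x * \<epsilon> + 4 * (x\<^sup>2 / real k) \<le> \<theta>\<^sup>2 / 16" "\<tau> \<le> \<theta>" "R \<le> x * \<theta>"
      "8 \<le> x\<^sup>2 * \<theta>\<^sup>2" "32 * (x * \<epsilon>)\<^sup>2 \<le> \<theta>\<^sup>2"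
  shows "exp (- (x\<^sup>2 / 2) * (1 + 26 * \<theta>)) \<le> measure M {\<omega> \<in> space M. x \<le> self_normalized T s k \<omega>}"
    "measure M {\<omega> \<in> space M. x \<le> self_normalized T s k \<omega>} \<le> exp (- (x\<^sup>2 / 2) * (1 - 9 * \<theta>))"
proof -
  have s: "bmeas M s" and k: "0 < k" and nn: "0 \<le> \<beta>" "0 \<le> \<tau>" "0 \<le> R"
    and mean: "cond_in M T 0 0 \<eta>"
    and var: "cond_in M T ((1 - \<beta>) / real k) ((1 + \<beta>) / real k) (\<lambda>\<omega>. (\<eta> \<omega>)\<^sup>2)"
    and bd: "\<And>\<omega>. \<omega> \<in> space M \<Longrightarrow> \<bar>\<eta> \<omega>\<bar> \<le> \<epsilon>"
    using A unfolding approx_array_def by auto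
  have b\<eta>: "bmeas M \<eta>" by (rule cond_in_bmeas[OF mean])
  define S where "S = orbit_sum T \<eta> k"
  define Q where "Q = orbit_sum T (\<lambda>\<omega>. (\<eta> \<omega>)\<^sup>2) k"
  have bS: "bmeas M S" and bQ: "bmeas M Q" unfolding S_def Q_def by (intro bmeas_orbit_sum bmeas_power b\<eta>)+
  have [measurable]: "S \<in> borel_measurable M" "Q \<in> borel_measurable M" "self_normalized T s k \<in> borel_measurable M"
    using bS bQ self_normalized_measurable[OF s] by (auto intro: bmeas_measurable)
  define p where "p = measure M {\<omega> \<in> space M. x \<le> self_normalized T s k \<omega>}"
  define bad where "bad = measure M {\<omega> \<in> space M. \<theta> \<le> \<bar>Q \<omega> - 1\<bar>}"
  have xe: "0 \<le> x * \<epsilon>" using x \<epsilon> by simp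
  have xk: "0 \<le> x\<^sup>2 / real k" by simp
  have \<theta>2: "\<theta>\<^sup>2 \<le> \<theta> / 32" using \<theta> mult_left_mono[of \<theta> "1/32" \<theta>] by (simp add: power2_eq_square)
  have sm: "\<beta> \<le> \<theta>\<^sup>2 / 16" "8 * (x * \<epsilon>) \<le> \<theta>\<^sup>2 / 16" "4 * (x\<^sup>2 / real k) \<le> \<theta>\<^sup>2 / 16"
    using small(1) nn xe xk by linarith+
  have \<beta>4: "\<beta> \<le> \<theta> / 4" "\<beta> \<le> 1" using sm(1) \<theta>2 \<theta> by linarith+
  have x2\<theta>: "8 \<le> x\<^sup>2 * \<theta> / 32"
    using small(4) mult_left_mono[OF \<theta>2, of "x\<^sup>2"] by simp
  have x2: "8 \<le> x\<^sup>2" using x2\<theta> mult_left_mono[OF \<theta>(2), of "x\<^sup>2"] by simp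
  have two: "2 \<le> exp (1::real)" using exp_ge_add_one_self[of 1] by simp
  have bad: "2 * bad \<le> exp (- x\<^sup>2)"
  proof -
    \<comment> \<open>Then \<open>c * \<epsilon>^2\<close> is \<open>\<theta> / 8\<close>: the
      variance error and the second-order term each cost at most a quarter of
      \<open>c * \<theta>\<close>. The remaining half is at least \<open>2 * x^2\<close> by the last
      smallness assumption.\<close>
    define c where "c = \<theta> / (8 * \<epsilon>\<^sup>2)"
    have c: "0 \<le> c" "c * \<epsilon>\<^sup>2 = \<theta> / 8" using \<theta> \<epsilon> by (auto simp: c_def)
    have c1: "c * \<epsilon>\<^sup>2 \<le> 1" using c \<theta> by simp
    have "bad \<le> 2 * exp (- c * \<theta> + c * \<beta> + 2 * c\<^sup>2 * \<epsilon>\<^sup>2)"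
      unfolding bad_def Q_def by (rule quadratic_concentration[OF var b\<eta> bd c(1) c1 k nn(1) \<beta>4(2)])
    also have "- c * \<theta> + c * \<beta> + 2 * c\<^sup>2 * \<epsilon>\<^sup>2 \<le> - 2 * x\<^sup>2"
    proof -
      have "2 * c\<^sup>2 * \<epsilon>\<^sup>2 = c * (\<theta> / 4)" using c(2) by (simp add: power2_eq_square mult.assoc)
      moreover have "c * \<beta> \<le> c * (\<theta> / 4)" by (rule mult_left_mono[OF \<beta>4(1) c(1)])
      moreover have "c * \<theta> / 2 = \<theta>\<^sup>2 / (16 * \<epsilon>\<^sup>2)" by (simp add: c_def power2_eq_square)
      moreover have "2 * x\<^sup>2 \<le> \<theta>\<^sup>2 / (16 * \<epsilon>\<^sup>2)"
        using small(5) \<epsilon> by (simp add: le_divide_eq power_mult_distrib mult_ac)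
      ultimately show ?thesis by linarith
    qed
    finally have "2 * bad \<le> (2 * 2) * exp (- 2 * x\<^sup>2)" by simp
    also have "\<dots> \<le> (exp 1 * exp 1) * exp (- 2 * x\<^sup>2)" using two by (intro mult_right_mono mult_mono) auto
    also have "\<dots> = exp (2 - 2 * x\<^sup>2)" by (simp add: exp_add[symmetric])
    also have "\<dots> \<le> exp (- x\<^sup>2)" using x2 by simp
    finally show ?thesis .
  qed
  have sandwich: "x \<le> self_normalized T s k \<omega> \<Longrightarrow> x * (1 - 3 * \<theta>) \<le> S \<omega>"
    "x * (1 + 3 * \<theta>) \<le> S \<omega> \<Longrightarrow> x \<le> self_normalized T s k \<omega>"
    if \<omega>: "\<omega> \<in> space M" and q: "\<bar>Q \<omega> - 1\<bar> < \<theta>" for \<omega>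
  proof -
    have Q: "1 / 4 \<le> Q \<omega>" "1 - \<theta> \<le> Q \<omega>" "Q \<omega> \<le> 1 + \<theta>" using q \<theta> by linarith+
    have "\<tau> < 1 / 2" using small(2) \<theta> by linarith
    note sw = self_normalized_sandwich[OF A \<omega> Q(1)[unfolded Q_def] this less_imp_le[OF x], folded Q_def S_def]
    have "(1 - \<theta>)\<^sup>2 \<le> Q \<omega>"
    proof -
      have "(1 - \<theta>)\<^sup>2 \<le> 1 - \<theta>" using \<theta> by (simp add: power2_eq_square mult_left_le)
      then show ?thesis using Q by linarith
    qed
    then have "1 - \<theta> \<le> sqrt (Q \<omega>)" by (rule real_le_rsqrt)
    moreover have "sqrt (Q \<omega>) \<le> 1 + \<theta>"
      using Q \<theta> self_le_power[of "1 + \<theta>" 2] by (intro real_le_lsqrt) auto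
    ultimately have xq: "x * (1 - \<theta>) \<le> x * sqrt (Q \<omega>)" "x * sqrt (Q \<omega>) \<le> x * (1 + \<theta>)"
      using x by auto
    have "x * \<tau> \<le> x * \<theta>" using small(2) x by simp
    with xq small(3) sw show "x \<le> self_normalized T s k \<omega> \<Longrightarrow> x * (1 - 3 * \<theta>) \<le> S \<omega>"
      "x * (1 + 3 * \<theta>) \<le> S \<omega> \<Longrightarrow> x \<le> self_normalized T s k \<omega>"
      by (auto simp: algebra_simps)
  qed
  have xe1: "x * \<epsilon> \<le> 1" using sm(2) \<theta>2 \<theta> by linarith
  have "p \<le> measure M ({\<omega> \<in> space M. x * (1 - 3 * \<theta>) \<le> S \<omega>} \<union> {\<omega> \<in> space M. \<theta> \<le> \<bar>Q \<omega> - 1\<bar>})"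
    unfolding p_def using sandwich(1) by (intro finite_measure_mono) (auto simp: not_le[symmetric])
  also have "\<dots> \<le> measure M {\<omega> \<in> space M. x * (1 - 3 * \<theta>) \<le> S \<omega>} + bad"
    unfolding bad_def by (intro measure_Un_le) auto
  also have "measure M {\<omega> \<in> space M. x * (1 - 3 * \<theta>) \<le> S \<omega>}
      \<le> exp (- x * (x * (1 - 3 * \<theta>)) + x\<^sup>2 / 2 * ((1 + x * \<epsilon>) * (1 + \<beta>)))"
    unfolding S_def by (rule orbit_sum_tail_upper[OF mean var bd k less_imp_le[OF x] xe1 less_imp_le[OF \<epsilon>] nn(1)])
  also have "- x * (x * (1 - 3 * \<theta>)) + x\<^sup>2 / 2 * ((1 + x * \<epsilon>) * (1 + \<beta>)) \<le> - (x\<^sup>2 / 2) * (1 - 8 * \<theta>)"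
  proof -
    have "x * \<epsilon> * \<beta> \<le> x * \<epsilon> * 1" using xe \<beta>4 by (intro mult_left_mono) auto
    moreover have "(1 + x * \<epsilon>) * (1 + \<beta>) = 1 + \<beta> + x * \<epsilon> + x * \<epsilon> * \<beta>" by (simp add: algebra_simps)
    ultimately have "(1 + x * \<epsilon>) * (1 + \<beta>) \<le> 1 + 2 * \<theta>" using sm \<theta>2 \<theta> by linarith
    then have "x\<^sup>2 / 2 * ((1 + x * \<epsilon>) * (1 + \<beta>)) \<le> x\<^sup>2 / 2 * (1 + 2 * \<theta>)" by (intro mult_left_mono) auto
    then show ?thesis by (simp add: power2_eq_square field_simps)
  qed
  finally have "p \<le> exp (- (x\<^sup>2 / 2) * (1 - 8 * \<theta>)) + bad" by simp
  moreover have "bad \<le> exp (- (x\<^sup>2 / 2) * (1 - 8 * \<theta>))"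
  proof -
    have "0 \<le> bad" unfolding bad_def by simp
    then have "bad \<le> exp (- x\<^sup>2)" using bad by linarith
    also have "\<dots> \<le> exp (- (x\<^sup>2 / 2) * (1 - 8 * \<theta>))" using \<theta> zero_le_power2[of x] by (simp add: algebra_simps)
    finally show ?thesis .
  qed
  ultimately have "p \<le> 2 * exp (- (x\<^sup>2 / 2) * (1 - 8 * \<theta>))" by linarith
  also have "\<dots> \<le> exp 1 * exp (- (x\<^sup>2 / 2) * (1 - 8 * \<theta>))" using two by (intro mult_right_mono) auto
  also have "\<dots> = exp (1 + - (x\<^sup>2 / 2) * (1 - 8 * \<theta>))" by (rule exp_add[symmetric])
  also have "\<dots> \<le> exp (- (x\<^sup>2 / 2) * (1 - 9 * \<theta>))"
    using x2\<theta> by (simp add: field_simps)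
  finally show "measure M {\<omega> \<in> space M. x \<le> self_normalized T s k \<omega>} \<le> exp (- (x\<^sup>2 / 2) * (1 - 9 * \<theta>))"
    unfolding p_def .
  \<comment> \<open>The tilt for which the window of \<open>orbit_sum_tail_lower\<close> starts
    exactly at the enlarged threshold \<open>x * (1 + 3 * \<theta>)\<close>.\<close>
  define u where "u = x * (1 + 3 * \<theta>) / (1 - \<theta>)"
  have u1: "u * (1 - \<theta>) = x * (1 + 3 * \<theta>)" using \<theta> by (simp add: u_def)
  have ux: "x \<le> u" using \<theta> x by (simp add: u_def pos_le_divide_eq mult_left_mono)
  have ux5: "u \<le> x * (1 + 5 * \<theta>)"
  proof -
    have "1 + 3 * \<theta> \<le> (1 + 5 * \<theta>) * (1 - \<theta>)" using \<theta>2 \<theta> by (simp add: power2_eq_square algebra_simps)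
    then have "x * (1 + 3 * \<theta>) \<le> x * ((1 + 5 * \<theta>) * (1 - \<theta>))" using x by (intro mult_left_mono) auto
    then show ?thesis unfolding u_def using \<theta> by (simp add: pos_divide_le_eq mult.assoc)
  qed
  have u0: "0 \<le> u" using ux x by linarith
  have u2x: "u \<le> 2 * x" using ux5 \<theta> mult_left_mono[of "1 + 5 * \<theta>" 2 x] x by linarith
  have usq: "u\<^sup>2 \<le> 4 * x\<^sup>2" using power_mono[OF u2x u0, of 2] by (simp add: power_mult_distrib)
  have uk: "u\<^sup>2 / real k \<le> 4 * (x\<^sup>2 / real k)" using usq k by (simp add: divide_right_mono)
  have ue: "u * \<epsilon> \<le> 2 * (x * \<epsilon>)" using mult_right_mono[OF u2x, of \<epsilon>] \<epsilon> by simp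
  have "exp (- u\<^sup>2 / 2 - 2 * u\<^sup>2 * \<theta>) \<le> measure M {\<omega> \<in> space M. u * (1 - \<theta>) \<le> orbit_sum T \<eta> k \<omega>}"
  proof (rule orbit_sum_tail_lower[OF mean var bd k u0 _ _ less_imp_le[OF \<epsilon>] nn(1) \<beta>4(2) \<theta>(1)])
    show "2 * u * \<epsilon> \<le> 1" using ue sm(2) \<theta>2 \<theta> by linarith
    have "u\<^sup>2 / real k \<le> 1" using uk sm(3) \<theta>2 \<theta> by linarith
    then show "u\<^sup>2 \<le> real k" using k by (simp add: divide_le_eq)
    show "\<beta> + 4 * u * \<epsilon> + u\<^sup>2 / real k \<le> \<theta>\<^sup>2 / 16" using ue uk small(1) by linarith
    have "x\<^sup>2 * \<theta>\<^sup>2 \<le> u\<^sup>2 * \<theta>\<^sup>2" using ux x by (intro mult_right_mono power_mono) auto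
    then show "8 \<le> u\<^sup>2 * \<theta>\<^sup>2" using small(4) by linarith
  qed (use \<theta> in auto)
  also have "\<dots> = measure M {\<omega> \<in> space M. x * (1 + 3 * \<theta>) \<le> S \<omega>}" unfolding u1 S_def ..
  also have "\<dots> \<le> measure M ({\<omega> \<in> space M. x \<le> self_normalized T s k \<omega>} \<union> {\<omega> \<in> space M. \<theta> \<le> \<bar>Q \<omega> - 1\<bar>})"
    using sandwich(2) by (intro finite_measure_mono) (auto simp: not_le[symmetric])
  also have "\<dots> \<le> p + bad"
    unfolding bad_def p_def by (intro measure_Un_le) auto
  finally have lo: "exp (- u\<^sup>2 / 2 - 2 * u\<^sup>2 * \<theta>) \<le> p + bad" .
  have "exp (- (x\<^sup>2 / 2) * (1 + 25 * \<theta>)) \<le> exp (- u\<^sup>2 / 2 - 2 * u\<^sup>2 * \<theta>)"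
  proof -
    have "(1 + 5 * \<theta>)\<^sup>2 * (1 + 4 * \<theta>) \<le> 1 + 25 * \<theta>"
    proof -
      have a: "(1 + 5 * \<theta>)\<^sup>2 \<le> 1 + 11 * \<theta>" using \<theta>2 \<theta> by (simp add: power2_eq_square algebra_simps)
      have "(1 + 5 * \<theta>)\<^sup>2 * (1 + 4 * \<theta>) \<le> (1 + 11 * \<theta>) * (1 + 4 * \<theta>)" using a \<theta> by (intro mult_right_mono) auto
      also have "\<dots> \<le> 1 + 25 * \<theta>" using \<theta>2 \<theta> by (simp add: power2_eq_square algebra_simps)
      finally show ?thesis .
    qed
    then have "x\<^sup>2 / 2 * ((1 + 5 * \<theta>)\<^sup>2 * (1 + 4 * \<theta>)) \<le> x\<^sup>2 / 2 * (1 + 25 * \<theta>)" by (intro mult_left_mono) auto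
    moreover have "u\<^sup>2 / 2 * (1 + 4 * \<theta>) \<le> (x * (1 + 5 * \<theta>))\<^sup>2 / 2 * (1 + 4 * \<theta>)"
      using power_mono[OF ux5 u0, of 2] \<theta> by (intro mult_right_mono divide_right_mono) auto
    moreover have "(x * (1 + 5 * \<theta>))\<^sup>2 / 2 * (1 + 4 * \<theta>) = x\<^sup>2 / 2 * ((1 + 5 * \<theta>)\<^sup>2 * (1 + 4 * \<theta>))"
      by (simp add: power_mult_distrib)
    moreover have "u\<^sup>2 / 2 * (1 + 4 * \<theta>) = u\<^sup>2 / 2 + 2 * u\<^sup>2 * \<theta>" by (simp add: field_simps)
    ultimately have "u\<^sup>2 / 2 + 2 * u\<^sup>2 * \<theta> \<le> x\<^sup>2 / 2 * (1 + 25 * \<theta>)" by linarith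
    then show ?thesis by simp
  qed
  moreover have "2 * bad \<le> exp (- (x\<^sup>2 / 2) * (1 + 25 * \<theta>))"
  proof -
    have "x\<^sup>2 / 2 * (1 + 25 * \<theta>) \<le> x\<^sup>2 / 2 * 2" using \<theta> by (intro mult_left_mono) auto
    then have "exp (- x\<^sup>2) \<le> exp (- (x\<^sup>2 / 2) * (1 + 25 * \<theta>))" by simp
    then show ?thesis using bad by linarith
  qed
  ultimately have "exp (- (x\<^sup>2 / 2) * (1 + 25 * \<theta>)) \<le> 2 * p" using lo by linarith
  moreover have "2 * exp (- (x\<^sup>2 / 2) * (1 + 26 * \<theta>)) \<le> exp (- (x\<^sup>2 / 2) * (1 + 25 * \<theta>))"
  proof -
    have "2 * exp (- (x\<^sup>2 / 2) * (1 + 26 * \<theta>)) \<le> exp 1 * exp (- (x\<^sup>2 / 2) * (1 + 26 * \<theta>))"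
      using two by (intro mult_right_mono) auto
    also have "\<dots> = exp (1 + - (x\<^sup>2 / 2) * (1 + 26 * \<theta>))" by (rule exp_add[symmetric])
    also have "\<dots> \<le> exp (- (x\<^sup>2 / 2) * (1 + 25 * \<theta>))" using x2\<theta> by (simp add: field_simps)
    finally show ?thesis .
  qed
  ultimately show "exp (- (x\<^sup>2 / 2) * (1 + 26 * \<theta>)) \<le> measure M {\<omega> \<in> space M. x \<le> self_normalized T s k \<omega>}"
    unfolding p_def by linarith
qed

text \<open>The summand bound is of order \<open>m / sqrt n\<close>, so its product with the
  threshold \<open>c / a n\<close> is, up to a constant, the reciprocal of the sequence assumed to
  diverge. Growth of \<open>m\<close> removes the variance and normalization errors.\<close>

lemma mdp_tail:
  assumes decomp: "mg_decomposition M T g s2" and s2: "0 < s2" and g: "bmeas M g"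
    and m: "\<forall>n\<ge>1. 1 \<le> m n \<and> m n \<le> n" "filterlim m at_top sequentially"
    and a: "a \<longlonglongrightarrow> 0" "filterlim (\<lambda>n. a n * real n powr (1/2) / real (m n)) at_top sequentially"
    and c: "0 < c" and h: "0 < h" "h \<le> 1"
  shows "\<forall>\<^sub>F n in sequentially.
    exp (- (c\<^sup>2 / 2) * (1 + h) / (a n)\<^sup>2) \<le> measure M {\<omega> \<in> space M. c / a n \<le> self_normalized (T ^^ m n) (orbit_sum T g (m n)) (n div m n) \<omega>} \<and>
    measure M {\<omega> \<in> space M. c / a n \<le> self_normalized (T ^^ m n) (orbit_sum T g (m n)) (n div m n) \<omega>} \<le> exp (- (c\<^sup>2 / 2) * (1 - h) / (a n)\<^sup>2)"
proof -
  obtain C where C: "0 < C" and blocks: "\<And>m k. 0 < m \<Longrightarrow> 0 < k \<Longrightarrow>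
       \<exists>\<eta>. approx_array M (T ^^ m) (\<lambda>\<omega>. orbit_sum T g m \<omega> / sqrt (s2 * real (m * k))) k \<eta>
         (C * real m / sqrt (real (m * k))) (C / real m) (C / sqrt (real m)) (C / sqrt (real (m * k)))"
    using approx_array_blocks[OF decomp s2 g] by blast
  \<comment> \<open>Small enough that the error coefficients 26 and 9 of
    \<open>self_normalized_mdp\<close> stay below \<open>h\<close>, and at most 1/32 because
    \<open>h \<le> 1\<close>.\<close>
  define \<theta> where "\<theta> = h / 32"
  have \<theta>: "0 < \<theta>" "\<theta> \<le> 1 / 32" using h by (auto simp: \<theta>_def)
  define K where "K n = n div m n" for n
  define x where "x n = c / a n" for n
  define \<epsilon> where "\<epsilon> n = C * real (m n) / sqrt (real (m n * K n))" for n
  \<comment> \<open>The sequence \<open>a\<close> is merely real; divergence to plus infinity forces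
    its eventual positivity.\<close>
  have pos: "\<forall>\<^sub>F n in sequentially. 0 < a n"
    using filterlim_at_top_dense[THEN iffD1, OF a(2), rule_format, of 0]
  proof eventually_elim
    case (elim n)
    show ?case
    proof (rule ccontr)
      assume "\<not> 0 < a n"
      then have "a n * real n powr (1/2) / real (m n) \<le> 0"
        by (intro divide_nonpos_nonneg mult_nonpos_nonneg) auto
      with elim show False by linarith
    qed
  qed
  have kb: "\<forall>\<^sub>F n in sequentially. 0 < m n \<and> 0 < K n \<and> real n / 2 \<le> real (m n * K n) \<and> 0 < n"
    using eventually_ge_at_top[of "1::nat"]
  proof eventually_elim
    case (elim n)
    then have "1 \<le> m n" "m n \<le> n" using m(1) by blast+
    then show ?case using block_count_bounds(1,2)[of "m n" n] elim unfolding K_def by linarith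
  qed
  have x_lim: "filterlim x at_top sequentially"
    unfolding x_def divide_inverse
    by (rule filterlim_tendsto_pos_mult_at_top[OF tendsto_const c filterlim_inverse_at_top[OF a(1) pos]])
  have xe_lim: "(\<lambda>n. x n * \<epsilon> n) \<longlonglongrightarrow> 0"
  proof (rule tendsto_sandwich[of "\<lambda>_. 0"])
    have "((\<lambda>n. 2 * C * c / (a n * real n powr (1/2) / real (m n))) \<longlongrightarrow> 0) sequentially"
      by (rule real_tendsto_divide_at_top[OF tendsto_const a(2)])
    then show "(\<lambda>n. 2 * C * c / (a n * real n powr (1/2) / real (m n))) \<longlonglongrightarrow> 0" .
    show "\<forall>\<^sub>F n in sequentially. 0 \<le> x n * \<epsilon> n"
      using pos by eventually_elim (use c C in \<open>auto simp: x_def \<epsilon>_def\<close>)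
    show "\<forall>\<^sub>F n in sequentially. x n * \<epsilon> n \<le> 2 * C * c / (a n * real n powr (1/2) / real (m n))"
      using pos kb
    proof eventually_elim
      case (elim n)
      have n: "0 < real n" using elim by simp
      have "sqrt (real n) / 2 = sqrt (real n / 4)" by (simp add: real_sqrt_divide)
      also have "\<dots> \<le> sqrt (real (m n * K n))" using elim n by (intro real_sqrt_le_mono) linarith
      finally have "1 / sqrt (real (m n * K n)) \<le> 1 / (sqrt (real n) / 2)"
        using n elim by (intro divide_left_mono mult_pos_pos) auto
      then have "(c / a n * (C * real (m n))) * (1 / sqrt (real (m n * K n))) \<le> (c / a n * (C * real (m n))) * (1 / (sqrt (real n) / 2))"
        using elim c C by (intro mult_left_mono) auto
      then show ?case unfolding x_def \<epsilon>_def by (simp add: powr_half_sqrt mult_ac)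
    qed
  qed simp
  have mr: "filterlim (\<lambda>n. real (m n)) at_top sequentially"
    by (rule filterlim_compose[OF filterlim_real_sequentially m(2)])
  have \<beta>_lim: "(\<lambda>n. C / real (m n)) \<longlonglongrightarrow> 0" by (rule real_tendsto_divide_at_top[OF tendsto_const mr])
  have \<tau>_lim: "(\<lambda>n. C / sqrt (real (m n))) \<longlonglongrightarrow> 0"
    by (rule real_tendsto_divide_at_top[OF tendsto_const filterlim_compose[OF sqrt_at_top mr]])
  \<comment> \<open>As the square of \<open>\<epsilon> n\<close> is \<open>C^2 * m / k\<close>, the
    ratio \<open>x^2 / k\<close> equals \<open>(x * \<epsilon>)^2 / (C^2 * m)\<close>; it is written
    with \<open>C / m\<close> so that the known limit applies.\<close>
  have xk_lim: "(\<lambda>n. (x n * \<epsilon> n)\<^sup>2 * (C / real (m n) / C ^ 3)) \<longlonglongrightarrow> 0\<^sup>2 * (0 / C ^ 3)"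
    using C by (intro tendsto_intros xe_lim \<beta>_lim) auto
  have "(\<lambda>n. C / real (m n) + 8 * (x n * \<epsilon> n) + 4 * ((x n * \<epsilon> n)\<^sup>2 * (C / real (m n) / C ^ 3))) \<longlonglongrightarrow> 0 + 8 * 0 + 4 * (0\<^sup>2 * (0 / C ^ 3))"
    by (intro tendsto_intros xe_lim \<beta>_lim xk_lim)
  then have e1: "\<forall>\<^sub>F n in sequentially. C / real (m n) + 8 * (x n * \<epsilon> n) + 4 * ((x n * \<epsilon> n)\<^sup>2 * (C / real (m n) / C ^ 3)) < \<theta>\<^sup>2 / 16"
    using \<theta> by (intro order_tendstoD) auto
  have e2: "\<forall>\<^sub>F n in sequentially. C / sqrt (real (m n)) < \<theta>"
    using \<tau>_lim \<theta> by (intro order_tendstoD) auto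
  have "(\<lambda>n. 32 * (x n * \<epsilon> n)\<^sup>2) \<longlonglongrightarrow> 32 * 0\<^sup>2" by (intro tendsto_intros xe_lim)
  then have e3: "\<forall>\<^sub>F n in sequentially. 32 * (x n * \<epsilon> n)\<^sup>2 < \<theta>\<^sup>2"
    by (rule order_tendstoD(2)) (use \<theta> in simp)
  have e4: "\<forall>\<^sub>F n in sequentially. 3 / \<theta> \<le> x n" "\<forall>\<^sub>F n in sequentially. 1 \<le> x n"
    using x_lim by (auto simp: filterlim_at_top)
  have e5: "\<forall>\<^sub>F n in sequentially. x n * \<epsilon> n < \<theta>" using xe_lim \<theta> by (intro order_tendstoD) auto
  from pos kb e1 e2 e3 e4 e5 show ?thesis
  proof eventually_elim
    case (elim n)
    have mk: "0 < m n" "0 < K n" using elim by auto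
    define B where "B = sqrt (s2 * real (m n * K n))"
    have B: "0 < B" unfolding B_def using s2 mk by simp
    let ?U = "T ^^ m n"
    interpret U: preserving M ?U by (rule iter_preserving)
    obtain \<eta> where A: "approx_array M ?U (\<lambda>\<omega>. orbit_sum T g (m n) \<omega> / B) (K n) \<eta>
         (\<epsilon> n) (C / real (m n)) (C / sqrt (real (m n))) (C / sqrt (real (m n * K n)))"
      using blocks[OF mk] unfolding B_def \<epsilon>_def by blast
    have x0: "0 < x n" using elim by linarith
    have \<epsilon>0: "0 < \<epsilon> n" unfolding \<epsilon>_def using C mk by simp
    have xk: "(x n)\<^sup>2 / real (K n) = (x n * \<epsilon> n)\<^sup>2 * (C / real (m n) / C ^ 3)"
      unfolding \<epsilon>_def using C mk by (simp add: power_mult_distrib power_divide power2_eq_square power3_eq_cube field_simps)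
    have R: "C / sqrt (real (m n * K n)) \<le> x n * \<theta>"
    proof -
      have "C / sqrt (real (m n * K n)) = C * 1 / sqrt (real (m n * K n))" by simp
      also have "\<dots> \<le> \<epsilon> n" unfolding \<epsilon>_def using mk C by (intro divide_right_mono mult_left_mono) auto
      also have "\<dots> \<le> x n * \<epsilon> n" using elim \<epsilon>0 by simp
      also have "\<dots> \<le> 1 * \<theta>" using elim by simp
      also have "\<dots> \<le> x n * \<theta>" using elim \<theta> by (intro mult_right_mono) auto
      finally show ?thesis .
    qed
    have big: "8 \<le> (x n)\<^sup>2 * \<theta>\<^sup>2"
    proof -
      have "3 \<le> x n * \<theta>" using elim \<theta> by (simp add: divide_le_eq)
      then have "3\<^sup>2 \<le> (x n * \<theta>)\<^sup>2" by (intro power_mono) auto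
      then show ?thesis by (simp add: power_mult_distrib)
    qed
    have small: "C / real (m n) + 8 * x n * \<epsilon> n + 4 * ((x n)\<^sup>2 / real (K n)) \<le> \<theta>\<^sup>2 / 16"
      unfolding xk using elim by (simp add: mult.assoc)
    note mdp = U.self_normalized_mdp[OF A \<theta> x0 \<epsilon>0 small _ R big]
    have "(x n)\<^sup>2 = c\<^sup>2 / (a n)\<^sup>2" by (simp add: x_def power_divide)
    then have ex: "- ((x n)\<^sup>2 / 2) * (1 + t) = - (c\<^sup>2 / 2) * (1 + t) / (a n)\<^sup>2" for t by simp
    let ?p = "measure M {\<omega> \<in> space M. c / a n \<le> self_normalized ?U (orbit_sum T g (m n)) (n div m n) \<omega>}"
    have 1: "exp (- (c\<^sup>2 / 2) * (1 + 26 * \<theta>) / (a n)\<^sup>2) \<le> ?p" "?p \<le> exp (- (c\<^sup>2 / 2) * (1 + - 9 * \<theta>) / (a n)\<^sup>2)"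
      using mdp elim unfolding self_normalized_scale[OF B] ex[symmetric] by (auto simp: x_def K_def)
    have mono: "exp (- (c\<^sup>2 / 2) * t / (a n)\<^sup>2) \<le> exp (- (c\<^sup>2 / 2) * t' / (a n)\<^sup>2)" if "t' \<le> t" for t t'
      using that by (simp add: divide_right_mono mult_left_mono)
    have "1 + 26 * \<theta> \<le> 1 + h" "1 - h \<le> 1 + - 9 * \<theta>" using h by (auto simp: \<theta>_def)
    then show ?case using 1 mono by (meson order_trans)
  qed
qed

end

section \<open>Large deviation principle\<close>

lemma filterlim_inverse_sq:
  fixes a :: "nat \<Rightarrow> real"
  assumes "a \<longlonglongrightarrow> 0" "\<forall>\<^sub>F n in sequentially. 0 < a n"
  shows "filterlim (\<lambda>n. 1 / (a n)\<^sup>2) at_top sequentially"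
proof -
  have "(\<lambda>n. (a n)\<^sup>2) \<longlonglongrightarrow> 0\<^sup>2" by (intro tendsto_intros assms)
  moreover have "\<forall>\<^sub>F n in sequentially. 0 < (a n)\<^sup>2" using assms(2) by eventually_elim simp
  ultimately show ?thesis unfolding divide_inverse mult_1 by (intro filterlim_inverse_at_top) simp_all
qed

context prob_space
begin

text \<open>The right tail has speed \<open>1 / a^2\<close> and rate \<open>c^2 / 2\<close>,
  expressed through exponentials to avoid logarithms of probabilities that might vanish. The left
  tail is the same property of the negated sequence.\<close>

definition gaussian_tail :: "(nat \<Rightarrow> real) \<Rightarrow> (nat \<Rightarrow> 'a \<Rightarrow> real) \<Rightarrow> bool" where
  "gaussian_tail a V \<longleftrightarrow> (\<forall>c>0. \<forall>h. 0 < h \<longrightarrow> h \<le> 1 \<longrightarrow> (\<forall>\<^sub>F n in sequentially.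
     exp (- (c\<^sup>2 / 2) * (1 + h) / (a n)\<^sup>2) \<le> measure M {\<omega> \<in> space M. c / a n \<le> V n \<omega>} \<and>
     measure M {\<omega> \<in> space M. c / a n \<le> V n \<omega>} \<le> exp (- (c\<^sup>2 / 2) * (1 - h) / (a n)\<^sup>2)))"

lemma gaussian_tailD:
  assumes "gaussian_tail a V" "0 < c" "0 < h" "h \<le> 1"
  shows "\<forall>\<^sub>F n in sequentially. exp (- (c\<^sup>2 / 2) * (1 + h) / (a n)\<^sup>2) \<le> measure M {\<omega> \<in> space M. c / a n \<le> V n \<omega>}"
    "\<forall>\<^sub>F n in sequentially. measure M {\<omega> \<in> space M. c / a n \<le> V n \<omega>} \<le> exp (- (c\<^sup>2 / 2) * (1 - h) / (a n)\<^sup>2)"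
proof -
  have E: "\<forall>\<^sub>F n in sequentially.
     exp (- (c\<^sup>2 / 2) * (1 + h) / (a n)\<^sup>2) \<le> measure M {\<omega> \<in> space M. c / a n \<le> V n \<omega>} \<and>
     measure M {\<omega> \<in> space M. c / a n \<le> V n \<omega>} \<le> exp (- (c\<^sup>2 / 2) * (1 - h) / (a n)\<^sup>2)"
    using assms unfolding gaussian_tail_def by blast
  show "\<forall>\<^sub>F n in sequentially. exp (- (c\<^sup>2 / 2) * (1 + h) / (a n)\<^sup>2) \<le> measure M {\<omega> \<in> space M. c / a n \<le> V n \<omega>}"
    by (rule eventually_mono[OF E]) (elim conjE)
  show "\<forall>\<^sub>F n in sequentially. measure M {\<omega> \<in> space M. c / a n \<le> V n \<omega>} \<le> exp (- (c\<^sup>2 / 2) * (1 - h) / (a n)\<^sup>2)"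
    by (rule eventually_mono[OF E]) (elim conjE)
qed

text \<open>The interval is a difference of two tails, and the one at \<open>w\<close> is
  exponentially smaller than the one at \<open>z\<close>.\<close>

lemma gaussian_tail_interval:
  assumes tail: "gaussian_tail a V" and V: "\<And>n. V n \<in> borel_measurable M"
    and a: "a \<longlonglongrightarrow> 0" "\<forall>\<^sub>F n in sequentially. 0 < a n" and z: "0 < z" "z < w" and t: "z\<^sup>2 / 2 < t"
  shows "\<forall>\<^sub>F n in sequentially. exp (- t / (a n)\<^sup>2) \<le> measure M {\<omega> \<in> space M. z \<le> a n * V n \<omega> \<and> a n * V n \<omega> < w}"
proof -
  have zw: "z\<^sup>2 < w\<^sup>2" using z by (intro power_strict_mono) auto
  have z2: "0 < z\<^sup>2" "0 < w\<^sup>2" using z by auto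
  \<comment> \<open>The second entry keeps the exponent at \<open>z\<close> below \<open>t\<close>;
    the third keeps it below the exponent at \<open>w\<close>, so that subtracting the farther tail
    costs at most a factor 2.\<close>
  define h where "h = min (1/2) (min ((t - z\<^sup>2 / 2) / z\<^sup>2) ((w\<^sup>2 - z\<^sup>2) / (4 * w\<^sup>2)))"
  have h: "0 < h" "h \<le> 1" using z2 zw t unfolding h_def by auto
  have ht: "z\<^sup>2 / 2 * (1 + h) < t"
  proof -
    have "h \<le> (t - z\<^sup>2 / 2) / z\<^sup>2" unfolding h_def by simp
    then have "z\<^sup>2 * h \<le> t - z\<^sup>2 / 2" using z2 by (simp add: le_divide_eq mult.commute)
    moreover have "0 < z\<^sup>2 * h" using z2 h by simp
    ultimately show ?thesis by (simp add: distrib_left)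
  qed
  have hw: "z\<^sup>2 / 2 * (1 + h) < w\<^sup>2 / 2 * (1 - h)"
  proof -
    have "h \<le> (w\<^sup>2 - z\<^sup>2) / (4 * w\<^sup>2)" unfolding h_def by simp
    then have "4 * w\<^sup>2 * h \<le> w\<^sup>2 - z\<^sup>2" using z2 by (simp add: le_divide_eq mult_ac)
    moreover have "z\<^sup>2 * h < w\<^sup>2 * h" using zw h by simp
    moreover have "0 < w\<^sup>2 * h" using z2 h by simp
    ultimately show ?thesis by (simp add: field_simps)
  qed
  define A1 A2 where "A1 = z\<^sup>2 / 2 * (1 + h)" and "A2 = w\<^sup>2 / 2 * (1 - h)"
  have d: "0 < A2 - A1" "0 < t - A1" using ht hw unfolding A1_def A2_def by auto
  note inv = filterlim_inverse_sq[OF a]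
  have "\<forall>\<^sub>F n in sequentially. 1 / (A2 - A1) \<le> 1 / (a n)\<^sup>2" "\<forall>\<^sub>F n in sequentially. 1 / (t - A1) \<le> 1 / (a n)\<^sup>2"
    using inv by (auto simp: filterlim_at_top)
  with gaussian_tailD(1)[OF tail z(1) h] gaussian_tailD(2)[OF tail less_trans[OF z] h] a(2)
  show ?thesis
  proof eventually_elim
    case (elim n)
    define I where "I = 1 / (a n)\<^sup>2"
    have Ie: "1 / (A2 - A1) \<le> I" "1 / (t - A1) \<le> I" using elim by (simp_all only: I_def)
    have [measurable]: "V n \<in> borel_measurable M" by (rule V)
    have "{\<omega> \<in> space M. z / a n \<le> V n \<omega>} = {\<omega> \<in> space M. z \<le> a n * V n \<omega> \<and> a n * V n \<omega> < w} \<union> {\<omega> \<in> space M. w / a n \<le> V n \<omega>}"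
    proof -
      have "z / a n \<le> V n \<omega> \<longleftrightarrow> z \<le> a n * V n \<omega>" "w / a n \<le> V n \<omega> \<longleftrightarrow> w \<le> a n * V n \<omega>" for \<omega>
        using elim by (auto simp: divide_le_eq mult.commute)
      then show ?thesis using z by auto
    qed
    then have "measure M {\<omega> \<in> space M. z / a n \<le> V n \<omega>}
        \<le> measure M {\<omega> \<in> space M. z \<le> a n * V n \<omega> \<and> a n * V n \<omega> < w} + measure M {\<omega> \<in> space M. w / a n \<le> V n \<omega>}"
      by (simp add: measure_Un_le)
    moreover have "exp (- (z\<^sup>2 / 2) * (1 + h) / (a n)\<^sup>2) = exp (- A1 * I)" "exp (- (w\<^sup>2 / 2) * (1 - h) / (a n)\<^sup>2) = exp (- A2 * I)"
      by (simp_all add: A1_def A2_def I_def)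
    ultimately have "exp (- A1 * I) \<le> measure M {\<omega> \<in> space M. z \<le> a n * V n \<omega> \<and> a n * V n \<omega> < w} + exp (- A2 * I)"
      using elim by linarith
    moreover have two: "2 \<le> exp (1::real)" using exp_ge_add_one_self[of 1] by simp
    have "2 * exp (- A2 * I) \<le> exp (- A1 * I)"
    proof -
      have "1 \<le> (A2 - A1) * I" using Ie d by (simp add: pos_divide_le_eq mult.commute)
      then have "1 + - A2 * I \<le> - A1 * I" by (simp add: algebra_simps)
      then have "exp 1 * exp (- A2 * I) \<le> exp (- A1 * I)" unfolding exp_add[symmetric] by simp
      then show ?thesis using mult_right_mono[OF two, of "exp (- A2 * I)"] exp_ge_zero[of "- A2 * I"] by linarith
    qed
    moreover have "2 * exp (- t * I) \<le> exp (- A1 * I)"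
    proof -
      have "1 \<le> (t - A1) * I" using Ie d by (simp add: pos_divide_le_eq mult.commute)
      then have "1 + - t * I \<le> - A1 * I" by (simp add: algebra_simps)
      then have "exp 1 * exp (- t * I) \<le> exp (- A1 * I)" unfolding exp_add[symmetric] by simp
      then show ?thesis using mult_right_mono[OF two, of "exp (- t * I)"] exp_ge_zero[of "- t * I"] by linarith
    qed
    ultimately have "exp (- t * I) \<le> measure M {\<omega> \<in> space M. z \<le> a n * V n \<omega> \<and> a n * V n \<omega> < w}" by linarith
    then show ?case by (simp add: I_def)
  qed
qed

lemma ln_ext_bounds:
  assumes "0 < q"
  shows "exp (- t / q) \<le> p \<Longrightarrow> ereal (- t) \<le> ereal q * ln_ext p"
    "0 \<le> p \<Longrightarrow> p \<le> exp (- t / q) \<Longrightarrow> ereal q * ln_ext p \<le> ereal (- t)"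
proof -
  show "ereal (- t) \<le> ereal q * ln_ext p" if "exp (- t / q) \<le> p"
  proof -
    have p: "0 < p" using that exp_gt_zero[of "- t / q"] by linarith
    then have "- t / q \<le> ln p" using that by (simp add: ln_ge_iff)
    then have "- t \<le> q * ln p" using mult_left_mono[of "- t / q" "ln p" q] assms by simp
    then show ?thesis using p by (simp add: ln_ext_def)
  qed
  show "ereal q * ln_ext p \<le> ereal (- t)" if "0 \<le> p" "p \<le> exp (- t / q)"
  proof (cases "p = 0")
    case True
    then show ?thesis using assms by (simp add: ln_ext_def)
  next
    case False
    then have "ln p \<le> - t / q" using that by (subst ln_exp[symmetric], subst ln_le_cancel_iff) auto
    then have "q * ln p \<le> - t" using mult_left_mono[of "ln p" "- t / q" q] assms by simp
    then show ?thesis using False by (simp add: ln_ext_def)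
  qed
qed

text \<open>The rate is even and increasing in the modulus. Hence for the upper bound
  \<open>B\<close> may be enclosed in the complement of a symmetric interval, that is, in two tails;
  the lower bound is local and treats one interior point at a time.\<close>

lemma ldp_from_tails:
  assumes tail: "gaussian_tail a V" "gaussian_tail a (\<lambda>n \<omega>. - V n \<omega>)" and V: "\<And>n. V n \<in> borel_measurable M"
    and a: "a \<longlonglongrightarrow> 0" "\<forall>\<^sub>F n in sequentially. 0 < a n" and B: "B \<in> sets borel"
  defines "r \<equiv> \<lambda>n. ereal ((a n)\<^sup>2) * ln_ext (measure M {\<omega> \<in> space M. a n * V n \<omega> \<in> B})"
  shows "- (INF x\<in>interior B. ereal (x\<^sup>2 / 2)) \<le> liminf r"
    "limsup r \<le> - (INF x\<in>closure B. ereal (x\<^sup>2 / 2))"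
proof -
  let ?p = "\<lambda>n. measure M {\<omega> \<in> space M. a n * V n \<omega> \<in> B}"
  have [measurable]: "V n \<in> borel_measurable M" "B \<in> sets borel" for n by (rule V, rule B)
  have V': "(\<lambda>\<omega>. - V n \<omega>) \<in> borel_measurable M" for n by measurable
  note inv = filterlim_inverse_sq[OF a]
  have q: "\<forall>\<^sub>F n in sequentially. 0 < (a n)\<^sup>2" using a(2) by eventually_elim simp
  have lower: "ereal (- t) \<le> liminf r" if ev: "\<forall>\<^sub>F n in sequentially. exp (- t / (a n)\<^sup>2) \<le> ?p n" for t
  proof (rule Liminf_bounded)
    show "\<forall>\<^sub>F n in sequentially. ereal (- t) \<le> r n"
      using ev q by eventually_elim (simp add: r_def ln_ext_bounds(1))
  qed
  have point: "ereal (- (z\<^sup>2 / 2)) \<le> liminf r" if z: "z \<in> interior B" for z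
  proof -
    obtain d where d: "0 < d" "ball z d \<subseteq> B" using z by (auto simp: mem_interior)
    have inB: "y \<in> B" if "\<bar>y - z\<bar> < d" for y
      using d(2) that by (auto simp: dist_real_def subset_iff abs_minus_commute)
    have "ereal (- t) \<le> liminf r" if t: "z\<^sup>2 / 2 < t" for t
    proof (rule lower)
      consider "0 < z" | "z < 0" | "z = 0" by linarith
      then show "\<forall>\<^sub>F n in sequentially. exp (- t / (a n)\<^sup>2) \<le> ?p n"
      proof cases
        case 1
        have zw: "z < z + d" using d by simp
        from gaussian_tail_interval[OF tail(1) V a 1 zw t] show ?thesis
        proof eventually_elim
          case (elim n)
          have "measure M {\<omega> \<in> space M. z \<le> a n * V n \<omega> \<and> a n * V n \<omega> < z + d} \<le> ?p n"
            by (intro finite_measure_mono) (auto intro!: inB)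
          then show ?case using elim by linarith
        qed
      next
        case 2
        have zw: "0 < - z" "- z < - z + d" "(- z)\<^sup>2 / 2 < t" using d 2 t by auto
        from gaussian_tail_interval[OF tail(2) V' a zw] show ?thesis
        proof eventually_elim
          case (elim n)
          have "measure M {\<omega> \<in> space M. - z \<le> a n * - V n \<omega> \<and> a n * - V n \<omega> < - z + d} \<le> ?p n"
            by (intro finite_measure_mono) (auto intro!: inB)
          then show ?case using elim by linarith
        qed
      next
        case 3
        \<comment> \<open>At the origin no tail estimate from below is needed: both tails beyond
          \<open>c\<close> eventually have probability at most 1/4, so a neighbourhood inside
          \<open>B\<close> keeps at least 1/2.\<close>
        define c where "c = d / 2"
        have c: "0 < c" "c < d" using d by (auto simp: c_def)
        have c2: "0 < c\<^sup>2" using c by simp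
        have t0: "0 < t" using t 3 by simp
        have "\<forall>\<^sub>F n in sequentially. 8 / c\<^sup>2 \<le> 1 / (a n)\<^sup>2" "\<forall>\<^sub>F n in sequentially. 1 / t \<le> 1 / (a n)\<^sup>2"
          using inv by (auto simp: filterlim_at_top)
        moreover have half: "0 < (1/2::real)" "(1/2::real) \<le> 1" by auto
        note gaussian_tailD(2)[OF tail(1) c(1) half] gaussian_tailD(2)[OF tail(2) c(1) half]
        ultimately show ?thesis
          using gaussian_tailD(2)[OF tail(1) c(1) half] gaussian_tailD(2)[OF tail(2) c(1) half] a(2)
        proof eventually_elim
          case (elim n)
          have two: "2 \<le> exp (1::real)" using exp_ge_add_one_self[of 1] by simp
          have e4: "exp (- 2) \<le> (1/4::real)"
          proof -
            have "2 * 2 \<le> exp 1 * exp (1::real)" using two by (intro mult_mono) auto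
            also have "\<dots> = exp 2" by (simp add: exp_add[symmetric])
            finally show ?thesis by (simp add: exp_minus divide_simps)
          qed
          have "- (c\<^sup>2 / 2) * (1 - 1/2) / (a n)\<^sup>2 = - (c\<^sup>2 / 4 * (1 / (a n)\<^sup>2))" by simp
          also have "\<dots> \<le> - (c\<^sup>2 / 4 * (8 / c\<^sup>2))" using elim(1) by (intro le_imp_neg_le mult_left_mono) auto
          also have "\<dots> = - 2" using c2 by simp
          finally have "exp (- (c\<^sup>2 / 2) * (1 - 1/2) / (a n)\<^sup>2) \<le> exp (- 2)" by simp
          then have small: "exp (- (c\<^sup>2 / 2) * (1 - 1/2) / (a n)\<^sup>2) \<le> 1/4" using e4 by linarith
          have "1 = measure M (space M)" by (simp add: prob_space)
          also have "space M = {\<omega> \<in> space M. \<bar>a n * V n \<omega>\<bar> < c} \<union> ({\<omega> \<in> space M. c / a n \<le> V n \<omega>} \<union> {\<omega> \<in> space M. c / a n \<le> - V n \<omega>})"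
            using elim by (auto simp: divide_le_eq mult.commute)
          also have "measure M \<dots> \<le> measure M {\<omega> \<in> space M. \<bar>a n * V n \<omega>\<bar> < c} + measure M ({\<omega> \<in> space M. c / a n \<le> V n \<omega>} \<union> {\<omega> \<in> space M. c / a n \<le> - V n \<omega>})"
            by (intro measure_Un_le) auto
          also have "measure M ({\<omega> \<in> space M. c / a n \<le> V n \<omega>} \<union> {\<omega> \<in> space M. c / a n \<le> - V n \<omega>})
              \<le> measure M {\<omega> \<in> space M. c / a n \<le> V n \<omega>} + measure M {\<omega> \<in> space M. c / a n \<le> - V n \<omega>}"
            by (intro measure_Un_le) auto
          also have "measure M {\<omega> \<in> space M. \<bar>a n * V n \<omega>\<bar> < c} \<le> ?p n"
            using c 3 by (intro finite_measure_mono) (auto intro!: inB)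
          finally have "1 \<le> ?p n + (1/4 + 1/4)" using elim small by linarith
          moreover have "exp (- t / (a n)\<^sup>2) \<le> 1/2"
          proof -
            have "1 \<le> t * (1 / (a n)\<^sup>2)" using elim t0 by (simp add: divide_le_eq mult.commute)
            then have "exp (- t / (a n)\<^sup>2) \<le> exp (- 1)" by simp
            also have "\<dots> \<le> 1/2" using two by (simp add: exp_minus divide_simps)
            finally show ?thesis .
          qed
          ultimately show ?case by linarith
        qed
      qed
    qed
    note above = this
    show ?thesis
    proof (rule ccontr)
      assume "\<not> ereal (- (z\<^sup>2 / 2)) \<le> liminf r"
      then have "liminf r < ereal (- (z\<^sup>2 / 2))" by (simp only: not_le)
      from ereal_dense2[OF this] obtain y where y: "liminf r < ereal y" "ereal y < ereal (- (z\<^sup>2 / 2))"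
        by blast
      have "ereal (- (- y)) \<le> liminf r" by (rule above) (use y(2) in simp)
      with y(1) show False by simp
    qed
  qed
  show "- (INF x\<in>interior B. ereal (x\<^sup>2 / 2)) \<le> liminf r"
  proof -
    have "- liminf r \<le> (INF x\<in>interior B. ereal (x\<^sup>2 / 2))"
      by (intro INF_greatest, subst ereal_uminus_le_reorder) (simp add: point)
    then show ?thesis by (simp add: ereal_uminus_le_reorder)
  qed
  \<comment> \<open>Covers the case of infimum 0, where the tail argument, which requires a positive
    level, gives nothing.\<close>
  have r0: "r n \<le> 0" for n
  proof (cases "?p n = 0")
    case True
    then show ?thesis by (simp add: r_def ln_ext_def)
  next
    case False
    then have "ln (?p n) \<le> 0" by (simp add: measure_nonneg order_less_le)
    then show ?thesis using False by (simp add: r_def ln_ext_def mult_nonneg_nonpos)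
  qed
  have upper: "limsup r \<le> ereal (- t')" if t': "0 < t'" "ereal t' < (INF x\<in>closure B. ereal (x\<^sup>2 / 2))" for t'
  proof -
    obtain t where t: "t' < t" "ereal t < (INF x\<in>closure B. ereal (x\<^sup>2 / 2))"
      using ereal_dense2[OF t'(2)] by auto
    define c where "c = sqrt (2 * t)"
    have t0: "0 < t" using t t' by simp
    have c: "0 < c" "c\<^sup>2 = 2 * t" using t0 by (auto simp: c_def)
    have Bc: "c \<le> \<bar>y\<bar>" if "y \<in> B" for y
    proof -
      have "ereal t < ereal (y\<^sup>2 / 2)"
        using t(2) INF_lower[of y "closure B" "\<lambda>x. ereal (x\<^sup>2 / 2)"] that closure_subset by (meson less_le_trans subsetD)
      then have "c\<^sup>2 \<le> \<bar>y\<bar>\<^sup>2" using c by simp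
      then show ?thesis by (rule power2_le_imp_le) simp
    qed
    \<comment> \<open>Makes \<open>t * (1 - h)\<close> the midpoint of \<open>t'\<close> and
      \<open>t\<close>; the remaining half of the gap absorbs the factor 2 from adding the two
      tails.\<close>
    define h where "h = (t - t') / (2 * t)"
    have h: "0 < h" "h \<le> 1" using t t' t0 by (auto simp: h_def divide_le_eq)
    have th: "t * (1 - h) = (t + t') / 2" using t0 by (simp add: h_def field_simps)
    have pos: "0 < (t - t') / 2" using t by simp
    have "\<forall>\<^sub>F n in sequentially. 1 / ((t - t') / 2) \<le> 1 / (a n)\<^sup>2"
      using inv by (auto simp: filterlim_at_top)
    with gaussian_tailD(2)[OF tail(1) c(1) h] gaussian_tailD(2)[OF tail(2) c(1) h] a(2)
    have "\<forall>\<^sub>F n in sequentially. r n \<le> ereal (- t')"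
    proof eventually_elim
      case (elim n)
      define I where "I = 1 / (a n)\<^sup>2"
      have Ie: "1 / ((t - t') / 2) \<le> I" using elim by (simp only: I_def)
      have "{\<omega> \<in> space M. a n * V n \<omega> \<in> B} \<subseteq> {\<omega> \<in> space M. c / a n \<le> V n \<omega>} \<union> {\<omega> \<in> space M. c / a n \<le> - V n \<omega>}"
        using Bc elim by (force simp: divide_le_eq mult.commute abs_if split: if_splits)
      then have "?p n \<le> measure M ({\<omega> \<in> space M. c / a n \<le> V n \<omega>} \<union> {\<omega> \<in> space M. c / a n \<le> - V n \<omega>})"
        by (intro finite_measure_mono) auto
      also have "\<dots> \<le> measure M {\<omega> \<in> space M. c / a n \<le> V n \<omega>} + measure M {\<omega> \<in> space M. c / a n \<le> - V n \<omega>}"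
        by (intro measure_Un_le) auto
      finally have "?p n \<le> 2 * exp (- (c\<^sup>2 / 2) * (1 - h) / (a n)\<^sup>2)" using elim by linarith
      also have "- (c\<^sup>2 / 2) * (1 - h) / (a n)\<^sup>2 = - ((t + t') / 2) * I"
        unfolding th[symmetric] by (simp add: I_def c(2))
      also have "2 * exp (- ((t + t') / 2) * I) \<le> exp 1 * exp (- ((t + t') / 2) * I)"
        using exp_ge_add_one_self[of 1] by (intro mult_right_mono) auto
      also have "\<dots> = exp (1 + - ((t + t') / 2) * I)" by (rule exp_add[symmetric])
      also have "\<dots> \<le> exp (- t' / (a n)\<^sup>2)"
      proof -
        have "1 \<le> (t - t') / 2 * I" using Ie pos by (simp only: pos_divide_le_eq mult.commute)
        moreover have "(t - t') / 2 * I + t' * I = (t + t') / 2 * I" by (simp add: field_simps)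
        ultimately have "1 + - ((t + t') / 2) * I \<le> - (t' * I)" by (simp only: mult_minus_left)
        then show ?thesis by (simp add: I_def)
      qed
      finally show ?case unfolding r_def using elim by (intro ln_ext_bounds(2)) auto
    qed
    then show ?thesis by (rule Limsup_bounded)
  qed
  show "limsup r \<le> - (INF x\<in>closure B. ereal (x\<^sup>2 / 2))"
  proof (rule ccontr)
    assume "\<not> limsup r \<le> - (INF x\<in>closure B. ereal (x\<^sup>2 / 2))"
    then have "- limsup r < (INF x\<in>closure B. ereal (x\<^sup>2 / 2))"
      by (simp add: not_le ereal_uminus_less_reorder)
    then obtain t where t: "- limsup r < ereal t" "ereal t < (INF x\<in>closure B. ereal (x\<^sup>2 / 2))"
      using ereal_dense2 by blast
    have "limsup r \<le> 0" by (rule Limsup_bounded) (simp add: r0)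
    then have "0 \<le> - limsup r" by (simp add: ereal_0_le_uminus_iff)
    then have "0 < ereal t" using t(1) by (rule le_less_trans)
    then have "limsup r \<le> ereal (- t)" using upper t(2) by simp
    then have "ereal t \<le> - limsup r" using ereal_minus_le_minus[of "ereal (- t)" "limsup r"] by simp
    then show False using t(1) by simp
  qed
qed

end

section \<open>Sign change and time reversal of the observations\<close>

context preserving
begin

text \<open>Negating the observable negates the self-normalized sum and leaves the variance
  unchanged, so right-tail results also give the left tail.\<close>

lemma mg_decomposition_uminus:
  assumes "mg_decomposition M T g s2"
  shows "mg_decomposition M T (\<lambda>x. - g x) s2"
proof -
  obtain q p C \<rho> where qp: "bmeas M q" "bmeas M p" and C: "0 \<le> C" "0 \<le> \<rho>" "\<rho> < 1"
    and g: "\<forall>x\<in>space M. g x = q x + (p (T x) - p x)" and q: "cond_in M T 0 0 q"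
    and var: "\<forall>i. cond_in M (T ^^ Suc i) (s2 - C * \<rho> ^ i) (s2 + C * \<rho> ^ i) (\<lambda>x. (q x)\<^sup>2)"
    using assms unfolding mg_decomposition_def by blast
  have "cond_in M T 0 0 (\<lambda>x. - q x)" using cond_in_uminus[OF q] by simp
  moreover have "\<forall>x\<in>space M. - g x = - q x + (- p (T x) - - p x)" using g by simp
  moreover have "\<forall>i. cond_in M (T ^^ Suc i) (s2 - C * \<rho> ^ i) (s2 + C * \<rho> ^ i) (\<lambda>x. (- q x)\<^sup>2)"
    using var by simp
  ultimately show ?thesis
    unfolding mg_decomposition_def using qp C
    by (intro exI[of _ "\<lambda>x. - q x"] exI[of _ "\<lambda>x. - p x"] exI[of _ C] exI[of _ \<rho>] conjI bmeas_uminus)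
qed

end

lemma self_normalized_uminus: "self_normalized T (\<lambda>x. - s x) k \<omega> = - self_normalized T s k \<omega>"
  by (simp add: self_normalized_def orbit_sum_def sum_negf)

lemma orbit_sum_uminus: "orbit_sum T (\<lambda>x. - g x) m = (\<lambda>x. - orbit_sum T g m x)"
  by (simp add: orbit_sum_def sum_negf fun_eq_iff)

text \<open>The substitution \<open>l = m * j - i\<close> reverses the order inside a block. Block
  \<open>j\<close> becomes a forward orbit piece that starts \<open>k - j\<close> blocks after a
  common shift by \<open>n - m * k + 1\<close>, which accounts for the discarded remainder and for
  the observations starting at \<open>T\<close> rather than at the identity.\<close>

lemma block_sum_obs:
  assumes j: "1 \<le> j" "j \<le> k" and k: "m * k \<le> n"
  shows "block_sum (obs \<mu> T f n) m j y
    = orbit_sum T (\<lambda>x. f x - (\<integral>z. f z \<partial>\<mu>)) m (((T ^^ m) ^^ (k - j)) ((T ^^ (n - m * k + 1)) y))"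
proof -
  let ?g = "\<lambda>x. f x - (\<integral>z. f z \<partial>\<mu>)"
  have mj: "m * (j - 1) + m = m * j" using j by (cases j) auto
  have mjk: "m * j \<le> m * k" using j by simp
  have "block_sum (obs \<mu> T f n) m j y = (\<Sum>i\<in>{m * (j - 1) + 1..m * j}. ?g ((T ^^ (n - i + 1)) y))"
    by (simp add: block_sum_def obs_def)
  also have "\<dots> = (\<Sum>l<m. ?g ((T ^^ (n - (m * j - l) + 1)) y))"
    by (rule sum.reindex_bij_witness[of _ "\<lambda>l. m * j - l" "\<lambda>i. m * j - i"]) (use mj in auto)
  also have "\<dots> = (\<Sum>l<m. ?g ((T ^^ l) ((T ^^ (m * (k - j))) ((T ^^ (n - m * k + 1)) y))))"
  proof (intro sum.cong refl)
    fix l assume l: "l \<in> {..<m}"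
    have "m * (k - j) = m * k - m * j" by (rule diff_mult_distrib2)
    then have "n - (m * j - l) + 1 = l + (m * (k - j) + (n - m * k + 1))"
      using mj mjk k l unfolding lessThan_iff by linarith
    then have "(T ^^ (n - (m * j - l) + 1)) y = (T ^^ l) ((T ^^ (m * (k - j))) ((T ^^ (n - m * k + 1)) y))"
      by (simp only: funpow_add o_def)
    then show "?g ((T ^^ (n - (m * j - l) + 1)) y) = ?g ((T ^^ l) ((T ^^ (m * (k - j))) ((T ^^ (n - m * k + 1)) y)))"
      by (simp only:)
  qed
  finally show ?thesis by (simp add: orbit_sum_def funpow_mult)
qed

text \<open>Numerator and denominator are symmetric in the blocks, so reversing their order has no
  effect; only the common shift of the starting point remains.\<close>

lemma W_circ_eq:
  "W_circ \<mu> T f m n y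
    = self_normalized (T ^^ m) (orbit_sum T (\<lambda>x. f x - (\<integral>z. f z \<partial>\<mu>)) m) (n div m) ((T ^^ (n - m * (n div m) + 1)) y)"
proof -
  define k where "k = n div m"
  define y' where "y' = (T ^^ (n - m * k + 1)) y"
  define s where "s = orbit_sum T (\<lambda>x. f x - (\<integral>z. f z \<partial>\<mu>)) m"
  have mk: "m * k \<le> n" unfolding k_def by simp
  have bs: "block_sum (obs \<mu> T f n) m j y = s (((T ^^ m) ^^ (k - j)) y')" if "j \<in> {1..k}" for j
    unfolding s_def y'_def using that mk by (intro block_sum_obs) auto
  have re: "(\<Sum>j\<in>{1..k}. F (k - j)) = (\<Sum>i<k. F i)" for F :: "nat \<Rightarrow> real"
    by (rule sum.reindex_bij_witness[of _ "\<lambda>i. k - i" "\<lambda>j. k - j"]) auto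
  have "(\<Sum>j\<in>{1..k}. block_sum (obs \<mu> T f n) m j y) = orbit_sum (T ^^ m) s k y'"
    using re[of "\<lambda>i. s (((T ^^ m) ^^ i) y')"] bs by (simp add: orbit_sum_def)
  moreover have "(\<Sum>j\<in>{1..k}. (block_sum (obs \<mu> T f n) m j y)\<^sup>2) = orbit_sum (T ^^ m) (\<lambda>\<omega>. (s \<omega>)\<^sup>2) k y'"
    using re[of "\<lambda>i. (s (((T ^^ m) ^^ i) y'))\<^sup>2"] bs by (simp add: orbit_sum_def)
  ultimately show ?thesis
    unfolding W_circ_def block_self_normalized_def block_norm_def self_normalized_def k_def[symmetric]
      y'_def[symmetric] s_def[symmetric] by simp
qed

theorem proposition3p4:
  fixes \<mu> :: "real measure" and T f :: "real \<Rightarrow> real"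
  assumes "unit_prob \<mu>"
    and "measure_preserving \<mu> T"
    and "BV_contracting \<mu> T"
    and "f \<in> BV"
    and "asymp_var \<mu> T f > 0"
  shows
    "(\<forall>b :: nat \<Rightarrow> real.
        (\<forall>n. b n \<ge> 0) \<and> b \<in> o(\<lambda>n. real n powr (1/14) / sqrt (ln (real n))) \<longrightarrow>
        (\<forall>\<epsilon>>0. \<forall>\<^sub>F n in sequentially. \<forall>x\<in>{0..b n}.
           \<bar>measure \<mu> {y \<in> space \<mu>. W_circ \<mu> T f (nat \<lfloor>real n powr (2/7)\<rfloor>) n y \<ge> x}
              / (1 - std_normal_cdf x) - 1\<bar> < \<epsilon>))
     \<and>
     (\<forall>(m :: nat \<Rightarrow> nat) (a :: nat \<Rightarrow> real) (B :: real set).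
        (\<forall>n\<ge>1. 1 \<le> m n \<and> m n \<le> n) \<longrightarrow>
        filterlim m at_top sequentially \<longrightarrow>
        filterlim (\<lambda>n. real n powr (1/2) / real (m n)) at_top sequentially \<longrightarrow>
        a \<longlonglongrightarrow> 0 \<longrightarrow>
        filterlim (\<lambda>n. a n * real n powr (1/2) / real (m n)) at_top sequentially \<longrightarrow>
        B \<in> sets borel \<longrightarrow>
        (let r = (\<lambda>n. ereal ((a n)\<^sup>2) *
                      ln_ext (measure \<mu> {y \<in> space \<mu>. a n * W_circ \<mu> T f (m n) n y \<in> B}))
         in - (INF x\<in>interior B. ereal (x\<^sup>2 / 2)) \<le> liminf r \<and>
            liminf r \<le> limsup r \<and>
            limsup r \<le> - (INF x\<in>closure B. ereal (x\<^sup>2 / 2))))"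
proof -
  interpret prob_space \<mu> using assms(1) by (simp add: unit_prob_def)
  interpret unit_system \<mu> T
    using assms(1,2) by unfold_locales (auto simp: unit_prob_def measure_preserving_def)
  define g where "g = (\<lambda>x. f x - (\<integral>z. f z \<partial>\<mu>))"
  define s2 where "s2 = asymp_var \<mu> T f"
  have dec: "mg_decomposition \<mu> T g s2"
    unfolding g_def s2_def by (rule contracting_decomposition[OF assms(3,4)])
  have s2: "0 < s2" unfolding s2_def by (rule assms(5))
  have g: "bmeas \<mu> g" unfolding g_def by (intro bmeas_diff bmeas_const BV_bmeas assms(4))
  let ?W = "\<lambda>m n. self_normalized (T ^^ m) (orbit_sum T g m) (n div m)"
  have W_meas [measurable]: "?W m n \<in> borel_measurable \<mu>" for m n
  proof -
    interpret U: preserving \<mu> "T ^^ m" by (rule iter_preserving)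
    show ?thesis by (intro U.self_normalized_measurable bmeas_orbit_sum g)
  qed
  \<comment> \<open>The remaining shift is an iterate of \<open>T\<close> and preserves
    \<open>\<mu>\<close>, so it does not change the law of the self-normalized sum.\<close>
  have W_law: "measure \<mu> {y \<in> space \<mu>. P (W_circ \<mu> T f m n y)} = measure \<mu> {y \<in> space \<mu>. P (?W m n y)}"
    if [measurable]: "Measurable.pred borel P" for P m n
  proof -
    interpret U: preserving \<mu> "T ^^ (n - m * (n div m) + 1)" by (rule iter_preserving)
    show ?thesis unfolding W_circ_eq g_def[symmetric] by (rule U.prob_T) measurable
  qed
  have part1: "\<forall>\<epsilon>>0. \<forall>\<^sub>F n in sequentially. \<forall>x\<in>{0..b n}.
           \<bar>measure \<mu> {y \<in> space \<mu>. W_circ \<mu> T f (nat \<lfloor>real n powr (2/7)\<rfloor>) n y \<ge> x}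
              / (1 - std_normal_cdf x) - 1\<bar> < \<epsilon>"
    if b: "b \<in> o(\<lambda>n. real n powr (1/14) / sqrt (ln (real n)))" for b
  proof (intro allI impI)
    fix e :: real assume e: "0 < e"
    have law: "measure \<mu> {y \<in> space \<mu>. x \<le> W_circ \<mu> T f m n y} = measure \<mu> {y \<in> space \<mu>. x \<le> ?W m n y}" for x m n
      by (rule W_law) measurable
    show "\<forall>\<^sub>F n in sequentially. \<forall>x\<in>{0..b n}.
           \<bar>measure \<mu> {y \<in> space \<mu>. W_circ \<mu> T f (nat \<lfloor>real n powr (2/7)\<rfloor>) n y \<ge> x}
              / (1 - std_normal_cdf x) - 1\<bar> < e"
      unfolding law ntail_def[symmetric] by (rule cramer_asymptotics[OF dec s2 g b e])
  qed
  have part2: "- (INF x\<in>interior B. ereal (x\<^sup>2 / 2)) \<le> liminf r \<and> liminf r \<le> limsup r \<and>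
      limsup r \<le> - (INF x\<in>closure B. ereal (x\<^sup>2 / 2))"
    if m: "\<forall>n\<ge>1. 1 \<le> m n \<and> m n \<le> n" "filterlim m at_top sequentially"
      and a: "a \<longlonglongrightarrow> 0" "filterlim (\<lambda>n. a n * real n powr (1/2) / real (m n)) at_top sequentially"
      and B: "B \<in> sets borel"
      and r: "r = (\<lambda>n. ereal ((a n)\<^sup>2) * ln_ext (measure \<mu> {y \<in> space \<mu>. a n * W_circ \<mu> T f (m n) n y \<in> B}))"
    for m :: "nat \<Rightarrow> nat" and a :: "nat \<Rightarrow> real" and B :: "real set" and r
  proof -
    have a_pos: "\<forall>\<^sub>F n in sequentially. 0 < a n"
      using filterlim_at_top_dense[THEN iffD1, OF a(2), rule_format, of 0]
    proof eventually_elim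
      case (elim n)
      show ?case
      proof (rule ccontr)
        assume "\<not> 0 < a n"
        then have "a n * real n powr (1/2) / real (m n) \<le> 0"
          by (intro divide_nonpos_nonneg mult_nonpos_nonneg) auto
        with elim show False by linarith
      qed
    qed
    have tail: "gaussian_tail a (\<lambda>n. ?W (m n) n)"
      unfolding gaussian_tail_def using mdp_tail[OF dec s2 g m a] by blast
    \<comment> \<open>The left tail comes from the same estimate for \<open>- g\<close>, whose
      decomposition has the same variance.\<close>
    have tail': "gaussian_tail a (\<lambda>n \<omega>. - ?W (m n) n \<omega>)"
      unfolding gaussian_tail_def
      using mdp_tail[OF mg_decomposition_uminus[OF dec] s2 bmeas_uminus[OF g] m a]
      unfolding orbit_sum_uminus self_normalized_uminus by blast
    have law: "measure \<mu> {y \<in> space \<mu>. a n * W_circ \<mu> T f (m n) n y \<in> B} = measure \<mu> {y \<in> space \<mu>. a n * ?W (m n) n y \<in> B}" for n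
      by (rule W_law) (use B in \<open>measurable\<close>)
    note ldp = ldp_from_tails[OF tail tail' W_meas a(1) a_pos B]
    show ?thesis
      unfolding r law using ldp by (auto intro: Liminf_le_Limsup)
  qed
  show ?thesis (is "?L \<and> ?R")
  proof
    show ?L by (intro allI impI, elim conjE) (rule part1[rule_format])
    show ?R unfolding Let_def by (intro allI impI) (rule part2[OF _ _ _ _ _ refl])
  qed
qed

end
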